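(* Let $1<p<\infty$ and let $f\in H^p$ with $f(0)\neq 0$. Then, for any compact subset $K$ of $\mathbb{D}$, there exists $N\in\mathbb{N}$ such that the roots of $q_{n,p}[f]$ lie outside $K$ for all $n\ge N$.
   Context: $\mathbb{D}$ is the open unit disk. $H^p$ is the Hardy space of analytic functions on $\mathbb{D}$ with norm $\|f\|_p^p=\sup_{0<r<1}\frac1{2\pi}\int_0^{2\pi}|f(re^{i\theta})|^p\,d\theta$. $\mathcal{P}_n$ is the set of complex polynomials of degree at most $n$. For $f\in H^p$ with $f(0)\ne0$, the $n$-th optimal polynomial approximant $q_{n,p}[f]$ to $1/f$ in $H^p$ is the unique element of $\mathcal{P}_n$ with $\|1-q_{n,p}[f]f\|_p=\inf_{q\in\mathcal{P}_n}\|1-qf\|_p$. *)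

theory Defs
  imports "HOL-Complex_Analysis.Complex_Analysis"
begin

definition hardy_mean :: "real \<Rightarrow> (complex \<Rightarrow> complex) \<Rightarrow> real \<Rightarrow> real" where
  "hardy_mean p f r =
     1 / (2 * pi) * integral {0..2 * pi} (\<lambda>\<theta>. cmod (f (of_real r * cis \<theta>)) powr p)"

text \<open>Elements of the Hardy space are total functions on the complex plane, of which only the
  values in the open unit disk matter.\<close>

definition hardy_space :: "real \<Rightarrow> (complex \<Rightarrow> complex) set" where
  "hardy_space p =
     {f. f holomorphic_on ball 0 1 \<and> bdd_above (hardy_mean p f ` {0<..<1})}"

text \<open>The supremum is taken in the reals, so this is the Hardy norm only for members of
  \<^term>\<open>hardy_space p\<close>.\<close>

definition hardy_norm :: "real \<Rightarrow> (complex \<Rightarrow> complex) \<Rightarrow> real" where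
  "hardy_norm p f = (SUP r\<in>{0<..<1}. hardy_mean p f r) powr (1 / p)"

definition polys_upto :: "nat \<Rightarrow> complex poly set" where
  "polys_upto n = {q. degree q \<le> n}"

text \<open>The optimal polynomial approximant to \<open>1 / f\<close> of degree at most \<open>n\<close>; for \<open>1 < p\<close>,
  \<open>f\<close> in \<^term>\<open>hardy_space p\<close> and \<open>f 0 \<noteq> 0\<close> the minimizer exists and is unique.\<close>

definition opt_poly_approx :: "real \<Rightarrow> nat \<Rightarrow> (complex \<Rightarrow> complex) \<Rightarrow> complex poly" where
  "opt_poly_approx p n f =
     (THE q. q \<in> polys_upto n \<and>
        hardy_norm p (\<lambda>z. 1 - poly q z * f z) =
          (INF q'\<in>polys_upto n. hardy_norm p (\<lambda>z. 1 - poly q' z * f z)))"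

end

theory Submission imports Defs begin

text \<open>
  Let \<open>E\<close> be the closure in \<open>H\<^sup>p\<close> of the polynomial multiples of \<open>f\<close>, and let \<open>\<phi>\<close> be the point
  of \<open>E\<close> nearest to \<open>1\<close>. The norms of \<open>1 - q\<^sub>n f\<close> decrease to the distance from \<open>1\<close> to \<open>E\<close>, so by
  uniform convexity of the norm \<open>q\<^sub>n f\<close> converges to \<open>\<phi>\<close> in \<open>H\<^sup>p\<close> (\<open>opt_poly_approx_converges\<close>),
  hence locally uniformly in the disc. Dividing by \<open>f\<close> on circles that avoid its zeros and applying
  the maximum principle, one sees that \<open>q\<^sub>n\<close> itself converges locally uniformly, to a holomorphic
  \<open>G\<close> with \<open>\<phi> = G f\<close> (\<open>quotient_locally_uniform\<close>). It remains to see that \<open>G\<close> has no zero in the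
  disc: then \<open>\<bar>G\<bar>\<close> is bounded below on \<open>K\<close>, and so is \<open>\<bar>q\<^sub>n\<bar>\<close> for all large \<open>n\<close>.

  The reason is an explicit formula. Let \<open>J\<close> be the element of norm \<open>1\<close> of \<open>E\<close> with the largest
  positive value \<open>c\<close> at \<open>0\<close>; it is the inner function that generates \<open>E\<close>. Then
    \<open>\<phi> = 1 - (1 - c J)\<^bsup>2/p\<^esup>\<close>.
  What is used of \<open>J\<close> follows by perturbing it inside \<open>E\<close>: it satisfies \<open>\<bar>J\<bar> \<le> 1\<close> (\<open>J_le_1\<close>), and for
  \<open>v\<close> in \<open>E\<close> the means of \<open>cnj J v\<close> over circles tend to \<open>v(0) / c\<close> as the radius tends to \<open>1\<close>
  (\<open>pairing\<close>). The formula is then verified by convexity (\<open>minimizer_formula\<close>): with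
  \<open>k = (1 - c J)\<^bsup>2/p\<^esup>\<close> the gradient \<open>\<bar>k\<bar>\<^bsup>p-2\<^esup> cnj k = (1 - c cnj J) (1 - c J)\<^bsup>1-2/p\<^esup>\<close> of the \<open>p\<close>-th power of
  the modulus annihilates \<open>E\<close> in the limit.

  Since \<open>p > 1\<close>, the argument of \<open>(1 - c \<zeta>)\<^bsup>2/p\<^esup>\<close> stays below \<open>\<pi>\<close> in modulus for \<open>\<bar>\<zeta>\<bar> \<le> 1\<close>, so this power
  takes the value \<open>1\<close> only at \<open>\<zeta> = 0\<close> (\<open>power_branch\<close>), and \<open>J\<close> is \<open>\<phi>\<close> times a bounded holomorphic
  function. If \<open>G\<close> vanished at \<open>w\<close>, then \<open>\<phi>\<close>, and hence \<open>J\<close>, would be \<open>z - w\<close> times an element of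
  \<open>E\<close> (\<open>zero_divides_in_cyclic_subspace\<close>). Replacing the factor \<open>z - w\<close> by \<open>1 - cnj w z\<close>, which
  has the same modulus on the unit circle, would give an element of \<open>E\<close> of norm at most \<open>1\<close> whose value at
  \<open>0\<close> is larger in modulus than \<open>c\<close>, against the choice of \<open>J\<close> (\<open>no_zero_factor\<close>).

  The norm is handled through its \<open>p\<close>-th power, the supremum of the means of \<open>\<bar>v\<bar>\<^sup>p\<close> over circles. These
  means increase with the radius, so that pointwise inequalities between \<open>p\<close>-th powers integrate
  over circles and pass to the norm as the radius tends to \<open>1\<close>.
\<close>

section \<open>Convexity inequalities for powers of the modulus\<close>

lemma bernoulli_powr_strict:
  fixes x p :: real
  assumes "1 < p" "0 \<le> x" "x \<noteq> 1"
  shows "1 + p * (x - 1) < x powr p"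
proof (cases "x = 0 \<or> 1 + p * (x - 1) \<le> 0")
  case True
  then show ?thesis
    using assms by (cases "x = 0") (auto intro: le_less_trans[OF _ powr_gt_zero[THEN iffD2]])
next
  case False
  \<comment> \<open>\<open>x\<close> is the average of \<open>m\<close> and \<open>1\<close> with weights \<open>1/p\<close> and \<open>1 - 1/p\<close>: compare logarithms.\<close>
  define m where "m = 1 + p * (x - 1)"
  have x: "0 < x" and m: "0 < m" using False assms by (auto simp: m_def)
  have strict: "ln y < y - 1" if "0 < y" "y \<noteq> 1" for y :: real
    using ln_le_minus_one[of y] ln_eq_minus_one[of y] that by fastforce
  have "(1 / p) * ln (m / x) \<le> (1 / p) * (m / x - 1)"
    using ln_le_minus_one[of "m / x"] x m assms by (intro mult_left_mono) auto
  moreover have "(1 - 1 / p) * ln (1 / x) < (1 - 1 / p) * (1 / x - 1)"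
    using strict[of "1 / x"] x assms by (intro mult_strict_left_mono) auto
  moreover have "(1 / p) * (m / x - 1) + (1 - 1 / p) * (1 / x - 1) = 0"
    using x assms by (simp add: m_def field_simps)
  moreover have "(1 / p) * ln (m / x) + (1 - 1 / p) * ln (1 / x) = (1 / p) * ln m - ln x"
    using x m assms by (simp add: ln_div field_simps)
  ultimately have "(1 / p) * ln m < ln x" by linarith
  then have "ln m < p * ln x" using assms by (simp add: field_simps)
  then have "exp (ln m) < exp (p * ln x)" by simp
  then have "m < x powr p" using x m by (simp add: powr_def)
  then show ?thesis by (simp add: m_def)
qed

lemma bernoulli_powr:
  fixes x p :: real
  assumes "1 < p" "0 \<le> x"
  shows "1 + p * (x - 1) \<le> x powr p"
  using bernoulli_powr_strict[OF assms] by (cases "x = 1") auto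

text \<open>The convex function \<open>\<bar>a\<bar>\<^sup>p\<close> lies above its tangent plane at \<open>k\<close>. For \<open>a\<close> a positive multiple of \<open>k\<close> this is
  Bernoulli's inequality for \<open>\<bar>a\<bar> / \<bar>k\<bar>\<close>; rotating \<open>a\<close> only decreases the linear term. At \<open>k = 0\<close> the
  convention \<open>0 powr x = 0\<close> gives the right gradient, namely \<open>0\<close>.\<close>

lemma cmod_powr_tangent_strict:
  fixes a k :: complex
  assumes p: "1 < p" and ne: "a \<noteq> k"
  shows "cmod k powr p + p * (cmod k powr (p - 2) * Re (cnj k * (a - k))) < cmod a powr p"
proof (cases "k = 0")
  case True
  then show ?thesis using ne by simp
next
  case False
  define x where "x = cmod a / cmod k"
  have kp: "0 < cmod k" using False by simp
  have Re_kk: "Re (cnj k * (a - k)) = Re (cnj k * a) - (cmod k)\<^sup>2"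
    unfolding cmod_power2 by (simp add: algebra_simps power2_eq_square)
  have kpow: "cmod k powr p = cmod k powr (p - 2) * (cmod k)\<^sup>2"
    using kp by (simp add: powr_diff field_simps flip: powr_numeral)
  have ax: "cmod a powr p = cmod k powr p * x powr p"
    using kp by (simp add: x_def powr_divide)
  have lhs: "cmod k powr p + p * (cmod k powr (p - 2) * (cmod k * cmod a - (cmod k)\<^sup>2))
      = cmod k powr p * (1 + p * (x - 1))"
    unfolding kpow using kp by (simp add: x_def field_simps power2_eq_square)
  have le: "Re (cnj k * a) \<le> cmod k * cmod a"
    using complex_Re_le_cmod[of "cnj k * a"] by (simp add: norm_mult)
  show ?thesis
  proof (cases "x = 1")
    case False
    have "cmod k powr p + p * (cmod k powr (p - 2) * Re (cnj k * (a - k)))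
        \<le> cmod k powr p + p * (cmod k powr (p - 2) * (cmod k * cmod a - (cmod k)\<^sup>2))"
      unfolding Re_kk using p le by (intro add_left_mono mult_left_mono) auto
    also have "\<dots> < cmod k powr p * x powr p"
      unfolding lhs using kp bernoulli_powr_strict[OF p _ False]
      by (intro mult_strict_left_mono) (auto simp: x_def)
    finally show ?thesis using ax by simp
  next
    case True
    then have ak: "cmod a = cmod k" using kp by (simp add: x_def)
    have "Re (cnj k * a) \<noteq> (cmod k)\<^sup>2"
    proof
      assume eq: "Re (cnj k * a) = (cmod k)\<^sup>2"
      have "(cmod (a - k))\<^sup>2 = (cmod a)\<^sup>2 + (cmod k)\<^sup>2 - 2 * Re (cnj k * a)"
        unfolding cmod_power2 by (simp add: power2_eq_square algebra_simps)
      then have "(cmod (a - k))\<^sup>2 = 0" using ak eq by simp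
      then show False using ne by simp
    qed
    then have "Re (cnj k * a) - (cmod k)\<^sup>2 < 0"
      using le ak by (simp add: power2_eq_square)
    then have "p * (cmod k powr (p - 2) * (Re (cnj k * a) - (cmod k)\<^sup>2)) < 0"
      using p kp by (intro mult_pos_neg) auto
    then show ?thesis unfolding Re_kk ak by linarith
  qed
qed

lemma cmod_powr_tangent:
  fixes a k :: complex
  assumes "1 < p"
  shows "cmod k powr p + p * (cmod k powr (p - 2) * Re (cnj k * (a - k))) \<le> cmod a powr p"
  using cmod_powr_tangent_strict[OF assms, of a k] by (cases "a = k") auto

text \<open>The linear terms of the tangent inequalities for \<open>a\<close> and \<open>b\<close> at their midpoint cancel.\<close>

lemma cmod_powr_midpoint_strict:
  fixes a b :: complex
  assumes p: "1 < p" and "a \<noteq> b"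
  shows "cmod ((a + b) / 2) powr p < (cmod a powr p + cmod b powr p) / 2"
proof -
  define k where "k = (a + b) / 2"
  have "a - k = - (b - k)" by (simp add: k_def field_simps)
  then have opp: "Re (cnj k * (a - k)) = - Re (cnj k * (b - k))"
    by (metis mult_minus_right uminus_complex.sel(1))
  have "a \<noteq> k" using assms by (auto simp: k_def field_simps)
  from cmod_powr_tangent_strict[OF p this] cmod_powr_tangent[OF p, of k b]
  show ?thesis unfolding opp by (simp add: k_def)
qed

lemma cmod_powr_midpoint:
  fixes a b :: complex
  assumes "1 < p"
  shows "cmod ((a + b) / 2) powr p \<le> (cmod a powr p + cmod b powr p) / 2"
  using cmod_powr_midpoint_strict[OF assms, of a b] by (cases "a = b") auto

lemma powr_cmod_scale:
  "t > 0 \<Longrightarrow> cmod (of_real t * a) powr p = t powr p * cmod a powr p"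
  by (simp add: norm_mult powr_mult)

lemma continuous_on_cmod_powr:
  fixes h :: "'a :: t2_space \<Rightarrow> complex"
  assumes "1 < p" "continuous_on S h"
  shows "continuous_on S (\<lambda>x. cmod (h x) powr p)"
  by (intro continuous_on_powr' continuous_intros assms) (use assms in auto)

lemma powr_two_sum_pos:
  fixes a b :: complex
  assumes "(a, b) \<noteq> (0, 0)"
  shows "cmod a powr p + cmod b powr p > 0"
proof -
  have "cmod a powr p > 0 \<or> cmod b powr p > 0" using assms by auto
  then show ?thesis by (smt (verit) powr_ge_zero)
qed

text \<open>Uniform convexity in a pointwise form that can be integrated over circles. Both sides are
  homogeneous, so it suffices to look at pairs with \<open>\<bar>a\<bar>\<^sup>p + \<bar>b\<bar>\<^sup>p = 1\<close>. Those of them with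
  \<open>\<bar>a - b\<bar>\<^sup>p \<ge> \<epsilon>\<close> form a compact set, on which the convexity gap has a positive minimum.\<close>

lemma cmod_powr_uniform_convexity:
  assumes p: "1 < p" and e: "0 < \<epsilon>"
  shows "\<exists>C\<ge>0. \<forall>a b. cmod (a - b) powr p \<le> \<epsilon> * (cmod a powr p + cmod b powr p)
      + C * ((cmod a powr p + cmod b powr p) / 2 - cmod ((a + b) / 2) powr p)"
proof -
  define n where "n = (\<lambda>x :: complex \<times> complex. cmod (fst x) powr p + cmod (snd x) powr p)"
  define gap where "gap = (\<lambda>x. n x / 2 - cmod ((fst x + snd x) / 2) powr p)"
  define dst where "dst = (\<lambda>x :: complex \<times> complex. cmod (fst x - snd x) powr p)"
  define S where "S = {x. n x = 1}"
  define T where "T = {x \<in> S. \<epsilon> \<le> dst x}"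
  have cont: "continuous_on UNIV n" "continuous_on UNIV gap" "continuous_on UNIV dst"
    unfolding gap_def n_def dst_def
    by (intro continuous_intros continuous_on_cmod_powr p continuous_on_divide; simp)+
  have bound: "norm x \<le> 2" if "x \<in> S" for x
  proof -
    have "cmod (fst x) powr p \<le> 1" "cmod (snd x) powr p \<le> 1"
      using that unfolding S_def n_def by (smt (verit) powr_ge_zero mem_Collect_eq)+
    then have "cmod (fst x) \<le> 1" "cmod (snd x) \<le> 1"
      using powr_less_mono2[of p 1 "cmod (fst x)"] powr_less_mono2[of p 1 "cmod (snd x)"] p
      by (fastforce simp: not_le[symmetric])+
    then show ?thesis using norm_Pair_le[of "fst x" "snd x"] by simp
  qed
  have "closed T"
    unfolding T_def S_def Collect_conj_eq mem_Collect_eq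
    by (intro closed_Int closed_Collect_eq closed_Collect_le cont continuous_intros)
  moreover have "bounded T" using bound by (auto simp: bounded_iff T_def)
  ultimately have "compact T" by (simp add: compact_eq_bounded_closed)
  have gap0: "0 \<le> gap x" for x
    using cmod_powr_midpoint[OF p, of "fst x" "snd x"] by (simp add: gap_def n_def)
  have gap_pos: "0 < gap x" if "x \<in> T" for x
  proof -
    have "fst x \<noteq> snd x" using that e by (auto simp: T_def dst_def)
    from cmod_powr_midpoint_strict[OF p this] show ?thesis by (simp add: gap_def n_def)
  qed
  have "\<exists>C\<ge>0. \<forall>x\<in>S. dst x \<le> \<epsilon> + C * gap x"
  proof (cases "T = {}")
    case True
    then show ?thesis by (intro exI[of _ 0]) (force simp: T_def S_def)
  next
    case False
    obtain x0 where x0: "x0 \<in> T" "\<forall>x\<in>T. gap x0 \<le> gap x"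
      using continuous_attains_inf[OF \<open>compact T\<close> False continuous_on_subset[OF cont(2)]] by auto
    obtain x1 where x1: "x1 \<in> T" "\<forall>x\<in>T. dst x \<le> dst x1"
      using continuous_attains_sup[OF \<open>compact T\<close> False continuous_on_subset[OF cont(3)]] by auto
    have g0: "0 < gap x0" using gap_pos x0 by auto
    have d1: "0 \<le> dst x1" by (simp add: dst_def)
    show ?thesis
    proof (intro exI[of _ "dst x1 / gap x0"] conjI ballI)
      show "0 \<le> dst x1 / gap x0" using g0 d1 by simp
      fix x assume x: "x \<in> S"
      show "dst x \<le> \<epsilon> + dst x1 / gap x0 * gap x"
      proof (cases "x \<in> T")
        case True
        have "dst x \<le> dst x1 / gap x0 * gap x0" using x1 True g0 by simp
        also have "\<dots> \<le> dst x1 / gap x0 * gap x"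
          using x0 True g0 d1 by (intro mult_left_mono) auto
        finally show ?thesis using e by simp
      next
        case False
        then have "dst x \<le> \<epsilon>" using x by (auto simp: T_def)
        moreover have "0 \<le> dst x1 / gap x0 * gap x" using g0 d1 gap0 by simp
        ultimately show ?thesis by linarith
      qed
    qed
  qed
  then obtain C where C: "C \<ge> 0" "\<forall>x\<in>S. dst x \<le> \<epsilon> + C * gap x" by auto
  show ?thesis
  proof (intro exI[of _ C] conjI allI)
    show "0 \<le> C" by fact
    fix a b :: complex
    show "cmod (a - b) powr p \<le> \<epsilon> * (cmod a powr p + cmod b powr p)
      + C * ((cmod a powr p + cmod b powr p) / 2 - cmod ((a + b) / 2) powr p)"
    proof (cases "(a, b) = (0, 0)")
      case True
      then show ?thesis by simp
    next
      case False
      define N where "N = cmod a powr p + cmod b powr p"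
      have N: "0 < N" using powr_two_sum_pos[OF False] by (simp add: N_def)
      define t where "t = (1 / N) powr (1 / p)"
      have t: "0 < t" "t powr p = 1 / N" using N p by (auto simp: t_def powr_powr)
      note sc = powr_cmod_scale[OF t(1)]
      define x where "x = (of_real t * a, of_real t * b)"
      have x: "n x = 1" "gap x = (N / 2 - cmod ((a + b) / 2) powr p) / N"
        "dst x = cmod (a - b) powr p / N"
      proof -
        have "n x = 1 / N * N"
          unfolding x_def n_def fst_conv snd_conv sc t(2) by (simp add: N_def distrib_left)
        then show 1: "n x = 1" using N by simp
        have mid: "(of_real t * a + of_real t * b) / 2 = of_real t * ((a + b) / 2)"
          by (simp add: field_simps)
        have "cmod ((fst x + snd x) / 2) powr p = cmod ((a + b) / 2) powr p / N"
          unfolding x_def fst_conv snd_conv mid sc t(2) by simp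
        then show "gap x = (N / 2 - cmod ((a + b) / 2) powr p) / N"
          unfolding gap_def 1 using N by (simp add: diff_divide_distrib)
        have "of_real t * a - of_real t * b = of_real t * (a - b)" by (simp add: field_simps)
        then show "dst x = cmod (a - b) powr p / N"
          unfolding dst_def x_def fst_conv snd_conv using sc[of "a - b" p] t by simp
      qed
      have "dst x \<le> \<epsilon> + C * gap x" using C(2) x(1) unfolding S_def by blast
      then have "N * dst x \<le> N * (\<epsilon> + C * gap x)" using N by (intro mult_left_mono) auto
      then have "cmod (a - b) powr p \<le> \<epsilon> * N + C * (N / 2 - cmod ((a + b) / 2) powr p)"
        unfolding x(2,3) distrib_left using N by (simp add: mult.commute mult.left_commute)
      then show ?thesis by (simp add: N_def)
    qed
  qed
qed

text \<open>This replaces the triangle inequality for \<open>p\<close>-th powers: because the first constant is as close to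
  \<open>1\<close> as desired, the \<open>p\<close>-th power of the norm is continuous along norm convergent sequences. For
  small \<open>\<bar>b\<bar> / \<bar>a\<bar>\<close> the first term absorbs everything, otherwise the second does.\<close>

lemma cmod_powr_add_le:
  assumes p: "1 < p" and e: "0 < \<epsilon>"
  shows "\<exists>C\<ge>0. \<forall>a b. cmod (a + b) powr p \<le> (1 + \<epsilon>) * cmod a powr p + C * cmod b powr p"
proof -
  have "((\<lambda>t. (1 + t) powr p) \<longlongrightarrow> (1 + 0) powr p) (at_right (0::real))"
    using p by (intro tendsto_intros) auto
  then have "\<forall>\<^sub>F t in at_right (0::real). (1 + t) powr p < 1 + \<epsilon>"
    using e by (intro order_tendstoD) auto
  moreover have "\<forall>\<^sub>F t in at_right (0::real). 0 < t" by (simp add: eventually_at_right_less)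
  ultimately have "\<forall>\<^sub>F t in at_right (0::real). (1 + t) powr p < 1 + \<epsilon> \<and> 0 < t"
    by eventually_elim auto
  then obtain t :: real where t: "(1 + t) powr p < 1 + \<epsilon>" "0 < t"
    using eventually_happens'[OF trivial_limit_at_right_real] by blast
  show ?thesis
  proof (intro exI[of _ "(1 + 1 / t) powr p"] conjI allI)
    fix a b :: complex
    have nn: "cmod (a + b) \<le> cmod a + cmod b" by (rule norm_triangle_ineq)
    show "cmod (a + b) powr p \<le> (1 + \<epsilon>) * cmod a powr p + (1 + 1 / t) powr p * cmod b powr p"
    proof (cases "cmod b \<le> t * cmod a")
      case True
      have "cmod (a + b) powr p \<le> ((1 + t) * cmod a) powr p"
        using nn True p by (intro powr_mono2) (auto simp: algebra_simps)
      also have "\<dots> = (1 + t) powr p * cmod a powr p" using t by (simp add: powr_mult)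
      also have "\<dots> \<le> (1 + \<epsilon>) * cmod a powr p" using t by (intro mult_right_mono) auto
      finally show ?thesis by (smt (verit) mult_nonneg_nonneg powr_ge_zero)
    next
      case False
      then have "cmod a \<le> cmod b / t" using t by (simp add: field_simps)
      then have "cmod (a + b) powr p \<le> ((1 + 1 / t) * cmod b) powr p"
        using nn p by (intro powr_mono2) (auto simp: algebra_simps)
      also have "\<dots> = (1 + 1 / t) powr p * cmod b powr p" using t by (simp add: powr_mult)
      finally show ?thesis using e by (smt (verit) mult_nonneg_nonneg powr_ge_zero)
    qed
  qed simp
qed

text \<open>On the unit circle this is the first-order expansion of the \<open>p\<close>-th power. It persists inside the
  disc, with the linear term \<open>Re (cnj a * b)\<close> and without a weight \<open>\<bar>a\<bar>\<^bsup>p-2\<^esup>\<close>, because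
  \<open>\<bar>a + b\<bar>\<^sup>2 \<le> 1 + 2 Re (cnj a b) + \<bar>b\<bar>\<^sup>2\<close>: for small \<open>b\<close> the one-variable expansion of \<open>(1 + s)\<^bsup>p/2\<^esup>\<close> applies,
  and for large \<open>b\<close> the last term dominates.\<close>

lemma cmod_powr_expansion_closed_disc:
  assumes p: "1 < p" and e: "0 < \<eta>"
  shows "\<exists>C\<ge>0. \<forall>a b. cmod a \<le> 1 \<longrightarrow>
    cmod (a + b) powr p \<le> 1 + p * Re (cnj a * b) + \<eta> * cmod b + C * cmod b powr p"
proof -
  define \<eta>' where "\<eta>' = \<eta> / 6"
  have e': "0 < \<eta>'" using e by (simp add: \<eta>'_def)
  have "((\<lambda>s. (1 + s) powr (p / 2)) has_real_derivative (p / 2)) (at (0::real))"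
    by (auto intro!: derivative_eq_intros)
  then have "((\<lambda>s. ((1 + s) powr (p / 2) - (1 + 0) powr (p / 2)) / (s - 0)) \<longlongrightarrow> p / 2) (at (0::real))"
    by (simp add: has_field_derivative_iff)
  then have "\<forall>\<^sub>F s in at (0::real). dist (((1 + s) powr (p / 2) - 1) / s) (p / 2) < \<eta>'"
    using e' by (simp add: tendsto_iff)
  then obtain \<delta> where d: "\<delta> > 0" "\<forall>s. s \<noteq> 0 \<and> \<bar>s\<bar> < \<delta> \<longrightarrow>
      \<bar>((1 + s) powr (p / 2) - 1) / s - p / 2\<bar> < \<eta>'"
    unfolding eventually_at dist_real_def by auto
  have lin: "(1 + s) powr (p / 2) \<le> 1 + p / 2 * s + \<eta>' * \<bar>s\<bar>" if "\<bar>s\<bar> < \<delta>" for s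
  proof (cases "s = 0")
    case False
    have "\<bar>((1 + s) powr (p / 2) - 1) / s - p / 2\<bar> * \<bar>s\<bar> \<le> \<eta>' * \<bar>s\<bar>"
      using d(2) that False by (intro mult_right_mono) (auto simp: less_imp_le)
    moreover have "\<bar>((1 + s) powr (p / 2) - 1) / s - p / 2\<bar> * \<bar>s\<bar>
        = \<bar>(1 + s) powr (p / 2) - 1 - p / 2 * s\<bar>"
    proof -
      have "(D / s - q) * s = D - q * s" for D q
        using False by (simp add: field_simps)
      then show ?thesis by (metis abs_mult)
    qed
    ultimately show ?thesis by linarith
  qed auto
  \<comment> \<open>For \<open>\<bar>b\<bar> < \<delta>'\<close> the increment \<open>s\<close> below satisfies \<open>\<bar>s\<bar> \<le> 3 \<bar>b\<bar> < \<delta>\<close>, and \<open>(p/2) \<bar>b\<bar>\<^sup>2\<close> is at most half of the error \<open>\<eta> \<bar>b\<bar>\<close>.\<close>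
  define \<delta>' where "\<delta>' = min 1 (min (\<delta> / 4) (\<eta> / p))"
  have d': "0 < \<delta>'" "\<delta>' \<le> 1" "\<delta>' \<le> \<delta> / 4" "\<delta>' \<le> \<eta> / p"
    unfolding \<delta>'_def using d e p by (simp, simp, linarith, linarith)
  \<comment> \<open>For \<open>\<bar>b\<bar> \<ge> \<delta>'\<close> the first summand bounds the left-hand side, the second one compensates a negative linear term.\<close>
  define C where "C = (1 / \<delta>' + 1) powr p + p * (1 / \<delta>') powr (p - 1)"
  show ?thesis
  proof (intro exI[of _ C] conjI allI impI)
    show "0 \<le> C" using p by (simp add: C_def)
    fix a b :: complex assume a: "cmod a \<le> 1"
    have Re_le: "\<bar>Re (cnj a * b)\<bar> \<le> cmod b"
    proof -
      have "\<bar>Re (cnj a * b)\<bar> \<le> cmod a * cmod b"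
        using abs_Re_le_cmod[of "cnj a * b"] by (simp add: norm_mult)
      also have "\<dots> \<le> 1 * cmod b" using a by (intro mult_right_mono) auto
      finally show ?thesis by simp
    qed
    have C1: "0 \<le> (1 / \<delta>' + 1) powr p * cmod b powr p"
      "0 \<le> p * (1 / \<delta>') powr (p - 1) * cmod b powr p" using p by auto
    show "cmod (a + b) powr p \<le> 1 + p * Re (cnj a * b) + \<eta> * cmod b + C * cmod b powr p"
    proof (cases "cmod b < \<delta>'")
      case True
      define s where "s = 2 * Re (cnj a * b) + (cmod b)\<^sup>2"
      have bb: "(cmod b)\<^sup>2 \<le> \<delta>' * cmod b" "(cmod b)\<^sup>2 \<le> cmod b"
        using True d' by (auto simp: power2_eq_square intro!: mult_right_mono mult_left_le_one_le)
      have s: "\<bar>s\<bar> \<le> 3 * cmod b"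
        unfolding s_def using Re_le bb(2) zero_le_power2[of "cmod b"] by linarith
      have sd: "\<bar>s\<bar> < \<delta>" using s True d' by linarith
      have "(cmod (a + b))\<^sup>2 = (cmod a)\<^sup>2 + s"
        unfolding s_def cmod_power2 by (simp add: power2_eq_square algebra_simps)
      also have "\<dots> \<le> 1 + s" using a by (simp add: power_le_one)
      finally have sq: "(cmod (a + b))\<^sup>2 \<le> 1 + s" .
      have "cmod (a + b) powr p = ((cmod (a + b))\<^sup>2) powr (p / 2)"
        by (cases "a + b = 0") (auto simp: powr_powr simp flip: powr_numeral)
      also have "\<dots> \<le> (1 + s) powr (p / 2)" using sq p by (intro powr_mono2) auto
      also have "\<dots> \<le> 1 + p / 2 * s + \<eta>' * \<bar>s\<bar>" using lin sd by auto
      also have "\<dots> \<le> 1 + p / 2 * s + \<eta>' * (3 * cmod b)"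
        using s e' by (intro add_left_mono mult_left_mono) auto
      also have "\<dots> = 1 + p * Re (cnj a * b) + p / 2 * (cmod b)\<^sup>2 + \<eta> / 2 * cmod b"
        by (simp add: s_def \<eta>'_def algebra_simps)
      also have "p / 2 * (cmod b)\<^sup>2 \<le> \<eta> / 2 * cmod b"
      proof -
        have "p * (cmod b)\<^sup>2 \<le> p * (\<delta>' * cmod b)" using bb p by (intro mult_left_mono) auto
        also have "\<dots> \<le> p * (\<eta> / p * cmod b)"
          using d' p by (intro mult_left_mono mult_right_mono) auto
        finally show ?thesis using p by simp
      qed
      finally have "cmod (a + b) powr p \<le> 1 + p * Re (cnj a * b) + \<eta> * cmod b"
        by (simp add: algebra_simps)
      moreover have "0 \<le> C * cmod b powr p" using C1 unfolding C_def distrib_right by linarith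
      ultimately show ?thesis by linarith
    next
      case False
      have bpos: "0 < cmod b" using False d' by linarith
      have b1: "1 \<le> 1 / \<delta>' * cmod b" using False d' by (simp add: field_simps)
      have "cmod (a + b) \<le> 1 + cmod b" using norm_triangle_ineq[of a b] a by linarith
      also have "\<dots> \<le> (1 / \<delta>' + 1) * cmod b" using b1 by (simp add: algebra_simps)
      finally have "cmod (a + b) powr p \<le> ((1 / \<delta>' + 1) * cmod b) powr p"
        using p by (intro powr_mono2) auto
      also have "\<dots> = (1 / \<delta>' + 1) powr p * cmod b powr p" using d' by (simp add: powr_mult)
      finally have 1: "cmod (a + b) powr p \<le> (1 / \<delta>' + 1) powr p * cmod b powr p" .
      have "1 \<le> (1 / \<delta>' * cmod b) powr (p - 1)" using b1 p by (simp add: ge_one_powr_ge_zero)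
      then have "cmod b * 1 \<le> cmod b * ((1 / \<delta>' * cmod b) powr (p - 1))"
        by (intro mult_left_mono) auto
      also have "\<dots> = (1 / \<delta>') powr (p - 1) * (cmod b powr (p - 1) * cmod b)"
        using d' by (simp add: powr_mult powr_divide)
      also have "cmod b powr (p - 1) * cmod b = cmod b powr p"
        using bpos by (simp add: powr_diff)
      finally have "p * cmod b \<le> p * ((1 / \<delta>') powr (p - 1) * cmod b powr p)"
        using p by (intro mult_left_mono) auto
      moreover have "- (p * cmod b) \<le> p * Re (cnj a * b)"
      proof -
        have "p * - cmod b \<le> p * Re (cnj a * b)" using Re_le p by (intro mult_left_mono) auto
        then show ?thesis by simp
      qed
      moreover have "0 \<le> \<eta> * cmod b" using e by simp
      ultimately show ?thesis using 1 by (simp add: C_def algebra_simps)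
    qed
  qed
qed

section \<open>Means over circles and the Poisson kernel\<close>

definition circle_mean :: "(complex \<Rightarrow> 'a::banach) \<Rightarrow> real \<Rightarrow> 'a" where
  "circle_mean h r = (1 / (2 * pi)) *\<^sub>R integral {0..2 * pi} (\<lambda>t. h (of_real r * cis t))"

lemma continuous_on_circle:
  "continuous_on (sphere 0 r) h \<Longrightarrow> 0 \<le> r \<Longrightarrow> continuous_on S (\<lambda>t. h (of_real r * cis t))"
  by (erule continuous_on_compose2) (auto intro!: continuous_intros simp: norm_mult)

lemma circle_integrable:
  fixes h :: "complex \<Rightarrow> 'a::banach"
  shows "continuous_on (sphere 0 r) h \<Longrightarrow> 0 \<le> r \<Longrightarrow>
    (\<lambda>t. h (of_real r * cis t)) integrable_on {0..2 * pi}"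
  by (rule integrable_continuous_interval[OF continuous_on_circle])

lemma circle_mean_cong:
  assumes "0 \<le> r" "\<And>z. cmod z = r \<Longrightarrow> g z = h z"
  shows "circle_mean g r = circle_mean h r"
  unfolding circle_mean_def using assms by (simp add: norm_mult)

lemma circle_mean_const [simp]: "circle_mean (\<lambda>_. c) r = c"
  by (simp add: circle_mean_def)

lemma circle_mean_linear:
  assumes "bounded_linear T" "continuous_on (sphere 0 r) h" "0 \<le> r"
  shows "circle_mean (\<lambda>z. T (h z)) r = T (circle_mean h r)"
  using integral_linear[OF circle_integrable[OF assms(2,3)] assms(1)] assms(1)
  by (simp add: circle_mean_def o_def linear_simps)

lemma circle_mean_add:
  assumes "continuous_on (sphere 0 r) g" "continuous_on (sphere 0 r) h" "0 \<le> r"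
  shows "circle_mean (\<lambda>z. g z + h z) r = circle_mean g r + circle_mean h r"
  unfolding circle_mean_def
  by (subst integral_add[OF circle_integrable circle_integrable])
     (simp_all add: assms scaleR_add_right)

lemma circle_mean_diff:
  assumes "continuous_on (sphere 0 r) g" "continuous_on (sphere 0 r) h" "0 \<le> r"
  shows "circle_mean (\<lambda>z. g z - h z) r = circle_mean g r - circle_mean h r"
  unfolding circle_mean_def
  by (subst integral_diff[OF circle_integrable circle_integrable])
     (simp_all add: assms scaleR_diff_right)

lemma circle_mean_mult_left:
  fixes c :: "'a :: {banach, real_normed_field}"
  assumes "continuous_on (sphere 0 r) h" "0 \<le> r"
  shows "circle_mean (\<lambda>z. c * h z) r = c * circle_mean h r"
  by (rule circle_mean_linear[OF bounded_linear_mult_right assms])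

lemma circle_mean_Re:
  assumes "continuous_on (sphere 0 r) h" "0 \<le> r"
  shows "circle_mean (\<lambda>z. Re (h z)) r = Re (circle_mean h r)"
  by (rule circle_mean_linear[OF bounded_linear_Re assms])

lemma circle_mean_mono:
  fixes g h :: "complex \<Rightarrow> real"
  assumes "continuous_on (sphere 0 r) g" "continuous_on (sphere 0 r) h" "0 \<le> r"
    "\<And>z. cmod z = r \<Longrightarrow> g z \<le> h z"
  shows "circle_mean g r \<le> circle_mean h r"
  unfolding circle_mean_def real_scaleR_def
  by (intro mult_left_mono integral_le circle_integrable assms) (auto simp: norm_mult assms)

lemma circle_mean_nonneg:
  fixes h :: "complex \<Rightarrow> real"
  assumes "continuous_on (sphere 0 r) h" "0 \<le> r" "\<And>z. cmod z = r \<Longrightarrow> 0 \<le> h z"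
  shows "0 \<le> circle_mean h r"
  using circle_mean_mono[of r "\<lambda>_. 0" h] assms by auto

lemma circle_mean_le_bound:
  fixes h :: "complex \<Rightarrow> real"
  assumes "continuous_on (sphere 0 r) h" "0 \<le> r" "\<And>z. cmod z = r \<Longrightarrow> h z \<le> B"
  shows "circle_mean h r \<le> B"
  using circle_mean_mono[of r h "\<lambda>_. B"] assms by auto

lemma circle_mean_tendsto:
  fixes h :: "nat \<Rightarrow> complex \<Rightarrow> 'a::banach"
  assumes u: "uniform_limit (sphere 0 r) h g sequentially"
    and c: "\<And>n. continuous_on (sphere 0 r) (h n)" and r: "0 \<le> r"
  shows "(\<lambda>n. circle_mean (h n) r) \<longlonglongrightarrow> circle_mean g r"
proof -
  have "uniform_limit {0..2 * pi} (\<lambda>n t. h n (of_real r * cis t)) (\<lambda>t. g (of_real r * cis t)) sequentially"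
    by (rule uniform_limit_compose'[OF u]) (use r in \<open>auto simp: norm_mult\<close>)
  then obtain I J where IJ:
    "\<And>n. ((\<lambda>t. h n (of_real r * cis t)) has_integral I n) {0..2 * pi}"
    "((\<lambda>t. g (of_real r * cis t)) has_integral J) {0..2 * pi}" "(I \<longlongrightarrow> J) sequentially"
    by (rule uniform_limit_integral) (auto intro!: continuous_on_circle c r)
  from IJ(3) have "(\<lambda>n. (1 / (2 * pi)) *\<^sub>R I n) \<longlonglongrightarrow> (1 / (2 * pi)) *\<^sub>R J"
    by (intro tendsto_intros)
  then show ?thesis
    by (simp add: circle_mean_def integral_unique[OF IJ(1)] integral_unique[OF IJ(2)])
qed

lemma circle_mean_rotate:
  assumes c: "continuous_on (sphere 0 r) h" and r: "0 \<le> r" and s: "0 \<le> s" "s \<le> 2 * pi"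
  shows "circle_mean (\<lambda>z. h (cis s * z)) r = circle_mean h r"
proof -
  define k where "k = (\<lambda>t. h (of_real r * cis t))"
  have int: "k integrable_on {a..b}" for a b
    unfolding k_def by (intro integrable_continuous_interval continuous_on_circle c r)
  have shift: "integral {a..b} (\<lambda>t. k (t + s)) = integral {a + s..b + s} k" for a b s
  proof -
    have "(k has_integral integral {a + s..b + s} k) (cbox (a + s) (b + s))"
      using int by (simp add: integrable_integral)
    then have "((k \<circ> (+) s) has_integral integral {a + s..b + s} k) (cbox a b)"
      by (rule has_integral_shift_cbox_iff[THEN iffD2])
    then show ?thesis by (intro integral_unique) (simp add: o_def add.commute)
  qed
  have per: "k (t + 2 * pi) = k t" for t
    by (simp add: k_def cis.code)
  have "integral {0..2 * pi} (\<lambda>t. k (t + s)) = integral {s..2 * pi + s} k"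
    using shift[of 0 "2 * pi" s] by simp
  also have "\<dots> = integral {s..2 * pi} k + integral {2 * pi..2 * pi + s} k"
    by (rule Henstock_Kurzweil_Integration.integral_combine[symmetric]) (use s int in auto)
  also have "integral {2 * pi..2 * pi + s} k = integral {0..s} k"
    using shift[of 0 s "2 * pi"] by (simp add: per add.commute)
  also have "integral {s..2 * pi} k + integral {0..s} k = integral {0..2 * pi} k"
    using s Henstock_Kurzweil_Integration.integral_combine[of 0 s "2 * pi" k] int
    by (simp add: add.commute)
  finally have "integral {0..2 * pi} (\<lambda>t. k (t + s)) = integral {0..2 * pi} k" .
  moreover have "k (t + s) = h (cis s * (of_real r * cis t))" for t
    by (simp add: k_def cis_mult[symmetric] mult_ac)
  ultimately show ?thesis by (simp add: circle_mean_def k_def)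
qed

text \<open>On a circle around \<open>0\<close> one has \<open>dz = \<i> z d\<theta>\<close>.\<close>

lemma circle_mean_contour:
  assumes "(g has_contour_integral (2 * of_real pi * \<i> * L)) (circlepath 0 r)"
  shows "circle_mean (\<lambda>z. g z * z) r = L"
proof -
  have "((\<lambda>t. g (0 + of_real r * cis t) * of_real r * \<i> * cis t)
      has_integral (2 * of_real pi * \<i> * L)) {0..2 * pi}"
    using assms unfolding circlepath_def
    by (subst (asm) has_contour_integral_part_circlepath_iff) auto
  then have "((\<lambda>t. (- \<i>) * (g (0 + of_real r * cis t) * of_real r * \<i> * cis t))
      has_integral ((- \<i>) * (2 * of_real pi * \<i> * L))) {0..2 * pi}"
    by (rule has_integral_mult_right)
  then have "((\<lambda>t. g (of_real r * cis t) * (of_real r * cis t))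
      has_integral (2 * of_real pi * L)) {0..2 * pi}"
    by (simp add: algebra_simps)
  then show ?thesis
    by (simp add: circle_mean_def integral_unique scaleR_conv_of_real)
qed

lemma circle_mean_Cauchy:
  assumes f: "f holomorphic_on ball 0 1" and a: "cmod a < r" and r: "r < 1"
  shows "circle_mean (\<lambda>z. f z * (z / (z - a))) r = f a"
proof -
  have "f holomorphic_on cball 0 r"
    using f r by (auto intro: holomorphic_on_subset)
  then have "((\<lambda>u. f u / (u - a)) has_contour_integral (2 * of_real pi * \<i> * f a)) (circlepath 0 r)"
    using a by (intro Cauchy_integral_circlepath_simple) auto
  from circle_mean_contour[OF this] show ?thesis by simp
qed

lemma circle_mean_holomorphic:
  assumes "f holomorphic_on ball 0 1" "0 < r" "r < 1"
  shows "circle_mean f r = f 0"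
proof -
  have "circle_mean f r = circle_mean (\<lambda>z. f z * (z / (z - 0))) r"
    using assms by (intro circle_mean_cong) auto
  then show ?thesis using circle_mean_Cauchy[of f 0 r] assms by simp
qed

text \<open>The Herglotz kernel \<open>(1 + cnj w z) / (1 - cnj w z)\<close> minus its value \<open>1\<close> at the origin. Its
  product with an element of a closed invariant subspace is an element that vanishes at \<open>0\<close>, and
  \<open>1\<close> plus its real part is the Poisson kernel.\<close>

definition herglotz_kernel :: "complex \<Rightarrow> complex \<Rightarrow> complex" where
  "herglotz_kernel w z = 2 * cnj w * z / (1 - cnj w * z)"

lemma one_minus_cnj_mult_nonzero:
  assumes "cmod w < 1" "cmod z \<le> 1"
  shows "1 - cnj w * z \<noteq> 0"
proof
  assume "1 - cnj w * z = 0"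
  then have "cnj w * z = 1" by simp
  then have "cmod w * cmod z = 1" by (metis complex_mod_cnj norm_mult norm_one)
  then show False using assms mult_left_le[of "cmod z" "cmod w"] by simp
qed

lemma herglotz_kernel_holomorphic:
  assumes "cmod w < 1"
  shows "herglotz_kernel w holomorphic_on cball 0 1"
  unfolding herglotz_kernel_def
  by (intro holomorphic_intros) (use one_minus_cnj_mult_nonzero[OF assms] in auto)

lemma herglotz_kernel_0 [simp]: "herglotz_kernel w 0 = 0"
  by (simp add: herglotz_kernel_def)

text \<open>The value is \<open>(1 - \<bar>w z\<bar>\<^sup>2) / \<bar>1 - cnj w z\<bar>\<^sup>2\<close>.\<close>

lemma poisson_kernel_nonneg:
  assumes "cmod w < 1" "cmod z \<le> 1"
  shows "0 \<le> 1 + Re (herglotz_kernel w z)"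
proof -
  define a where "a = cnj w * z"
  have a: "1 - a \<noteq> 0" using one_minus_cnj_mult_nonzero[OF assms] by (simp add: a_def)
  have "cmod a \<le> 1"
    using assms by (simp add: a_def norm_mult mult_le_one)
  then have a1: "(cmod a)\<^sup>2 \<le> 1" by (simp add: power_le_one)
  have "1 + herglotz_kernel w z = (1 + a) / (1 - a)"
    using a by (simp add: herglotz_kernel_def a_def field_simps)
  also have "\<dots> = (1 + a) * cnj (1 - a) / (of_real ((cmod (1 - a))\<^sup>2))"
    using complex_div_cnj[of "1 + a" "1 - a"] by simp
  finally have "Re (1 + herglotz_kernel w z) = Re ((1 + a) * cnj (1 - a)) / (cmod (1 - a))\<^sup>2"
    by (metis Re_divide_of_real)
  also have "Re ((1 + a) * cnj (1 - a)) = 1 - (cmod a)\<^sup>2"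
    unfolding cmod_power2 by (simp add: power2_eq_square algebra_simps)
  finally show ?thesis using a1 by simp
qed

text \<open>For \<open>\<bar>z\<bar> = r\<close> the kernel is that of the point \<open>r w\<close> at \<open>z / r\<close>, which is why its mean against \<open>f\<close>
  picks out the point \<open>r\<^sup>2 w\<close>. Half of the kernel is holomorphic and vanishes at \<open>0\<close>; the conjugate
  half becomes a Cauchy kernel after \<open>cnj z = r\<^sup>2 / z\<close>.\<close>

lemma circle_mean_herglotz:
  assumes f: "f holomorphic_on ball 0 1" and w: "cmod w < 1" and r: "0 < r" "r < 1"
  shows "circle_mean (\<lambda>z. f z * of_real (Re (herglotz_kernel w z))) r = f (of_real (r\<^sup>2) * w) - f 0"
proof -
  define a where "a = of_real (r\<^sup>2) * w"
  have a: "cmod a < r"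
  proof -
    have "cmod a = r * (r * cmod w)" using r by (simp add: a_def norm_mult power2_eq_square)
    moreover have "r * cmod w < 1 * 1" using r w by (intro mult_strict_mono) auto
    ultimately show ?thesis using r by simp
  qed
  let ?u = "herglotz_kernel w"
  have sub: "sphere 0 r \<subseteq> ball (0::complex) 1" "sphere 0 r \<subseteq> cball (0::complex) 1"
    "ball 0 1 \<subseteq> cball (0::complex) 1" using r by auto
  have cf: "continuous_on (sphere 0 r) f" "continuous_on (sphere 0 r) ?u"
    using f herglotz_kernel_holomorphic[OF w] sub
    by (meson holomorphic_on_imp_continuous_on continuous_on_subset)+
  have ne: "z - a \<noteq> 0" if "cmod z = r" for z using a that by auto
  have "circle_mean (\<lambda>z. f z * of_real (Re (?u z))) r
     = circle_mean (\<lambda>z. (1 / 2) * (f z * ?u z) + (f z * (z / (z - a)) - f z)) r"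
  proof (rule circle_mean_cong)
    fix z :: complex assume z: "cmod z = r"
    have zz: "z * cnj z = of_real (r\<^sup>2)" using z by (metis complex_norm_square)
    have z0: "z \<noteq> 0" using z r by auto
    have cz: "cnj z = of_real (r\<^sup>2) / z" using zz z0 by (simp add: field_simps)
    have "cnj (?u z) = 2 * (w * cnj z) / (1 - w * cnj z)" by (simp add: herglotz_kernel_def)
    also have "w * cnj z = a / z" unfolding cz by (simp add: a_def)
    also have "2 * (a / z) / (1 - a / z) = 2 * a / (z - a)"
      using z0 ne[OF z] by (simp add: field_simps)
    also have "\<dots> = 2 * (z / (z - a) - 1)" using ne[OF z] by (simp add: field_simps)
    finally have cu: "cnj (?u z) = 2 * (z / (z - a) - 1)" .
    have "of_real (Re (?u z)) = (?u z + cnj (?u z)) / 2" by (simp add: complex_add_cnj)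
    then have "of_real (Re (?u z)) = (1 / 2) * ?u z + (z / (z - a) - 1)"
      unfolding cu by (simp add: add_divide_distrib)
    then show "f z * of_real (Re (?u z)) = (1 / 2) * (f z * ?u z) + (f z * (z / (z - a)) - f z)"
      by (simp only: distrib_left right_diff_distrib mult_1_right mult.left_commute)
  qed (use r in auto)
  also have "\<dots> = (1 / 2) * circle_mean (\<lambda>z. f z * ?u z) r
      + (circle_mean (\<lambda>z. f z * (z / (z - a))) r - circle_mean f r)"
  proof -
    have c1: "continuous_on (sphere 0 r) (\<lambda>z. f z * ?u z)" by (intro continuous_intros cf)
    have c2: "continuous_on (sphere 0 r) (\<lambda>z. f z * (z / (z - a)))"
      by (intro continuous_intros cf) (use ne in auto)
    have r0: "0 \<le> r" using r by simp
    show ?thesis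
      unfolding circle_mean_mult_left[OF c1 r0, symmetric] circle_mean_diff[OF c2 cf(1) r0, symmetric]
      by (rule circle_mean_add) (intro continuous_intros c1 c2 cf r0)+
  qed
  also have "circle_mean (\<lambda>z. f z * ?u z) r = 0"
    using herglotz_kernel_holomorphic[OF w] f r holomorphic_on_subset[OF _ sub(3)]
    by (subst circle_mean_holomorphic) (auto intro!: holomorphic_intros)
  also have "circle_mean (\<lambda>z. f z * (z / (z - a))) r = f a"
    by (rule circle_mean_Cauchy[OF f a r(2)])
  also have "circle_mean f r = f 0"
    by (rule circle_mean_holomorphic[OF f r])
  finally show ?thesis by (simp add: a_def)
qed

text \<open>Jensen's inequality for the Poisson kernel. The tangent of the \<open>p\<close>-th power at the value of \<open>f\<close> in
  question is the real part of a holomorphic function of \<open>z\<close>, whose Poisson mean is known exactly.\<close>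

lemma poisson_jensen:
  assumes p: "1 < p" and f: "f holomorphic_on ball 0 1" and w: "cmod w < 1" and r: "0 < r" "r < 1"
  shows "cmod (f (of_real (r\<^sup>2) * w)) powr p
    \<le> circle_mean (\<lambda>z. (1 + Re (herglotz_kernel w z)) * cmod (f z) powr p) r"
proof -
  define P where "P = (\<lambda>z. 1 + Re (herglotz_kernel w z))"
  define k where "k = f (of_real (r\<^sup>2) * w)"
  define A where "A = of_real p * of_real (cmod k powr (p - 2)) * cnj k"
  have sub: "sphere 0 r \<subseteq> ball (0::complex) 1" "sphere 0 r \<subseteq> cball (0::complex) 1"
    using r by auto
  have cf: "continuous_on (sphere 0 r) f" "continuous_on (sphere 0 r) (herglotz_kernel w)"
    using f herglotz_kernel_holomorphic[OF w] sub
    by (meson holomorphic_on_imp_continuous_on continuous_on_subset)+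
  then have cP: "continuous_on (sphere 0 r) P" unfolding P_def by (intro continuous_intros)
  have holp: "(\<lambda>z. of_real (cmod k powr p) + A * (f z - k)) holomorphic_on ball 0 1"
    by (intro holomorphic_intros f)
  define F where "F = (\<lambda>z. of_real (cmod k powr p) + A * (f z - k))"
  have cF: "continuous_on (sphere 0 r) F" unfolding F_def by (intro continuous_intros cf)
  have "circle_mean (\<lambda>z. F z + F z * of_real (Re (herglotz_kernel w z))) r
      = F 0 + (F (of_real (r\<^sup>2) * w) - F 0)"
    using holp r
    by (subst circle_mean_add)
       (auto intro!: continuous_intros cF cf simp: circle_mean_herglotz w F_def circle_mean_holomorphic)
  also have "\<dots> = of_real (cmod k powr p)" by (simp add: F_def k_def)
  finally have "cmod k powr p
      = Re (circle_mean (\<lambda>z. F z + F z * of_real (Re (herglotz_kernel w z))) r)" by simp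
  also have "\<dots> = circle_mean (\<lambda>z. Re (F z + F z * of_real (Re (herglotz_kernel w z)))) r"
    using r by (intro circle_mean_Re[symmetric] continuous_intros cF cf) auto
  also have "\<dots> = circle_mean (\<lambda>z. P z * Re (F z)) r"
    by (simp add: P_def algebra_simps)
  also have "\<dots> \<le> circle_mean (\<lambda>z. P z * cmod (f z) powr p) r"
  proof (rule circle_mean_mono)
    show "continuous_on (sphere 0 r) (\<lambda>z. P z * Re (F z))"
      "continuous_on (sphere 0 r) (\<lambda>z. P z * cmod (f z) powr p)"
      by (intro continuous_intros cP cF cf continuous_on_cmod_powr p)+
    fix z :: complex assume z: "cmod z = r"
    have "Re (F z) = cmod k powr p + p * (cmod k powr (p - 2) * Re (cnj k * (f z - k)))"
      by (simp add: F_def A_def algebra_simps)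
    also have "\<dots> \<le> cmod (f z) powr p" by (rule cmod_powr_tangent[OF p])
    finally show "P z * Re (F z) \<le> P z * cmod (f z) powr p"
      using poisson_kernel_nonneg[OF w, of z] z r by (intro mult_left_mono) (auto simp: P_def)
  qed (use r in auto)
  finally show ?thesis by (simp add: P_def k_def)
qed

section \<open>Hardy means and Hardy norms\<close>

lemma hardy_mean_eq: "hardy_mean p f r = circle_mean (\<lambda>z. cmod (f z) powr p) r"
  by (simp add: hardy_mean_def circle_mean_def)

lemma holomorphic_continuous_circle:
  assumes "f holomorphic_on ball 0 1" "r < 1"
  shows "continuous_on (sphere 0 r) f"
  using holomorphic_on_imp_continuous_on[OF assms(1)] assms(2)
  by (auto elim!: continuous_on_subset)

lemma hardy_mean_nonneg:
  assumes "1 < p" "f holomorphic_on ball 0 1" "0 < r" "r < 1"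
  shows "0 \<le> hardy_mean p f r"
  unfolding hardy_mean_eq using assms
  by (intro circle_mean_nonneg continuous_on_cmod_powr holomorphic_continuous_circle) auto

lemma hardy_mean_cong:
  assumes "0 < r" "r < 1" "\<And>z. cmod z < 1 \<Longrightarrow> f z = g z"
  shows "hardy_mean p f r = hardy_mean p g r"
  unfolding hardy_mean_eq using assms by (intro circle_mean_cong) auto

text \<open>At \<open>0\<close> the modulus is \<open>\<bar>a\<bar>\<^bsup>p-1\<^esup>\<close>, which tends to \<open>0\<close> although \<open>\<bar>a\<bar>\<^bsup>p-2\<^esup>\<close> may blow up.\<close>

lemma continuous_cnj_mult_powr:
  assumes "1 < p"
  shows "continuous_on UNIV (\<lambda>a. cnj a * of_real (cmod a powr (p - 2)))"
proof -
  have "isCont (\<lambda>a. cnj a * of_real (cmod a powr (p - 2))) a" for a :: complex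
  proof (cases "a = 0")
    case False
    then show ?thesis by (intro continuous_intros) auto
  next
    case True
    have "cmod (cnj b * of_real (cmod b powr (p - 2))) = cmod b powr (p - 1)" for b :: complex
    proof (cases "b = 0")
      case False
      then have "cmod b powr 1 * cmod b powr (p - 2) = cmod b powr (1 + (p - 2))"
        by (simp only: powr_add)
      then show ?thesis using False by (simp add: norm_mult)
    qed simp
    moreover have "((\<lambda>b::complex. cmod b powr (p - 1)) \<longlongrightarrow> cmod (0::complex) powr (p - 1)) (at 0)"
      using assms by (intro tendsto_powr' tendsto_intros) auto
    ultimately have "((\<lambda>b. cmod (cnj b * of_real (cmod b powr (p - 2)))) \<longlongrightarrow> 0) (at 0)" by simp
    then have "((\<lambda>b. cnj b * of_real (cmod b powr (p - 2))) \<longlongrightarrow> 0) (at 0)"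
      by (rule tendsto_norm_zero_cancel)
    then show ?thesis unfolding True isCont_def by simp
  qed
  then show ?thesis by (simp add: continuous_at_imp_continuous_on)
qed

text \<open>Pairing \<open>f (z e\<^bsup>\<i>t\<^esup>)\<close> with the dual weight \<open>T(t) = \<bar>f\<bar>\<^bsup>p-2\<^esup> cnj f\<close>, taken at \<open>r e\<^bsup>\<i>t\<^esup>\<close>, gives a
  holomorphic function \<open>g\<close> of \<open>z\<close> whose value at \<open>r\<close> is the mean over the circle of radius \<open>r\<close>, up to
  the factor \<open>2 \<pi>\<close>. By Young's inequality \<open>\<bar>g\<bar>\<close> on the circle of radius \<open>\<rho>\<close> is at most \<open>1 - 1/p\<close> times
  the mean over radius \<open>r\<close> plus \<open>1/p\<close> times the mean over radius \<open>\<rho>\<close>, and the maximum principle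
  compares the two.\<close>

lemma hardy_mean_mono:
  assumes p: "1 < p" and f: "f holomorphic_on ball 0 1" and r: "0 < r" "r \<le> \<rho>" "\<rho> < 1"
  shows "hardy_mean p f r \<le> hardy_mean p f \<rho>"
proof -
  define T where "T = (\<lambda>t. cnj (f (of_real r * cis t)) * of_real (cmod (f (of_real r * cis t)) powr (p - 2)))"
  define g where "g = (\<lambda>z. integral (cbox 0 (2 * pi)) (\<lambda>t. T t * f (z * cis t)))"
  have r1: "r < 1" and rho: "0 < \<rho>" using r by auto
  note cf = holomorphic_continuous_circle[OF f]
  have cT: "continuous_on S T" for S
    unfolding T_def
    by (rule continuous_on_compose2[OF continuous_cnj_mult_powr[OF p]])
       (auto intro!: continuous_on_circle cf r1 simp: less_imp_le r)
  have inb: "z * cis t \<in> ball 0 1" if "z \<in> ball 0 1" for z t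
    using that by (simp add: norm_mult)
  have c2: "continuous_on S (\<lambda>t. f (z * cis t))" if "z \<in> ball 0 1" for z and S :: "real set"
    by (rule continuous_on_compose2[OF holomorphic_on_imp_continuous_on[OF f]])
       (use inb that in \<open>auto intro!: continuous_intros\<close>)
  have holg: "g holomorphic_on ball 0 1"
    unfolding g_def
  proof (rule leibniz_rule_holomorphic)
    fix z t assume z: "z \<in> ball (0::complex) 1"
    have "(f has_field_derivative deriv f (z * cis t)) (at (z * cis t))"
      by (rule holomorphic_derivI[OF f open_ball inb[OF z]])
    moreover have "((\<lambda>x. x * cis t) has_field_derivative cis t) (at z within ball 0 1)"
      by (auto intro!: derivative_eq_intros)
    ultimately have "((\<lambda>x. f (x * cis t)) has_field_derivative deriv f (z * cis t) * cis t) (at z within ball 0 1)"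
      by (rule DERIV_chain2)
    then show "((\<lambda>x. T t * f (x * cis t)) has_field_derivative T t * (deriv f (z * cis t) * cis t)) (at z within ball 0 1)"
      by (rule DERIV_cmult)
  next
    fix z assume z: "z \<in> ball (0::complex) 1"
    show "(\<lambda>t. T t * f (z * cis t)) integrable_on cbox 0 (2 * pi)"
      by (intro integrable_continuous continuous_intros cT c2 z)
  next
    have "deriv f holomorphic_on ball 0 1" using f by (auto intro: holomorphic_deriv)
    then have cd: "continuous_on (ball 0 1) (deriv f)" by (rule holomorphic_on_imp_continuous_on)
    have "continuous_on (ball 0 1 \<times> cbox 0 (2 * pi)) (\<lambda>x. T (snd x) * (deriv f (fst x * cis (snd x)) * cis (snd x)))"
      by (intro continuous_intros continuous_on_compose2[OF cT] continuous_on_compose2[OF cd])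
         (use inb in auto)
    then show "continuous_on (ball 0 1 \<times> cbox 0 (2 * pi)) (\<lambda>(z, t). T t * (deriv f (z * cis t) * cis t))"
      by (simp add: case_prod_unfold)
  qed auto
  have gr: "g (of_real r) = of_real (2 * pi * hardy_mean p f r)"
  proof -
    have "T t * f (of_real r * cis t) = of_real (cmod (f (of_real r * cis t)) powr p)" for t
    proof -
      let ?a = "f (of_real r * cis t)"
      have "T t * ?a = of_real ((cmod ?a)\<^sup>2) * of_real (cmod ?a powr (p - 2))"
        unfolding T_def complex_norm_square by (simp add: algebra_simps)
      also have "(cmod ?a)\<^sup>2 * cmod ?a powr (p - 2) = cmod ?a powr p"
      proof (cases "?a = 0")
        case False
        then have "cmod ?a powr 2 * cmod ?a powr (p - 2) = cmod ?a powr (2 + (p - 2))"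
          by (simp only: powr_add)
        then show ?thesis using False by simp
      qed simp
      then have "of_real ((cmod ?a)\<^sup>2) * of_real (cmod ?a powr (p - 2)) = (of_real (cmod ?a powr p) :: complex)"
        by (metis of_real_mult)
      finally show ?thesis .
    qed
    then have "g (of_real r) = integral {0..2 * pi} (\<lambda>t. of_real (cmod (f (of_real r * cis t)) powr p))"
      by (simp add: g_def)
    also have "\<dots> = of_real (integral {0..2 * pi} (\<lambda>t. cmod (f (of_real r * cis t)) powr p))"
      using integral_linear[OF circle_integrable[of r "\<lambda>z. cmod (f z) powr p"] bounded_linear_of_real[where ?'a = complex]]
        continuous_on_cmod_powr[OF p cf[OF r1]] r
      by (simp add: o_def)
    finally show ?thesis by (simp add: hardy_mean_def)
  qed
  define B where "B = 2 * pi * ((1 - 1 / p) * hardy_mean p f r + (1 / p) * hardy_mean p f \<rho>)"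
  have bound: "cmod (g z) \<le> B" if z: "cmod z = \<rho>" for z
  proof -
    define s where "s = Arg2pi z"
    have s: "0 \<le> s" "s \<le> 2 * pi" and zs: "z = of_real \<rho> * cis s"
      using Arg2pi_eq[of z] Arg2pi[of z] z by (auto simp: s_def cis_conv_exp)
    have zb: "z \<in> ball 0 1" using z r by simp
    let ?u = "\<lambda>t. cmod (f (of_real r * cis t)) powr p"
    let ?v = "\<lambda>t. cmod (f (cis s * (of_real \<rho> * cis t))) powr p"
    have cu: "continuous_on (sphere 0 r) (\<lambda>z. cmod (f z) powr p)"
      "continuous_on (sphere 0 \<rho>) (\<lambda>z. cmod (f z) powr p)"
      using r by (auto intro!: continuous_on_cmod_powr p cf)
    have cv: "continuous_on (sphere 0 \<rho>) (\<lambda>z. cmod (f (cis s * z)) powr p)"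
      by (rule continuous_on_compose2[OF cu(2)]) (auto intro!: continuous_intros simp: norm_mult)
    have iu: "?u integrable_on {0..2 * pi}" using circle_integrable[OF cu(1)] r by simp
    have iv: "?v integrable_on {0..2 * pi}" using circle_integrable[OF cv] r by simp
    have "cmod (g z) \<le> integral (cbox 0 (2 * pi)) (\<lambda>t. (1 - 1 / p) * ?u t + (1 / p) * ?v t)"
      unfolding g_def
    proof (rule integral_norm_bound_integral)
      show "(\<lambda>t. T t * f (z * cis t)) integrable_on cbox 0 (2 * pi)"
        by (intro integrable_continuous continuous_intros cT c2 zb)
      show "(\<lambda>t. (1 - 1 / p) * ?u t + (1 / p) * ?v t) integrable_on cbox 0 (2 * pi)"
        unfolding cbox_interval by (intro integrable_add integrable_on_mult_right iu iv)
      fix t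
      let ?a = "f (of_real r * cis t)"
      have zt: "z * cis t = cis s * (of_real \<rho> * cis t)" by (simp add: zs mult_ac)
      have "cmod (T t) = cmod ?a powr (p - 1)"
      proof (cases "?a = 0")
        case False
        then have "cmod ?a powr 1 * cmod ?a powr (p - 2) = cmod ?a powr (1 + (p - 2))"
          by (simp only: powr_add)
        then show ?thesis using False by (simp add: T_def norm_mult)
      qed (simp add: T_def)
      then have "cmod (T t * f (z * cis t)) = cmod ?a powr (p - 1) * cmod (f (z * cis t))"
        by (simp add: norm_mult)
      also have "\<dots> \<le> (cmod ?a powr (p - 1)) powr (p / (p - 1)) / (p / (p - 1)) + cmod (f (z * cis t)) powr p / p"
        using p by (intro Youngs_inequality) (auto simp: field_simps)
      also have "(cmod ?a powr (p - 1)) powr (p / (p - 1)) = ?u t"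
        using p by (simp add: powr_powr)
      also have "?u t / (p / (p - 1)) = (1 - 1 / p) * ?u t"
        using p by (simp add: field_simps)
      finally show "cmod (T t * f (z * cis t)) \<le> (1 - 1 / p) * ?u t + (1 / p) * ?v t"
        unfolding zt by simp
    qed
    also have "\<dots> = (1 - 1 / p) * integral {0..2 * pi} ?u + (1 / p) * integral {0..2 * pi} ?v"
    proof -
      have "integral {0..2 * pi} (\<lambda>t. (1 - 1 / p) * ?u t + (1 / p) * ?v t)
          = integral {0..2 * pi} (\<lambda>t. (1 - 1 / p) * ?u t) + integral {0..2 * pi} (\<lambda>t. (1 / p) * ?v t)"
        by (intro integral_add integrable_on_mult_right iu iv)
      then show ?thesis by (simp only: integral_mult_right cbox_interval)
    qed
    also have "integral {0..2 * pi} ?v = 2 * pi * hardy_mean p f \<rho>"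
      using circle_mean_rotate[OF cu(2) _ s] rho by (simp add: hardy_mean_eq circle_mean_def)
    also have "integral {0..2 * pi} ?u = 2 * pi * hardy_mean p f r"
      by (simp add: hardy_mean_def)
    also have "(1 - 1 / p) * (2 * pi * hardy_mean p f r) + (1 / p) * (2 * pi * hardy_mean p f \<rho>) = B"
      unfolding B_def by (simp only: distrib_left mult_ac)
    finally show ?thesis .
  qed
  have "cmod (g (of_real r)) \<le> B"
  proof (rule maximum_modulus_frontier[of g "cball 0 \<rho>"])
    show "g holomorphic_on interior (cball 0 \<rho>)"
      using r by (auto intro!: holomorphic_on_subset[OF holg])
    show "continuous_on (closure (cball 0 \<rho>)) g"
      using r by (auto intro!: continuous_on_subset[OF holomorphic_on_imp_continuous_on[OF holg]])
  qed (use r rho bound in \<open>auto simp: frontier_cball\<close>)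
  moreover have "0 \<le> hardy_mean p f r" using hardy_mean_nonneg[OF p f r(1) r1] .
  ultimately have "2 * pi * hardy_mean p f r \<le> B" unfolding gr norm_of_real by linarith
  then have "hardy_mean p f r \<le> (1 - 1 / p) * hardy_mean p f r + (1 / p) * hardy_mean p f \<rho>"
    unfolding B_def by simp
  then have "(1 / p) * hardy_mean p f r \<le> (1 / p) * hardy_mean p f \<rho>"
    by (simp add: left_diff_distrib)
  then show ?thesis using p by (simp add: divide_le_cancel)
qed

text \<open>The \<open>p\<close>-th power of the Hardy norm; unlike the norm it inherits pointwise inequalities.\<close>

definition hardy_sup :: "real \<Rightarrow> (complex \<Rightarrow> complex) \<Rightarrow> real" where
  "hardy_sup p f = (SUP r\<in>{0<..<1}. hardy_mean p f r)"

lemma hardy_norm_eq: "hardy_norm p f = hardy_sup p f powr (1 / p)"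
  by (simp add: hardy_norm_def hardy_sup_def)

lemma hardy_space_holomorphic: "f \<in> hardy_space p \<Longrightarrow> f holomorphic_on ball 0 1"
  by (simp add: hardy_space_def)

lemma hardy_spaceI:
  assumes "f holomorphic_on ball 0 1" "\<And>r. 0 < r \<Longrightarrow> r < 1 \<Longrightarrow> hardy_mean p f r \<le> B"
  shows "f \<in> hardy_space p"
  using assms unfolding hardy_space_def by (auto intro!: bdd_aboveI[of _ B])

lemma hardy_mean_le_sup:
  assumes "f \<in> hardy_space p" "0 < r" "r < 1"
  shows "hardy_mean p f r \<le> hardy_sup p f"
  unfolding hardy_sup_def using assms by (intro cSUP_upper) (auto simp: hardy_space_def)

lemma hardy_sup_le:
  assumes "\<And>r. 0 < r \<Longrightarrow> r < 1 \<Longrightarrow> hardy_mean p f r \<le> B"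
  shows "hardy_sup p f \<le> B"
  unfolding hardy_sup_def using assms by (intro cSUP_least) auto

lemma hardy_sup_nonneg:
  assumes "1 < p" "f \<in> hardy_space p"
  shows "0 \<le> hardy_sup p f"
  using hardy_mean_nonneg[OF assms(1) hardy_space_holomorphic[OF assms(2)], of "1/2"]
    hardy_mean_le_sup[OF assms(2), of "1/2"] by simp

lemma hardy_sup_cong:
  assumes "\<And>z. cmod z < 1 \<Longrightarrow> f z = g z"
  shows "hardy_sup p f = hardy_sup p g"
  unfolding hardy_sup_def using assms by (intro SUP_cong refl hardy_mean_cong) auto

text \<open>This limit, a consequence of monotonicity, is what takes the place of boundary values.\<close>

lemma hardy_mean_tendsto_sup:
  assumes p: "1 < p" and f: "f \<in> hardy_space p"
  shows "(hardy_mean p f \<longlongrightarrow> hardy_sup p f) (at_left 1)"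
proof (rule order_tendstoI)
  fix a assume "a < hardy_sup p f"
  then obtain r0 where r0: "0 < r0" "r0 < 1" "a < hardy_mean p f r0"
    unfolding hardy_sup_def using f
    by (subst (asm) less_cSUP_iff) (auto simp: hardy_space_def)
  have "\<forall>\<^sub>F r in at_left 1. r \<in> {r0<..<1}"
    using r0 by (intro eventually_at_leftI[of r0]) auto
  then show "\<forall>\<^sub>F r in at_left 1. a < hardy_mean p f r"
  proof eventually_elim
    case (elim r)
    then have "hardy_mean p f r0 \<le> hardy_mean p f r"
      using r0 by (intro hardy_mean_mono p hardy_space_holomorphic[OF f]) auto
    then show ?case using r0 by simp
  qed
next
  fix a assume a: "hardy_sup p f < a"
  have "\<forall>\<^sub>F r in at_left 1. r \<in> {0<..<(1::real)}"
    by (intro eventually_at_leftI[of 0]) auto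
  then show "\<forall>\<^sub>F r in at_left 1. hardy_mean p f r < a"
    by eventually_elim (use a hardy_mean_le_sup[OF f] in force)
qed

lemma eventually_at_left_1: "\<forall>\<^sub>F r in at_left (1::real). 0 < r \<and> r < 1"
  by (rule eventually_at_leftI[of 0]) auto

lemma hardy_mean_mult_left:
  assumes "1 < p" "f holomorphic_on ball 0 1" "0 < r" "r < 1"
  shows "hardy_mean p (\<lambda>z. c * f z) r = cmod c powr p * hardy_mean p f r"
  unfolding hardy_mean_eq norm_mult
  using assms
  by (simp add: powr_mult circle_mean_mult_left continuous_on_cmod_powr holomorphic_continuous_circle)

lemma hardy_mean_mult_le:
  assumes p: "1 < p" and f: "f holomorphic_on ball 0 1" and g: "g holomorphic_on ball 0 1"
    and r: "0 < r" "r < 1" and B: "\<And>z. cmod z = r \<Longrightarrow> cmod (g z) \<le> B"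
  shows "hardy_mean p (\<lambda>z. g z * f z) r \<le> B powr p * hardy_mean p f r"
proof -
  have cf: "continuous_on (sphere 0 r) (\<lambda>z. cmod (f z) powr p)"
    using f r p by (intro continuous_on_cmod_powr holomorphic_continuous_circle) auto
  have "cmod (g (of_real r)) \<le> B" using B[of "of_real r"] r by simp
  then have "0 \<le> B" by (rule order_trans[OF norm_ge_zero])
  have "hardy_mean p (\<lambda>z. g z * f z) r \<le> circle_mean (\<lambda>z. B powr p * cmod (f z) powr p) r"
    unfolding hardy_mean_eq
  proof (rule circle_mean_mono)
    show "continuous_on (sphere 0 r) (\<lambda>z. cmod (g z * f z) powr p)"
      using f g r p by (intro continuous_on_cmod_powr continuous_intros holomorphic_continuous_circle) auto
    fix z :: complex assume "cmod z = r"
    then show "cmod (g z * f z) powr p \<le> B powr p * cmod (f z) powr p"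
      using B[of z] p by (simp add: norm_mult powr_mult mult_right_mono powr_mono2)
  qed (use cf r in \<open>auto intro!: continuous_intros\<close>)
  also have "\<dots> = B powr p * hardy_mean p f r"
    unfolding hardy_mean_eq using cf r by (intro circle_mean_mult_left) auto
  finally show ?thesis .
qed

lemma hardy_bounded_mult:
  assumes p: "1 < p" and f: "f \<in> hardy_space p" and g: "g holomorphic_on ball 0 1"
    and B: "\<And>z. cmod z < 1 \<Longrightarrow> cmod (g z) \<le> B"
  shows "(\<lambda>z. g z * f z) \<in> hardy_space p"
    and "hardy_sup p (\<lambda>z. g z * f z) \<le> B powr p * hardy_sup p f"
proof -
  note hf = hardy_space_holomorphic[OF f]
  have le: "hardy_mean p (\<lambda>z. g z * f z) r \<le> B powr p * hardy_sup p f" if r: "0 < r" "r < 1" for r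
  proof -
    have "hardy_mean p (\<lambda>z. g z * f z) r \<le> B powr p * hardy_mean p f r"
      using hardy_mean_mult_le[OF p hf g r] B r by auto
    also have "\<dots> \<le> B powr p * hardy_sup p f"
      using hardy_mean_le_sup[OF f r] by (intro mult_left_mono) auto
    finally show ?thesis .
  qed
  show "(\<lambda>z. g z * f z) \<in> hardy_space p"
    by (rule hardy_spaceI[OF _ le]) (intro holomorphic_intros hf g)
  show "hardy_sup p (\<lambda>z. g z * f z) \<le> B powr p * hardy_sup p f"
    by (rule hardy_sup_le[OF le])
qed

lemma hardy_scale:
  assumes p: "1 < p" and f: "f \<in> hardy_space p"
  shows "(\<lambda>z. c * f z) \<in> hardy_space p"
    and "hardy_sup p (\<lambda>z. c * f z) = cmod c powr p * hardy_sup p f"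
proof -
  show 1: "(\<lambda>z. c * f z) \<in> hardy_space p"
    by (rule hardy_bounded_mult[OF p f, of "\<lambda>_. c" "cmod c"]) auto
  have "((\<lambda>r. cmod c powr p * hardy_mean p f r) \<longlongrightarrow> hardy_sup p (\<lambda>z. c * f z)) (at_left 1)"
    by (rule Lim_transform_eventually[OF hardy_mean_tendsto_sup[OF p 1]])
       (use eventually_at_left_1 in \<open>eventually_elim, simp add: hardy_mean_mult_left p hardy_space_holomorphic[OF f]\<close>)
  moreover have "((\<lambda>r. cmod c powr p * hardy_mean p f r) \<longlongrightarrow> cmod c powr p * hardy_sup p f) (at_left 1)"
    by (intro tendsto_intros hardy_mean_tendsto_sup p f)
  ultimately show "hardy_sup p (\<lambda>z. c * f z) = cmod c powr p * hardy_sup p f"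
    by (intro tendsto_unique) auto
qed

lemma hardy_bounded:
  assumes p: "1 < p" and g: "g holomorphic_on ball 0 1"
    and B: "\<And>z. cmod z < 1 \<Longrightarrow> cmod (g z) \<le> B"
  shows "g \<in> hardy_space p"
proof (rule hardy_spaceI[OF g])
  fix r :: real assume r: "0 < r" "r < 1"
  show "hardy_mean p g r \<le> B powr p"
    unfolding hardy_mean_eq
    using r p B g
    by (intro circle_mean_le_bound continuous_on_cmod_powr holomorphic_continuous_circle powr_mono2) auto
qed

lemma hardy_const: "1 < p \<Longrightarrow> (\<lambda>_. c) \<in> hardy_space p"
  by (rule hardy_bounded[of p _ "cmod c"]) auto

lemma hardy_mean_add_le:
  assumes p: "1 < p" and C: "\<And>a b. cmod (a + b) powr p \<le> A * cmod a powr p + C * cmod b powr p"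
    and f: "f holomorphic_on ball 0 1" and g: "g holomorphic_on ball 0 1" and r: "0 < r" "r < 1"
  shows "hardy_mean p (\<lambda>z. f z + g z) r \<le> A * hardy_mean p f r + C * hardy_mean p g r"
proof -
  have c: "continuous_on (sphere 0 r) (\<lambda>z. cmod (f z) powr p)"
    "continuous_on (sphere 0 r) (\<lambda>z. cmod (g z) powr p)"
    "continuous_on (sphere 0 r) (\<lambda>z. cmod (f z + g z) powr p)"
    by (intro continuous_on_cmod_powr p continuous_on_add holomorphic_continuous_circle f g r)+
  have "hardy_mean p (\<lambda>z. f z + g z) r
      \<le> circle_mean (\<lambda>z. A * cmod (f z) powr p + C * cmod (g z) powr p) r"
    unfolding hardy_mean_eq using C r
    by (intro circle_mean_mono continuous_on_add continuous_on_mult_left c) auto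
  also have "\<dots> = circle_mean (\<lambda>z. A * cmod (f z) powr p) r + circle_mean (\<lambda>z. C * cmod (g z) powr p) r"
    using r by (intro circle_mean_add continuous_on_mult_left c) auto
  also have "\<dots> = A * hardy_mean p f r + C * hardy_mean p g r"
    unfolding hardy_mean_eq using c r by (simp add: circle_mean_mult_left)
  finally show ?thesis .
qed

lemma hardy_add:
  assumes p: "1 < p" and f: "f \<in> hardy_space p" and g: "g \<in> hardy_space p"
  shows "(\<lambda>z. f z + g z) \<in> hardy_space p"
proof -
  obtain C where C: "C \<ge> 0" "\<And>a b. cmod (a + b) powr p \<le> (1 + 1) * cmod a powr p + C * cmod b powr p"
    using cmod_powr_add_le[OF p, of 1] by auto
  note hf = hardy_space_holomorphic[OF f] and hg = hardy_space_holomorphic[OF g]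
  show ?thesis
  proof (rule hardy_spaceI)
    fix r :: real assume r: "0 < r" "r < 1"
    have "hardy_mean p (\<lambda>z. f z + g z) r \<le> (1 + 1) * hardy_mean p f r + C * hardy_mean p g r"
      by (rule hardy_mean_add_le[OF p C(2) hf hg r])
    also have "\<dots> \<le> (1 + 1) * hardy_sup p f + C * hardy_sup p g"
      using C(1) by (intro add_mono mult_left_mono hardy_mean_le_sup f g r) auto
    finally show "hardy_mean p (\<lambda>z. f z + g z) r \<le> (1 + 1) * hardy_sup p f + C * hardy_sup p g" .
  qed (intro holomorphic_intros hf hg)
qed

lemma hardy_minus: "1 < p \<Longrightarrow> f \<in> hardy_space p \<Longrightarrow> (\<lambda>z. - f z) \<in> hardy_space p"
  using hardy_scale(1)[of p f "-1"] by simp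

lemma hardy_diff:
  "1 < p \<Longrightarrow> f \<in> hardy_space p \<Longrightarrow> g \<in> hardy_space p \<Longrightarrow> (\<lambda>z. f z - g z) \<in> hardy_space p"
  using hardy_add[of p f "\<lambda>z. - g z"] hardy_minus[of p g] by simp

lemma hardy_sup_minus_commute: "hardy_sup p (\<lambda>z. f z - g z) = hardy_sup p (\<lambda>z. g z - f z)"
  unfolding hardy_sup_def hardy_mean_eq by (simp add: norm_minus_commute)

lemma hardy_sup_add_le:
  assumes p: "1 < p" and e: "0 < \<epsilon>"
  shows "\<exists>C\<ge>0. \<forall>f\<in>hardy_space p. \<forall>g\<in>hardy_space p.
    hardy_sup p (\<lambda>z. f z + g z) \<le> (1 + \<epsilon>) * hardy_sup p f + C * hardy_sup p g"
proof -
  obtain C where C: "C \<ge> 0" "\<And>a b. cmod (a + b) powr p \<le> (1 + \<epsilon>) * cmod a powr p + C * cmod b powr p"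
    using cmod_powr_add_le[OF p e] by auto
  show ?thesis
  proof (intro exI[of _ C] conjI ballI C(1))
    fix f g assume f: "f \<in> hardy_space p" and g: "g \<in> hardy_space p"
    show "hardy_sup p (\<lambda>z. f z + g z) \<le> (1 + \<epsilon>) * hardy_sup p f + C * hardy_sup p g"
    proof (rule hardy_sup_le)
      fix r :: real assume r: "0 < r" "r < 1"
      have "hardy_mean p (\<lambda>z. f z + g z) r \<le> (1 + \<epsilon>) * hardy_mean p f r + C * hardy_mean p g r"
        by (rule hardy_mean_add_le[OF p C(2) hardy_space_holomorphic[OF f] hardy_space_holomorphic[OF g] r])
      also have "\<dots> \<le> (1 + \<epsilon>) * hardy_sup p f + C * hardy_sup p g"
        using C(1) e by (intro add_mono mult_left_mono hardy_mean_le_sup f g r) auto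
      finally show "hardy_mean p (\<lambda>z. f z + g z) r \<le> (1 + \<epsilon>) * hardy_sup p f + C * hardy_sup p g" .
    qed
  qed
qed

text \<open>The means occurring here are compared at one and the same radius, which then tends to \<open>1\<close>; the
  suprema alone could not be compared, since the midpoint enters with a negative sign.\<close>

lemma hardy_sup_uniform_convexity:
  assumes p: "1 < p" and e: "0 < \<epsilon>"
  shows "\<exists>C\<ge>0. \<forall>f\<in>hardy_space p. \<forall>g\<in>hardy_space p.
    hardy_sup p (\<lambda>z. f z - g z) \<le> \<epsilon> * (hardy_sup p f + hardy_sup p g)
      + C * ((hardy_sup p f + hardy_sup p g) / 2 - hardy_sup p (\<lambda>z. (f z + g z) / 2))"
proof -
  obtain C where C: "C \<ge> 0" "\<And>a b. cmod (a - b) powr p \<le> \<epsilon> * (cmod a powr p + cmod b powr p)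
      + C * ((cmod a powr p + cmod b powr p) / 2 - cmod ((a + b) / 2) powr p)"
    using cmod_powr_uniform_convexity[OF p e] by auto
  show ?thesis
  proof (intro exI[of _ C] conjI ballI C(1))
    fix f g assume f: "f \<in> hardy_space p" and g: "g \<in> hardy_space p"
    have d: "(\<lambda>z. f z - g z) \<in> hardy_space p" by (rule hardy_diff[OF p f g])
    have m: "(\<lambda>z. (f z + g z) / 2) \<in> hardy_space p"
      using hardy_scale(1)[OF p hardy_add[OF p f g], of "1/2"] by simp
    note lims = hardy_mean_tendsto_sup[OF p f] hardy_mean_tendsto_sup[OF p g]
      hardy_mean_tendsto_sup[OF p d] hardy_mean_tendsto_sup[OF p m]
    show "hardy_sup p (\<lambda>z. f z - g z) \<le> \<epsilon> * (hardy_sup p f + hardy_sup p g)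
      + C * ((hardy_sup p f + hardy_sup p g) / 2 - hardy_sup p (\<lambda>z. (f z + g z) / 2))"
    proof (rule tendsto_le[OF _ _ lims(3)])
      show "((\<lambda>r. \<epsilon> * (hardy_mean p f r + hardy_mean p g r)
          + C * ((hardy_mean p f r + hardy_mean p g r) / 2 - hardy_mean p (\<lambda>z. (f z + g z) / 2) r)) \<longlongrightarrow>
        \<epsilon> * (hardy_sup p f + hardy_sup p g)
      + C * ((hardy_sup p f + hardy_sup p g) / 2 - hardy_sup p (\<lambda>z. (f z + g z) / 2))) (at_left 1)"
        by (intro tendsto_intros lims) auto
      show "\<forall>\<^sub>F r in at_left 1. hardy_mean p (\<lambda>z. f z - g z) r \<le> \<epsilon> * (hardy_mean p f r + hardy_mean p g r)
          + C * ((hardy_mean p f r + hardy_mean p g r) / 2 - hardy_mean p (\<lambda>z. (f z + g z) / 2) r)"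
        using eventually_at_left_1
      proof eventually_elim
        case (elim r)
        then have r: "0 \<le> r" "r < 1" by auto
        note hol = f[THEN hardy_space_holomorphic] g[THEN hardy_space_holomorphic]
          d[THEN hardy_space_holomorphic] m[THEN hardy_space_holomorphic]
        note c = hol[THEN holomorphic_continuous_circle, OF r(2), THEN continuous_on_cmod_powr[OF p]]
        have le: "cmod (f z - g z) powr p \<le> \<epsilon> * (cmod (f z) powr p + cmod (g z) powr p)
            + C * ((1 / 2) * (cmod (f z) powr p + cmod (g z) powr p) - cmod ((f z + g z) / 2) powr p)" for z
          using C(2)[of "f z" "g z"] by simp
        have "hardy_mean p (\<lambda>z. f z - g z) r \<le> circle_mean (\<lambda>z. \<epsilon> * (cmod (f z) powr p + cmod (g z) powr p)
            + C * ((1 / 2) * (cmod (f z) powr p + cmod (g z) powr p) - cmod ((f z + g z) / 2) powr p)) r"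
          unfolding hardy_mean_eq
          by (rule circle_mean_mono)
             (intro continuous_on_add continuous_on_diff continuous_on_mult_left c r le)+
        also have "\<dots> = \<epsilon> * (hardy_mean p f r + hardy_mean p g r)
          + C * ((1 / 2) * (hardy_mean p f r + hardy_mean p g r) - hardy_mean p (\<lambda>z. (f z + g z) / 2) r)"
          unfolding hardy_mean_eq
          unfolding circle_mean_add[OF c(1) c(2) r(1), symmetric]
            circle_mean_mult_left[OF continuous_on_add[OF c(1) c(2)] r(1), symmetric]
            circle_mean_diff[OF continuous_on_mult_left[OF continuous_on_add[OF c(1) c(2)]] c(4) r(1), symmetric]
            circle_mean_mult_left[OF continuous_on_diff[OF continuous_on_mult_left[OF continuous_on_add[OF c(1) c(2)]] c(4)] r(1), symmetric]
          by (rule circle_mean_add)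
             (intro continuous_on_add continuous_on_diff continuous_on_mult_left c r)+
        finally show ?case by simp
      qed
    qed simp
  qed
qed

text \<open>For \<open>r\<^sup>2 = (1 + \<rho>) / 2\<close> the Poisson kernels belonging to the points \<open>z / r\<^sup>2\<close> with \<open>\<bar>z\<bar> \<le> \<rho>\<close> have a
  common bound.\<close>

lemma hardy_point_evaluation:
  assumes p: "1 < p" and \<rho>: "0 \<le> \<rho>" "\<rho> < 1"
  shows "\<exists>C>0. \<forall>f\<in>hardy_space p. \<forall>z. cmod z \<le> \<rho> \<longrightarrow> cmod (f z) powr p \<le> C * hardy_sup p f"
proof -
  define r where "r = sqrt ((1 + \<rho>) / 2)"
  have r: "0 < r" "r < 1" "r\<^sup>2 = (1 + \<rho>) / 2" using \<rho> by (auto simp: r_def)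
  define \<sigma> where "\<sigma> = \<rho> / r\<^sup>2"
  have \<sigma>: "0 \<le> \<sigma>" "\<sigma> < 1" using \<rho> r by (auto simp: \<sigma>_def field_simps)
  define C where "C = 1 + 2 / (1 - \<sigma>)"
  show ?thesis
  proof (intro exI[of _ C] conjI ballI allI impI)
    show "0 < C" using \<sigma> by (simp add: C_def add_pos_nonneg)
    fix f z assume f: "f \<in> hardy_space p" and z: "cmod z \<le> \<rho>"
    define w where "w = z / of_real (r\<^sup>2)"
    have wz: "of_real (r\<^sup>2) * w = z" using r by (simp add: w_def)
    have cw: "cmod w \<le> \<sigma>" unfolding w_def \<sigma>_def norm_divide norm_of_real
      using z r \<rho> by (auto intro!: divide_right_mono)
    then have w: "cmod w < 1" using \<sigma> by simp
    note hf = hardy_space_holomorphic[OF f]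
    have c: "continuous_on (sphere 0 r) (\<lambda>z. cmod (f z) powr p)"
      by (intro continuous_on_cmod_powr p holomorphic_continuous_circle hf r)
    have "cmod (f z) powr p \<le> circle_mean (\<lambda>z. (1 + Re (herglotz_kernel w z)) * cmod (f z) powr p) r"
      using poisson_jensen[OF p hf w r(1,2)] wz by simp
    also have "\<dots> \<le> circle_mean (\<lambda>z. C * cmod (f z) powr p) r"
    proof (rule circle_mean_mono)
      have "continuous_on (sphere 0 r) (herglotz_kernel w)"
        using r by (intro continuous_on_subset[OF holomorphic_on_imp_continuous_on[OF herglotz_kernel_holomorphic[OF w]]]) auto
      then show "continuous_on (sphere 0 r) (\<lambda>z. (1 + Re (herglotz_kernel w z)) * cmod (f z) powr p)"
        by (intro continuous_intros c)
      fix u :: complex assume u: "cmod u = r"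
      have wu: "cmod (cnj w * u) \<le> \<sigma>"
        using cw u r \<sigma> by (simp add: norm_mult mult_le_cancel_right1) (meson cw mult_left_le order_trans less_imp_le norm_ge_zero)
      have "1 - \<sigma> \<le> cmod (1 - cnj w * u)"
        using norm_triangle_ineq2[of 1 "cnj w * u"] wu by simp
      then have "cmod (herglotz_kernel w u) \<le> 2 * 1 / (1 - \<sigma>)"
        unfolding herglotz_kernel_def norm_divide mult.assoc norm_mult[of 2]
        using wu \<sigma> by (intro frac_le mult_mono) auto
      then have "1 + Re (herglotz_kernel w u) \<le> C"
        using complex_Re_le_cmod[of "herglotz_kernel w u"] by (simp add: C_def)
      then show "(1 + Re (herglotz_kernel w u)) * cmod (f u) powr p \<le> C * cmod (f u) powr p"
        by (intro mult_right_mono) auto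
    qed (use r c in \<open>auto intro!: continuous_intros\<close>)
    also have "\<dots> = C * hardy_mean p f r"
      unfolding hardy_mean_eq using c r by (intro circle_mean_mult_left) auto
    also have "\<dots> \<le> C * hardy_sup p f"
      using \<open>0 < C\<close> hardy_mean_le_sup[OF f r(1,2)] by (intro mult_left_mono) auto
    finally show "cmod (f z) powr p \<le> C * hardy_sup p f" .
  qed
qed

section \<open>Completeness and closed invariant subspaces\<close>

lemma locally_uniform_limit_holomorphic:
  assumes hol: "\<And>n. f n holomorphic_on ball 0 1"
    and unif: "\<And>\<rho>. \<rho> < 1 \<Longrightarrow> uniform_limit (cball 0 \<rho>) f g sequentially"
  shows "g holomorphic_on ball 0 1"
proof (rule holomorphic_uniform_sequence[OF open_ball hol])
  fix x :: complex assume x: "x \<in> ball 0 1"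
  define d where "d = (1 - cmod x) / 2"
  have d: "0 < d" "cmod x + d < 1" using x by (auto simp: d_def field_simps)
  have "cball x d \<subseteq> cball 0 (cmod x + d)"
    by (simp add: cball_subset_cball_iff)
  moreover have "cball (0::complex) (cmod x + d) \<subseteq> ball 0 1" using d by auto
  ultimately show "\<exists>d>0. cball x d \<subseteq> ball 0 1 \<and> uniform_limit (cball x d) f g sequentially"
    using uniform_limit_on_subset[OF unif[OF d(2)]] d(1) by blast
qed

lemma hardy_convergence_locally_uniform:
  assumes p: "1 < p" and f: "\<And>n. f n \<in> hardy_space p" and g: "g \<in> hardy_space p"
    and lim: "(\<lambda>n. hardy_sup p (\<lambda>z. f n z - g z)) \<longlonglongrightarrow> 0" and \<rho>: "\<rho> < 1"
  shows "uniform_limit (cball 0 \<rho>) f g sequentially"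
proof (cases "0 \<le> \<rho>")
  case False
  then have "cball (0::complex) \<rho> = {}" by simp
  then show ?thesis by simp
next
  case True
  obtain C where C: "C > 0"
    "\<forall>f\<in>hardy_space p. \<forall>z. cmod z \<le> \<rho> \<longrightarrow> cmod (f z) powr p \<le> C * hardy_sup p f"
    using hardy_point_evaluation[OF p True \<rho>] by auto
  show ?thesis
  proof (rule uniform_limitI)
    fix e :: real assume e: "0 < e"
    have "\<forall>\<^sub>F n in sequentially. hardy_sup p (\<lambda>z. f n z - g z) < e powr p / C"
      using e C by (intro order_tendstoD(2)[OF lim]) auto
    then show "\<forall>\<^sub>F n in sequentially. \<forall>z\<in>cball 0 \<rho>. dist (f n z) (g z) < e"
    proof eventually_elim
      case (elim n)
      show ?case
      proof
        fix z :: complex assume z: "z \<in> cball 0 \<rho>"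
        have "cmod (f n z - g z) powr p \<le> C * hardy_sup p (\<lambda>z. f n z - g z)"
          using C(2) hardy_diff[OF p f g] z by force
        also have "\<dots> < e powr p" using elim C(1) by (simp add: field_simps)
        finally have "cmod (f n z - g z) < e"
          using powr_mono2[of p e "cmod (f n z - g z)"] e p by force
        then show "dist (f n z) (g z) < e" by (simp add: dist_norm)
      qed
    qed
  qed
qed

lemma hardy_convergence_pointwise:
  assumes "1 < p" "\<And>n. f n \<in> hardy_space p" "g \<in> hardy_space p"
    "(\<lambda>n. hardy_sup p (\<lambda>z. f n z - g z)) \<longlonglongrightarrow> 0" "cmod z < 1"
  shows "(\<lambda>n. f n z) \<longlonglongrightarrow> g z"
  using hardy_convergence_locally_uniform[OF assms(1-5)]
  by (rule tendsto_uniform_limitI) simp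

text \<open>Locally uniform convergence gives convergence of the means over each fixed circle.\<close>

lemma hardy_fatou:
  assumes p: "1 < p" and h: "\<And>n. h n \<in> hardy_space p" and g: "g holomorphic_on ball 0 1"
    and lim: "\<And>\<rho>. \<rho> < 1 \<Longrightarrow> uniform_limit (cball 0 \<rho>) h g sequentially"
    and B: "\<forall>\<^sub>F n in sequentially. hardy_sup p (h n) \<le> B"
  shows "g \<in> hardy_space p" and "hardy_sup p g \<le> B"
proof -
  have le: "hardy_mean p g r \<le> B" if r: "0 < r" "r < 1" for r
  proof -
    have cg: "continuous_on (cball 0 r) g"
      using holomorphic_on_imp_continuous_on[OF g] r by (auto elim!: continuous_on_subset)
    have "compact (g ` cball 0 r)" by (intro compact_continuous_image cg) auto
    then obtain M where M: "\<And>z. z \<in> cball 0 r \<Longrightarrow> cmod (g z) \<le> M"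
      by (meson bounded_iff compact_imp_bounded image_eqI)
    have ul: "uniform_limit (cball 0 r) h g sequentially" by (rule lim[OF r(2)])
    have "\<forall>\<^sub>F n in sequentially. \<forall>z\<in>cball 0 r. dist (h n z) (g z) < 1"
      using uniform_limitD[OF ul, of 1] by simp
    then have ev: "\<forall>\<^sub>F n in sequentially. \<forall>z\<in>cball 0 r. h n z \<in> cball 0 (M + 1)"
    proof eventually_elim
      case (elim n)
      show ?case
      proof
        fix z :: complex assume z: "z \<in> cball 0 r"
        have "cmod (h n z) \<le> cmod (g z) + cmod (h n z - g z)"
          by (metis add.commute norm_triangle_sub)
        also have "\<dots> \<le> M + 1" using M[OF z] elim z by (force simp: dist_norm)
        finally show "h n z \<in> cball 0 (M + 1)" by simp
      qed
    qed
    have "uniformly_continuous_on (cball 0 (M + 1)) (\<lambda>a::complex. cmod a powr p)"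
      by (intro compact_uniformly_continuous continuous_on_cmod_powr p continuous_intros) auto
    from uniform_limit_compose_uniformly_continuous_on[OF ul this ev closed_cball]
    have "uniform_limit (cball 0 r) (\<lambda>n z. cmod (h n z) powr p) (\<lambda>z. cmod (g z) powr p) sequentially" .
    then have "uniform_limit (sphere 0 r) (\<lambda>n z. cmod (h n z) powr p) (\<lambda>z. cmod (g z) powr p) sequentially"
      by (rule uniform_limit_on_subset) auto
    then have "(\<lambda>n. hardy_mean p (h n) r) \<longlonglongrightarrow> hardy_mean p g r"
      unfolding hardy_mean_eq using r
      by (intro circle_mean_tendsto continuous_on_cmod_powr p
          holomorphic_continuous_circle hardy_space_holomorphic[OF h]) auto
    moreover have "\<forall>\<^sub>F n in sequentially. hardy_mean p (h n) r \<le> B"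
      using B by eventually_elim (use hardy_mean_le_sup[OF h r] in \<open>blast intro: order_trans\<close>)
    ultimately show ?thesis by (intro tendsto_upperbound) auto
  qed
  show "g \<in> hardy_space p" by (rule hardy_spaceI[OF g le])
  show "hardy_sup p g \<le> B" by (rule hardy_sup_le[OF le])
qed

lemma hardy_sup_limit_le:
  assumes p: "1 < p" and u: "\<And>k. u k \<in> hardy_space p" and g: "g \<in> hardy_space p"
    and lim: "(\<lambda>k. hardy_sup p (\<lambda>z. u k z - g z)) \<longlonglongrightarrow> 0"
    and bound: "\<And>k. hardy_sup p (u k) < m + 1 / Suc k"
  shows "hardy_sup p g \<le> m"
proof (rule field_le_epsilon)
  fix e :: real assume e: "0 < e"
  show "hardy_sup p g \<le> m + e"
  proof (rule hardy_fatou(2)[OF p u hardy_space_holomorphic[OF g] hardy_convergence_locally_uniform[OF p u g lim]])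
    have "\<forall>\<^sub>F k in sequentially. 1 / real (Suc k) < e"
      using e by (intro order_tendstoD(2)[OF LIMSEQ_inverse_real_of_nat[unfolded inverse_eq_divide]])
    then show "\<forall>\<^sub>F k in sequentially. hardy_sup p (u k) \<le> m + e"
    proof eventually_elim
      case (elim k)
      then show ?case using bound[of k] by linarith
    qed
  qed
qed

lemma hardy_space_complete:
  assumes p: "1 < p" and f: "\<And>n. f n \<in> hardy_space p"
    and cauchy: "\<And>e. 0 < e \<Longrightarrow> \<exists>N. \<forall>m\<ge>N. \<forall>n\<ge>N. hardy_sup p (\<lambda>z. f m z - f n z) < e"
  obtains g where "g \<in> hardy_space p" "(\<lambda>n. hardy_sup p (\<lambda>z. f n z - g z)) \<longlonglongrightarrow> 0"
proof -
  define g where "g = (\<lambda>z. lim (\<lambda>n. f n z))"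
  have unif: "uniform_limit (cball 0 \<rho>) f g sequentially" if \<rho>: "\<rho> < 1" for \<rho>
  proof (cases "0 \<le> \<rho>")
    case False
    then have "cball (0::complex) \<rho> = {}" by simp
    then show ?thesis by simp
  next
    case True
    obtain C where C: "C > 0"
      "\<forall>f\<in>hardy_space p. \<forall>z. cmod z \<le> \<rho> \<longrightarrow> cmod (f z) powr p \<le> C * hardy_sup p f"
      using hardy_point_evaluation[OF p True \<rho>] by auto
    have "uniformly_Cauchy_on (cball 0 \<rho>) f"
    proof (rule uniformly_Cauchy_onI)
      fix e :: real assume e: "0 < e"
      obtain N where N: "\<forall>m\<ge>N. \<forall>n\<ge>N. hardy_sup p (\<lambda>z. f m z - f n z) < e powr p / C"
        using cauchy[of "e powr p / C"] e C by auto
      show "\<exists>M. \<forall>x\<in>cball 0 \<rho>. \<forall>m\<ge>M. \<forall>n\<ge>M. dist (f m x) (f n x) < e"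
      proof (intro exI[of _ N] ballI allI impI)
        fix z m n assume z: "z \<in> cball (0::complex) \<rho>" and mn: "N \<le> m" "N \<le> n"
        have "cmod (f m z - f n z) powr p \<le> C * hardy_sup p (\<lambda>z. f m z - f n z)"
          using C(2) hardy_diff[OF p f f] z by force
        also have "\<dots> < e powr p" using N mn C(1) by (simp add: field_simps)
        finally have "cmod (f m z - f n z) < e"
          using powr_mono2[of p e "cmod (f m z - f n z)"] e p by force
        then show "dist (f m z) (f n z) < e" by (simp add: dist_norm)
      qed
    qed
    then show ?thesis
      unfolding g_def uniformly_convergent_uniform_limit_iff[symmetric]
      by (rule Cauchy_uniformly_convergent)
  qed
  have holg: "g holomorphic_on ball 0 1"
    by (rule locally_uniform_limit_holomorphic[OF hardy_space_holomorphic[OF f] unif])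
  have tail: "(\<lambda>z. f n z - g z) \<in> hardy_space p \<and> hardy_sup p (\<lambda>z. f n z - g z) \<le> e"
    if N: "\<forall>m\<ge>N. \<forall>n\<ge>N. hardy_sup p (\<lambda>z. f m z - f n z) < e" and n: "N \<le> n" for n N e
  proof -
    have "\<forall>\<^sub>F m in sequentially. hardy_sup p (\<lambda>z. f n z - f m z) \<le> e"
      using eventually_ge_at_top[of N] by eventually_elim (use N n in \<open>auto intro: less_imp_le\<close>)
    moreover have "(\<lambda>z. f n z - g z) holomorphic_on ball 0 1"
      by (intro holomorphic_intros holg hardy_space_holomorphic[OF f])
    moreover have "uniform_limit (cball 0 \<rho>) (\<lambda>m z. f n z - f m z) (\<lambda>z. f n z - g z) sequentially"
      if "\<rho> < 1" for \<rho>
      by (intro uniform_limit_intros unif that)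
    ultimately show ?thesis
      using hardy_fatou[OF p, of "\<lambda>m z. f n z - f m z" "\<lambda>z. f n z - g z" e] hardy_diff[OF p f f] by auto
  qed
  have "g \<in> hardy_space p"
  proof -
    obtain N where "\<forall>m\<ge>N. \<forall>n\<ge>N. hardy_sup p (\<lambda>z. f m z - f n z) < 1" using cauchy[of 1] by auto
    from tail[OF this, of N] have "(\<lambda>z. f N z - g z) \<in> hardy_space p" by simp
    from hardy_diff[OF p f[of N] this] show ?thesis by simp
  qed
  moreover have "(\<lambda>n. hardy_sup p (\<lambda>z. f n z - g z)) \<longlonglongrightarrow> 0"
  proof (rule LIMSEQ_I)
    fix e :: real assume e: "0 < e"
    obtain N where N: "\<forall>m\<ge>N. \<forall>n\<ge>N. hardy_sup p (\<lambda>z. f m z - f n z) < e / 2"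
      using cauchy[of "e / 2"] e by auto
    have "norm (hardy_sup p (\<lambda>z. f n z - g z) - 0) < e" if "N \<le> n" for n
      using tail[OF N that] hardy_sup_nonneg[OF p, of "\<lambda>z. f n z - g z"] e by auto
    then show "\<exists>N. \<forall>n\<ge>N. norm (hardy_sup p (\<lambda>z. f n z - g z) - 0) < e" by blast
  qed
  ultimately show thesis by (rule that)
qed

text \<open>Closedness refers to the Hardy norm. Both the closure of the polynomial multiples of a function and
  the whole Hardy space are of this kind.\<close>

locale closed_invariant_subspace =
  fixes p :: real and E :: "(complex \<Rightarrow> complex) set"
  assumes p: "1 < p"
    and sub: "v \<in> E \<Longrightarrow> v \<in> hardy_space p"
    and add: "u \<in> E \<Longrightarrow> v \<in> E \<Longrightarrow> (\<lambda>z. u z + v z) \<in> E"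
    and poly_mult: "v \<in> E \<Longrightarrow> (\<lambda>z. poly q z * v z) \<in> E"
    and closed: "v \<in> hardy_space p \<Longrightarrow> (\<And>e. 0 < e \<Longrightarrow> \<exists>u\<in>E. hardy_sup p (\<lambda>z. v z - u z) < e) \<Longrightarrow> v \<in> E"
begin

lemma scale: "v \<in> E \<Longrightarrow> (\<lambda>z. c * v z) \<in> E"
  using poly_mult[of v "[:c:]"] by simp

lemma diff: "u \<in> E \<Longrightarrow> v \<in> E \<Longrightarrow> (\<lambda>z. u z - v z) \<in> E"
  using add[of u "\<lambda>z. (- 1) * v z"] scale[of v "- 1"] by simp

lemma midpoint: "u \<in> E \<Longrightarrow> v \<in> E \<Longrightarrow> (\<lambda>z. (u z + v z) / 2) \<in> E"
  using scale[OF add, of u v "1 / 2"] by simp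

lemma holo: "v \<in> E \<Longrightarrow> v holomorphic_on ball 0 1"
  using sub hardy_space_holomorphic by blast

lemma cong:
  assumes "v \<in> E" and eq: "\<And>z. cmod z < 1 \<Longrightarrow> v z = w z"
  shows "w \<in> E"
proof (rule closed)
  have "w holomorphic_on ball 0 1"
    using holo[OF assms(1)] by (rule holomorphic_transform) (simp add: eq)
  moreover have "hardy_mean p w r \<le> hardy_sup p v" if "0 < r" "r < 1" for r
    using hardy_mean_cong[OF that eq] hardy_mean_le_sup[OF sub[OF assms(1)] that] by simp
  ultimately show "w \<in> hardy_space p" by (rule hardy_spaceI)
  fix e :: real assume "0 < e"
  moreover have "hardy_sup p (\<lambda>z. w z - v z) = hardy_sup p (\<lambda>z. 0 * v z)"
    by (rule hardy_sup_cong) (simp add: eq)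
  then have "hardy_sup p (\<lambda>z. w z - v z) = 0" using hardy_scale(2)[OF p sub[OF assms(1)], of 0] by simp
  ultimately show "\<exists>u\<in>E. hardy_sup p (\<lambda>z. w z - u z) < e" using assms(1)
    by (intro bexI[of _ v]) simp
qed

lemma limit_mem:
  assumes "\<And>n. u n \<in> E" "g \<in> hardy_space p" "(\<lambda>n. hardy_sup p (\<lambda>z. u n z - g z)) \<longlonglongrightarrow> 0"
  shows "g \<in> E"
proof (rule closed[OF assms(2)])
  fix e :: real assume "0 < e"
  from order_tendstoD(2)[OF assms(3) this] obtain n where "hardy_sup p (\<lambda>z. u n z - g z) < e"
    by (auto simp: eventually_sequentially)
  then show "\<exists>u\<in>E. hardy_sup p (\<lambda>z. g z - u z) < e"
    using assms(1) by (auto simp: hardy_sup_minus_commute[of p g])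
qed

text \<open>The argument for nearest points in uniformly convex spaces, for a decreasing sequence of midpoint
  convex sets. Their minimal norms increase to a finite limit, and for \<open>k \<le> l\<close> the midpoint of \<open>u k\<close>
  and \<open>u l\<close> still lies in \<open>C k\<close>; so its norm is not much smaller than those of its end points, which
  forces the end points together. A constant sequence \<open>C\<close> gives elements of minimal norm.\<close>

lemma near_minimal_convergent:
  assumes C: "\<And>k. C k \<subseteq> E" "\<And>k. C (Suc k) \<subseteq> C k"
    and mid: "\<And>k u v. u \<in> C k \<Longrightarrow> v \<in> C k \<Longrightarrow> (\<lambda>z. (u z + v z) / 2) \<in> C k"
    and bounded: "\<And>k. \<exists>v\<in>C k. hardy_sup p v \<le> B"
  obtains u g where "\<And>k. u k \<in> C k" "g \<in> E" "(\<lambda>k. hardy_sup p (\<lambda>z. u k z - g z)) \<longlonglongrightarrow> 0"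
    "\<And>k. hardy_sup p (u k) < (INF v\<in>C k. hardy_sup p v) + 1 / Suc k"
proof -
  define m where "m = (\<lambda>k. INF v\<in>C k. hardy_sup p v)"
  have CH: "v \<in> hardy_space p" if "v \<in> C k" for v k using C(1) sub that by blast
  have bdd: "bdd_below (hardy_sup p ` C k)" for k
    using CH hardy_sup_nonneg[OF p] by (intro bdd_belowI[of _ 0]) auto
  have ne: "C k \<noteq> {}" for k using bounded[of k] by auto
  have mono: "C l \<subseteq> C k" if "k \<le> l" for k l
    using lift_Suc_antimono_le[of C, OF C(2) that] .
  have m_le: "m k \<le> hardy_sup p v" if "v \<in> C k" for v k
    unfolding m_def using that by (intro cINF_lower bdd) auto
  have m_mono: "m k \<le> m l" if "k \<le> l" for k l
    unfolding m_def[of] using mono[OF that] ne bdd by (intro cINF_superset_mono) auto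
  have m_B: "m k \<le> B" for k
    using bounded[of k] m_le by force
  have "\<exists>v\<in>C k. hardy_sup p v < m k + 1 / Suc k" for k
    using cINF_less_iff[OF ne bdd, of k "m k + 1 / Suc k"] by (simp add: m_def)
  then obtain u where u: "\<And>k. u k \<in> C k" "\<And>k. hardy_sup p (u k) < m k + 1 / Suc k" by metis
  have "incseq m" using m_mono by (simp add: incseq_def)
  moreover have "bdd_above (range m)" using m_B by (auto intro!: bdd_aboveI[of _ B])
  ultimately have m_lim: "m \<longlonglongrightarrow> (SUP k. m k)" using LIMSEQ_incseq_SUP by blast
  define s where "s = (SUP k. m k)"
  have m_s: "m k \<le> s" for k unfolding s_def using \<open>bdd_above (range m)\<close> by (intro cSUP_upper) auto
  have s_B: "s \<le> B" unfolding s_def using m_B by (intro cSUP_least) auto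
  have B0: "0 \<le> B" using bounded[of 0] hardy_sup_nonneg[OF p CH] by force
  have cauchy: "\<exists>N. \<forall>k\<ge>N. \<forall>l\<ge>N. hardy_sup p (\<lambda>z. u k z - u l z) < e" if e: "0 < e" for e
  proof -
    \<comment> \<open>All norms below are at most \<open>B + 1\<close>, so the first term of the convexity inequality is at most \<open>e / 2\<close>.\<close>
    define \<epsilon> where "\<epsilon> = e / (4 * (B + 1))"
    have eps: "0 < \<epsilon>" using e B0 by (simp add: \<epsilon>_def)
    obtain D where D: "D \<ge> 0" "\<And>f g. f \<in> hardy_space p \<Longrightarrow> g \<in> hardy_space p \<Longrightarrow>
      hardy_sup p (\<lambda>z. f z - g z) \<le> \<epsilon> * (hardy_sup p f + hardy_sup p g)
      + D * ((hardy_sup p f + hardy_sup p g) / 2 - hardy_sup p (\<lambda>z. (f z + g z) / 2))"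
      using hardy_sup_uniform_convexity[OF p eps] by auto
    have "(\<lambda>N. D * (s + 1 / real (Suc N) - m N)) \<longlonglongrightarrow> D * (s + 0 - s)"
      using m_lim unfolding s_def[symmetric]
      by (intro tendsto_intros LIMSEQ_inverse_real_of_nat[unfolded inverse_eq_divide])
    then have "\<forall>\<^sub>F N in sequentially. D * (s + 1 / real (Suc N) - m N) < e / 2"
      using e by (intro order_tendstoD(2)) auto
    then obtain N where N: "D * (s + 1 / real (Suc N) - m N) < e / 2"
      by (auto simp: eventually_sequentially)
    show ?thesis
    proof (intro exI[of _ N] allI impI)
      fix k l assume kl: "N \<le> k" "N \<le> l"
      have H: "u k \<in> hardy_space p" "u l \<in> hardy_space p" using CH u(1) by auto
      have N1: "1 / real (Suc k) \<le> 1 / real (Suc N)" "1 / real (Suc l) \<le> 1 / real (Suc N)" "1 / real (Suc N) \<le> 1"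
        using kl by (auto simp: frac_le)
      define q where "q = 1 / real (Suc N)"
      have q: "q \<le> 1" using N1(3) by (simp add: q_def)
      have b: "hardy_sup p (u k) \<le> s + q" "hardy_sup p (u l) \<le> s + q"
        using u(2)[of k] u(2)[of l] m_s[of k] m_s[of l] N1(1,2) unfolding q_def by linarith+
      have "u k \<in> C N" "u l \<in> C N" using u(1) mono kl by blast+
      from m_le[OF mid[OF this]] have mN: "m N \<le> hardy_sup p (\<lambda>z. (u k z + u l z) / 2)" .
      have "hardy_sup p (\<lambda>z. u k z - u l z) \<le> \<epsilon> * (hardy_sup p (u k) + hardy_sup p (u l))
        + D * ((hardy_sup p (u k) + hardy_sup p (u l)) / 2 - hardy_sup p (\<lambda>z. (u k z + u l z) / 2))"
        by (rule D(2)[OF H])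
      also have "\<dots> \<le> \<epsilon> * (2 * (B + 1)) + D * (s + q - m N)"
      proof (intro add_mono mult_left_mono)
        show "hardy_sup p (u k) + hardy_sup p (u l) \<le> 2 * (B + 1)"
          using b q s_B by simp
        show "(hardy_sup p (u k) + hardy_sup p (u l)) / 2 - hardy_sup p (\<lambda>z. (u k z + u l z) / 2)
            \<le> s + q - m N"
          using b by (intro diff_mono mN) simp
      qed (use eps D(1) in auto)
      also have "\<epsilon> * (2 * (B + 1)) = e / 2" using B0 by (simp add: \<epsilon>_def field_simps)
      finally show "hardy_sup p (\<lambda>z. u k z - u l z) < e" using N unfolding q_def by linarith
    qed
  qed
  obtain g where g: "g \<in> hardy_space p" "(\<lambda>k. hardy_sup p (\<lambda>z. u k z - g z)) \<longlonglongrightarrow> 0"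
    using hardy_space_complete[OF p _ cauchy] CH[OF u(1)] by blast
  have "u k \<in> E" for k using u(1) C(1) by blast
  then have "g \<in> E" using limit_mem g by blast
  then show thesis using that u g(2) unfolding m_def by blast
qed

text \<open>Norm bounded pointwise limits are weak limits, and closed subspaces are weakly closed. As in
  Mazur's theorem, suitable averages converge in norm. The role of the convex hull of the
  tail from \<open>k\<close> on is played by the set \<open>C k\<close> of all \<open>v\<close> that are everywhere as close to the limit as
  that tail is: it is stable under midpoints, and any \<open>u k\<close> chosen from it converge pointwise to the limit.\<close>

lemma bounded_pointwise_limit_mem:
  assumes x: "\<And>j. x j \<in> E" and B: "\<And>j. hardy_sup p (x j) \<le> B"
    and lim: "\<And>z. cmod z < 1 \<Longrightarrow> (\<lambda>j. x j z) \<longlonglongrightarrow> y z"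
  shows "y \<in> E"
proof -
  define C where "C = (\<lambda>k. {v \<in> E. \<forall>z e. cmod z < 1 \<longrightarrow>
    (\<forall>j\<ge>k. cmod (x j z - y z) \<le> e) \<longrightarrow> cmod (v z - y z) \<le> e})"
  obtain u g where ug: "\<And>k. u k \<in> C k" "g \<in> E" "(\<lambda>k. hardy_sup p (\<lambda>z. u k z - g z)) \<longlonglongrightarrow> 0"
  proof (rule near_minimal_convergent[of C B])
    show "C k \<subseteq> E" "C (Suc k) \<subseteq> C k" for k
      by (auto simp: C_def)
    show "\<exists>v\<in>C k. hardy_sup p v \<le> B" for k
      using x B by (intro bexI[of _ "x k"]) (auto simp: C_def)
    fix k v w assume v: "v \<in> C k" and w: "w \<in> C k"
    have "cmod ((v z + w z) / 2 - y z) \<le> e"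
      if "cmod z < 1" "\<forall>j\<ge>k. cmod (x j z - y z) \<le> e" for z e
    proof -
      have "cmod (v z - y z) \<le> e" "cmod (w z - y z) \<le> e" using v w that by (auto simp: C_def)
      moreover have "(v z + w z) / 2 - y z = ((v z - y z) + (w z - y z)) / 2"
        by (simp add: field_simps)
      ultimately show ?thesis
        using norm_triangle_ineq[of "v z - y z" "w z - y z"]
        by (simp only: norm_divide norm_numeral divide_le_eq_numeral)
    qed
    then show "(\<lambda>z. (v z + w z) / 2) \<in> C k" using v w by (auto simp: C_def midpoint)
  qed blast
  show ?thesis
  proof (rule cong[OF ug(2)])
    fix z :: complex assume z: "cmod z < 1"
    have "u k \<in> E" for k using ug(1) by (auto simp: C_def)
    then have 1: "(\<lambda>k. u k z) \<longlonglongrightarrow> g z"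
      using hardy_convergence_pointwise[OF p _ _ ug(3) z] sub ug(2) by blast
    have "(\<lambda>k. u k z) \<longlonglongrightarrow> y z"
    proof (rule LIMSEQ_I)
      fix e :: real assume e: "0 < e"
      obtain N where N: "\<forall>j\<ge>N. cmod (x j z - y z) < e / 2"
        using LIMSEQ_D[OF lim[OF z], of "e / 2"] e by auto
      have "norm (u k z - y z) < e" if k: "N \<le> k" for k
      proof -
        have "\<forall>j\<ge>k. cmod (x j z - y z) \<le> e / 2"
          using N k by (meson less_imp_le order_trans)
        then have "cmod (u k z - y z) \<le> e / 2" using ug(1)[of k] z unfolding C_def by blast
        then show ?thesis using e by simp
      qed
      then show "\<exists>N. \<forall>k\<ge>N. norm (u k z - y z) < e" by blast
    qed
    with 1 show "g z = y z" by (rule LIMSEQ_unique)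
  qed
qed

text \<open>The Taylor polynomials of a dilate \<open>R (\<rho> z)\<close> with \<open>\<rho> < 1\<close> are uniformly bounded, so they give the
  claim for the dilate; the dilates have the same bound as \<open>R\<close> and converge to it pointwise.\<close>

lemma bounded_holomorphic_mult:
  assumes v: "v \<in> E" and R: "R holomorphic_on ball 0 1"
    and B: "\<And>z. cmod z < 1 \<Longrightarrow> cmod (R z) \<le> B"
  shows "(\<lambda>z. R z * v z) \<in> E"
proof -
  note vH = sub[OF v]
  define a where "a = (\<lambda>i. (deriv ^^ i) R 0 / fact i)"
  have series: "(\<lambda>i. a i * z ^ i) sums R z" if "cmod z < 1" for z
    using holomorphic_power_series[OF R, of z] that by (simp add: a_def)
  have dil: "(\<lambda>z. R (of_real \<rho> * z) * v z) \<in> E" if \<rho>: "0 < \<rho>" "\<rho> < 1" for \<rho>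
  proof -
    define x where "x = (\<lambda>n z. poly (\<Sum>i<n. monom (a i * of_real \<rho> ^ i) i) z * v z)"
    have pol: "poly (\<Sum>i<n. monom (a i * of_real \<rho> ^ i) i) z = (\<Sum>i<n. a i * (of_real \<rho> * z) ^ i)" for n z
      by (simp add: poly_sum poly_monom power_mult_distrib mult.assoc)
    define r where "r = (1 + \<rho>) / 2"
    have "summable (\<lambda>i. a i * of_real r ^ i)"
      by (rule sums_summable[OF series]) (unfold norm_of_real, use \<rho> in \<open>simp add: r_def\<close>)
    then have "summable (\<lambda>i. norm (a i * of_real \<rho> ^ i))"
      by (rule powser_insidea) (unfold norm_of_real, use \<rho> in \<open>simp add: r_def\<close>)
    then have sm: "summable (\<lambda>i. cmod (a i) * \<rho> ^ i)" using \<rho> by (simp add: norm_mult norm_power)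
    define S where "S = (\<Sum>i. cmod (a i) * \<rho> ^ i)"
    have bound: "cmod (poly (\<Sum>i<n. monom (a i * of_real \<rho> ^ i) i) z) \<le> S" if z: "cmod z < 1" for n z
    proof -
      have "cmod (\<Sum>i<n. a i * (of_real \<rho> * z) ^ i) \<le> (\<Sum>i<n. cmod (a i) * \<rho> ^ i)"
      proof (rule sum_norm_le)
        fix i
        have "cmod (a i * (of_real \<rho> * z) ^ i) = cmod (a i) * \<rho> ^ i * cmod z ^ i"
          using \<rho> by (simp add: norm_mult norm_power power_mult_distrib)
        also have "\<dots> \<le> cmod (a i) * \<rho> ^ i * 1"
          using z \<rho> by (intro mult_left_mono power_le_one) auto
        finally show "cmod (a i * (of_real \<rho> * z) ^ i) \<le> cmod (a i) * \<rho> ^ i" by simp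
      qed
      also have "\<dots> \<le> S" unfolding S_def using sm \<rho> by (intro sum_le_suminf) auto
      finally show ?thesis unfolding pol .
    qed
    show ?thesis
    proof (rule bounded_pointwise_limit_mem[of x "S powr p * hardy_sup p v"])
      show "x j \<in> E" for j unfolding x_def by (rule poly_mult[OF v])
      show "hardy_sup p (x j) \<le> S powr p * hardy_sup p v" for j
        unfolding x_def by (rule hardy_bounded_mult(2)[OF p vH _ bound]) (auto intro!: holomorphic_intros)
      fix z :: complex assume z: "cmod z < 1"
      have "cmod (of_real \<rho> * z) < 1" using z \<rho> mult_left_le_one_le[of "cmod z" \<rho>] by (simp add: norm_mult)
      from series[OF this] show "(\<lambda>j. x j z) \<longlonglongrightarrow> R (of_real \<rho> * z) * v z"
        unfolding x_def pol sums_def by (intro tendsto_intros)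
    qed
  qed
  define \<rho> where "\<rho> = (\<lambda>n. 1 - 1 / real (n + 2))"
  have \<rho>: "0 < \<rho> n" "\<rho> n < 1" for n by (auto simp: \<rho>_def)
  have \<rho>_lim: "\<rho> \<longlonglongrightarrow> 1" unfolding \<rho>_def by real_asymp
  have inD: "cmod (of_real (\<rho> n) * z) < 1" if "cmod z < 1" for z n
  proof -
    have "cmod (of_real (\<rho> n) * z) \<le> cmod z"
      using \<rho>[of n] by (simp add: norm_mult mult_left_le_one_le)
    then show ?thesis using that by simp
  qed
  show ?thesis
  proof (rule bounded_pointwise_limit_mem[of "\<lambda>n z. R (of_real (\<rho> n) * z) * v z" "B powr p * hardy_sup p v"])
    show "(\<lambda>z. R (of_real (\<rho> n) * z) * v z) \<in> E" for n by (rule dil[OF \<rho>])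
    show "hardy_sup p (\<lambda>z. R (of_real (\<rho> n) * z) * v z) \<le> B powr p * hardy_sup p v" for n
    proof (rule hardy_bounded_mult(2)[OF p vH])
      have "(R \<circ> (\<lambda>z. of_real (\<rho> n) * z)) holomorphic_on ball 0 1"
        by (intro holomorphic_on_compose_gen[OF _ R] holomorphic_intros) (use inD in auto)
      then show "(\<lambda>z. R (of_real (\<rho> n) * z)) holomorphic_on ball 0 1" by (simp add: o_def)
    qed (use B inD in auto)
    fix z :: complex assume z: "cmod z < 1"
    have "isCont R z"
      using holomorphic_on_imp_continuous_on[OF R] z by (simp add: continuous_on_eq_continuous_at)
    moreover have "(\<lambda>n. of_real (\<rho> n) * z) \<longlonglongrightarrow> of_real 1 * z" by (intro tendsto_intros \<rho>_lim)
    ultimately have "(\<lambda>n. R (of_real (\<rho> n) * z)) \<longlonglongrightarrow> R z"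
      using isCont_tendsto_compose[of z R] by simp
    then show "(\<lambda>n. R (of_real (\<rho> n) * z) * v z) \<longlonglongrightarrow> R z * v z" by (intro tendsto_intros)
  qed
qed

end

section \<open>The extremal function of an invariant subspace\<close>

lemma tendsto_powr_at_right_0:
  fixes a :: real
  assumes "0 < a"
  shows "((\<lambda>t. t powr a) \<longlongrightarrow> 0) (at_right 0)"
proof -
  have "((\<lambda>t. t powr a) \<longlongrightarrow> 0 powr a) (at_right 0)"
    using assms eventually_at_right_less[of "0::real"]
    by (intro tendsto_powr' tendsto_intros) (auto elim: eventually_mono)
  then show ?thesis by simp
qed

context closed_invariant_subspace
begin

text \<open>In the language of Beurling's theorem \<open>J\<close> is the inner function with \<open>E = J H\<^sup>p\<close> that is positive
  at \<open>0\<close>. It is obtained by normalising the element of least norm among those with value \<open>1\<close> at \<open>0\<close>.\<close>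

lemma extremal_function_exists:
  assumes "\<exists>v\<in>E. v 0 \<noteq> 0"
  obtains J c where "J \<in> E" "0 < c" "J 0 = of_real c" "hardy_sup p J = 1"
    "\<And>v. v \<in> E \<Longrightarrow> cmod (v 0) powr p \<le> c powr p * hardy_sup p v"
proof -
  define C where "C = {v \<in> E. v 0 = 1}"
  obtain v0 where v0: "v0 \<in> E" "v0 0 \<noteq> 0" using assms by blast
  have v1: "(\<lambda>z. (1 / v0 0) * v0 z) \<in> C" using scale[OF v0(1), of "1 / v0 0"] v0(2) by (simp add: C_def)
  have CH: "v \<in> hardy_space p" if "v \<in> C" for v using that sub by (auto simp: C_def)
  have bdd: "bdd_below (hardy_sup p ` C)"
    using CH hardy_sup_nonneg[OF p] by (intro bdd_belowI[of _ 0]) auto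
  define m where "m = (INF v\<in>C. hardy_sup p v)"
  have m_le: "m \<le> hardy_sup p v" if "v \<in> C" for v
    unfolding m_def using that by (intro cINF_lower bdd)
  have midC: "(\<lambda>z. (u z + v z) / 2) \<in> C" if "u \<in> C" "v \<in> C" for u v
    using that by (auto simp: C_def midpoint)
  obtain u g where u: "\<And>k. u k \<in> C" and g: "g \<in> E" "(\<lambda>k. hardy_sup p (\<lambda>z. u k z - g z)) \<longlonglongrightarrow> 0"
    and um: "\<And>k. hardy_sup p (u k) < m + 1 / Suc k"
    by (rule near_minimal_convergent[of "\<lambda>_. C" "hardy_sup p (\<lambda>z. (1 / v0 0) * v0 z)"])
       (use midC v1 in \<open>auto simp: C_def m_def\<close>)
  have uH: "u k \<in> hardy_space p" for k using CH u by blast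
  have gH: "g \<in> hardy_space p" using sub g by blast
  have "(\<lambda>k. u k 0) \<longlonglongrightarrow> g 0"
    by (rule hardy_convergence_pointwise[OF p uH gH g(2)]) simp
  moreover have "u k 0 = 1" for k using u by (auto simp: C_def)
  ultimately have g0: "g 0 = 1" by (simp add: LIMSEQ_const_iff)
  then have gC: "g \<in> C" using g by (simp add: C_def)
  have "hardy_sup p g \<le> m" by (rule hardy_sup_limit_le[OF p uH gH g(2) um])
  with m_le[OF gC] have gm: "hardy_sup p g = m" by simp
  obtain D where "D > 0" "cmod (g 0) powr p \<le> D * hardy_sup p g"
    using hardy_point_evaluation[OF p, of 0] gH by auto
  then have "0 < D" "0 < D * m" using g0 gm by simp_all
  then have m: "0 < m" by (simp add: zero_less_mult_iff)
  define c where "c = (1 / m) powr (1 / p)"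
  have c: "0 < c" "c powr p = 1 / m" using m p by (auto simp: c_def powr_powr)
  show thesis
  proof (rule that[of "\<lambda>z. of_real c * g z" c])
    show "(\<lambda>z. of_real c * g z) \<in> E" by (rule scale[OF g(1)])
    show "hardy_sup p (\<lambda>z. of_real c * g z) = 1"
      using m c by (simp add: hardy_scale[OF p gH] gm)
    fix v assume v: "v \<in> E"
    show "cmod (v 0) powr p \<le> c powr p * hardy_sup p v"
    proof (cases "v 0 = 0")
      case True
      then show ?thesis using hardy_sup_nonneg[OF p sub[OF v]] by simp
    next
      case False
      have "(\<lambda>z. (1 / v 0) * v z) \<in> C" using scale[OF v, of "1 / v 0"] False by (simp add: C_def)
      from m_le[OF this] have "m \<le> hardy_sup p v / cmod (v 0) powr p"
        by (simp only: hardy_scale[OF p sub[OF v]] norm_divide norm_one)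
           (simp add: powr_divide)
      then show ?thesis using m False by (simp add: c(2) field_simps)
    qed
  qed (use g0 c in auto)
qed

end

locale extremal_function = closed_invariant_subspace +
  fixes J :: "complex \<Rightarrow> complex" and c :: real
  assumes J_mem: "J \<in> E" and c_pos: "0 < c" and J_0: "J 0 = of_real c"
    and J_sup: "hardy_sup p J = 1"
    and extremal: "v \<in> E \<Longrightarrow> cmod (v 0) powr p \<le> c powr p * hardy_sup p v"
begin

text \<open>The extremal property in the form in which it is varied: the value at \<open>0\<close> is unchanged.\<close>

lemma one_le_perturbed:
  assumes "w \<in> E" "w 0 = 0"
  shows "1 \<le> hardy_sup p (\<lambda>z. J z + w z)"
  using extremal[OF add[OF J_mem assms(1)]] assms(2) c_pos by (simp add: J_0)

text \<open>Vary \<open>J\<close> to \<open>J (1 - t u)\<close>, where \<open>1 + Re u\<close> is the Poisson kernel of \<open>w\<close>. To first order in \<open>t\<close> the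
  norm must not decrease, so asymptotically the means of \<open>\<bar>J\<bar>\<^sup>p Re u\<close> are at most \<open>0\<close>, and those of
  \<open>\<bar>J\<bar>\<^sup>p (1 + Re u)\<close> at most \<open>1\<close>. By Jensen's inequality the latter dominate \<open>\<bar>J w\<bar>\<^sup>p\<close>.\<close>

lemma J_le_1:
  assumes w: "cmod w < 1"
  shows "cmod (J w) \<le> 1"
proof -
  let ?u = "herglotz_kernel w"
  note holu = herglotz_kernel_holomorphic[OF w]
  have "compact (?u ` cball 0 1)"
    by (intro compact_continuous_image holomorphic_on_imp_continuous_on holu compact_cball)
  then obtain U where U: "\<And>z. cmod z \<le> 1 \<Longrightarrow> cmod (?u z) \<le> U"
    by (metis bounded_iff compact_imp_bounded image_eqI mem_cball_0)
  have U0: "0 \<le> U" using U[of 0] by simp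
  have holu': "?u holomorphic_on ball 0 1" by (rule holomorphic_on_subset[OF holu]) auto
  have uJ: "(\<lambda>z. ?u z * J z) \<in> E" by (rule bounded_holomorphic_mult[OF J_mem holu' U]) auto
  note JH = sub[OF J_mem] and hJ = holo[OF J_mem]
  have main: "cmod (J w) powr p \<le> 1 + \<eta> * U / p + C * U powr p / p * t powr (p - 1)"
    if t: "0 < t" and \<eta>: "0 < \<eta>" and C: "C \<ge> 0" "\<And>a b. cmod a \<le> 1 \<Longrightarrow>
      cmod (a + b) powr p \<le> 1 + p * Re (cnj a * b) + \<eta> * cmod b + C * cmod b powr p" for t \<eta> C
  proof -
    \<comment> \<open>The pointwise bound for \<open>\<bar>1 - t u\<bar>\<^sup>p\<close> is \<open>B - p t Re u\<close>.\<close>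
    define B where "B = 1 + \<eta> * (t * U) + C * (t * U) powr p"
    define F where "F = (\<lambda>z. J z + (- of_real t) * (?u z * J z))"
    have F1: "1 \<le> hardy_sup p F"
      unfolding F_def by (rule one_le_perturbed[OF scale[OF uJ]]) simp
    have FH: "F \<in> hardy_space p" unfolding F_def by (intro sub add J_mem scale uJ)
    have ev: "p * t * cmod (J (of_real (r\<^sup>2) * w)) powr p
        \<le> p * t * hardy_mean p J r + B * hardy_mean p J r - hardy_mean p F r"
      if r: "0 < r" "r < 1" for r
    proof -
      have r0: "0 \<le> r" using r by simp
      have cJ: "continuous_on (sphere 0 r) (\<lambda>z. cmod (J z) powr p)"
        by (intro continuous_on_cmod_powr p holomorphic_continuous_circle hJ r)
      have cF: "continuous_on (sphere 0 r) (\<lambda>z. cmod (F z) powr p)"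
        by (intro continuous_on_cmod_powr p holomorphic_continuous_circle hardy_space_holomorphic[OF FH] r)
      have cu: "continuous_on (sphere 0 r) (\<lambda>z. Re (?u z))"
        by (intro continuous_on_Re holomorphic_continuous_circle holu' r)
      have cuJ: "continuous_on (sphere 0 r) (\<lambda>z. Re (?u z) * cmod (J z) powr p)"
        by (intro continuous_on_mult cu cJ)
      define X where "X = circle_mean (\<lambda>z. Re (?u z) * cmod (J z) powr p) r"
      have 1: "cmod (J (of_real (r\<^sup>2) * w)) powr p \<le> hardy_mean p J r + X"
      proof -
        have "circle_mean (\<lambda>z. (1 + Re (?u z)) * cmod (J z) powr p) r
            = circle_mean (\<lambda>z. cmod (J z) powr p + Re (?u z) * cmod (J z) powr p) r"
          by (simp add: algebra_simps)
        also have "\<dots> = hardy_mean p J r + X"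
          unfolding X_def hardy_mean_eq by (rule circle_mean_add[OF cJ cuJ r0])
        finally show ?thesis using poisson_jensen[OF p hJ w r] by simp
      qed
      have "hardy_mean p F r \<le> circle_mean (\<lambda>z. B * cmod (J z) powr p - p * t * (Re (?u z) * cmod (J z) powr p)) r"
        unfolding hardy_mean_eq
      proof (rule circle_mean_mono)
        show "continuous_on (sphere 0 r) (\<lambda>z. B * cmod (J z) powr p - p * t * (Re (?u z) * cmod (J z) powr p))"
          by (intro continuous_on_diff continuous_on_mult_left cJ cuJ)
        fix z :: complex assume z: "cmod z = r"
        let ?b = "- of_real t * ?u z"
        have bU: "cmod ?b \<le> t * U" using U[of z] z r t by (simp add: norm_mult)
        have "F z = J z * (1 + ?b)" by (simp add: F_def algebra_simps)
        then have "cmod (F z) powr p = cmod (J z) powr p * cmod (1 + ?b) powr p"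
          by (simp only: norm_mult) (simp add: powr_mult)
        also have "\<dots> \<le> cmod (J z) powr p * (B - p * t * Re (?u z))"
        proof (intro mult_left_mono)
          have "cmod (1 + ?b) powr p \<le> 1 + p * Re (cnj 1 * ?b) + \<eta> * cmod ?b + C * cmod ?b powr p"
            by (rule C(2)) simp
          also have "\<dots> \<le> 1 + p * Re (cnj 1 * ?b) + \<eta> * (t * U) + C * (t * U) powr p"
            using bU C(1) \<eta> p by (intro add_mono mult_left_mono powr_mono2) auto
          also have "\<dots> = B - p * t * Re (?u z)" by (simp add: B_def)
          finally show "cmod (1 + ?b) powr p \<le> B - p * t * Re (?u z)" .
        qed simp
        finally show "cmod (F z) powr p \<le> B * cmod (J z) powr p - p * t * (Re (?u z) * cmod (J z) powr p)"
          by (simp add: algebra_simps)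
      qed (use cF r in auto)
      also have "\<dots> = B * hardy_mean p J r - p * t * X"
        unfolding X_def hardy_mean_eq
          circle_mean_mult_left[OF cJ r0, symmetric] circle_mean_mult_left[OF cuJ r0, symmetric]
        by (intro circle_mean_diff continuous_on_mult_left cJ cuJ r0)
      finally have "p * t * X \<le> B * hardy_mean p J r - hardy_mean p F r" by simp
      moreover have "p * t * cmod (J (of_real (r\<^sup>2) * w)) powr p \<le> p * t * (hardy_mean p J r + X)"
        using 1 p t by (intro mult_left_mono) auto
      ultimately show ?thesis by (simp add: distrib_left)
    qed
    have "isCont J w"
      using holomorphic_on_imp_continuous_on[OF hJ] w by (simp add: continuous_on_eq_continuous_at)
    moreover have "((\<lambda>r. of_real (r\<^sup>2) * w) \<longlongrightarrow> of_real (1\<^sup>2) * w) (at_left 1)"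
      by (intro tendsto_intros)
    ultimately have "((\<lambda>r. J (of_real (r\<^sup>2) * w)) \<longlongrightarrow> J w) (at_left 1)"
      using isCont_tendsto_compose[of w J] by simp
    then have lim1: "((\<lambda>r. p * t * cmod (J (of_real (r\<^sup>2) * w)) powr p) \<longlongrightarrow> p * t * cmod (J w) powr p) (at_left 1)"
      using p by (intro tendsto_intros tendsto_powr') auto
    have lim2: "((\<lambda>r. p * t * hardy_mean p J r + B * hardy_mean p J r - hardy_mean p F r)
        \<longlongrightarrow> p * t * hardy_sup p J + B * hardy_sup p J - hardy_sup p F) (at_left 1)"
      by (intro tendsto_intros hardy_mean_tendsto_sup p JH FH)
    have "p * t * cmod (J w) powr p \<le> p * t * hardy_sup p J + B * hardy_sup p J - hardy_sup p F"
      by (rule tendsto_le[OF trivial_limit_at_left_real lim2 lim1])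
         (use eventually_at_left_1 in \<open>eventually_elim, use ev in blast\<close>)
    then have "p * t * cmod (J w) powr p \<le> p * t + \<eta> * (t * U) + C * (t * U) powr p"
      using F1 by (simp add: J_sup B_def)
    also have "(t * U) powr p = t * t powr (p - 1) * U powr p"
      using t U0 by (simp add: powr_mult powr_diff)
    also have "p * t + \<eta> * (t * U) + C * (t * t powr (p - 1) * U powr p)
        = p * t * (1 + \<eta> * U / p + C * U powr p / p * t powr (p - 1))"
      using p by (simp add: field_simps)
    finally have "p * t * cmod (J w) powr p \<le> p * t * (1 + \<eta> * U / p + C * U powr p / p * t powr (p - 1))" .
    then show ?thesis using p t by simp
  qed
  have "cmod (J w) powr p \<le> 1 + \<eta> * (U / p)" if \<eta>: "0 < \<eta>" for \<eta>
  proof -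
    obtain C where C: "C \<ge> 0" "\<And>a b. cmod a \<le> 1 \<Longrightarrow>
      cmod (a + b) powr p \<le> 1 + p * Re (cnj a * b) + \<eta> * cmod b + C * cmod b powr p"
      using cmod_powr_expansion_closed_disc[OF p \<eta>] by auto
    have "((\<lambda>t. 1 + \<eta> * U / p + C * U powr p / p * t powr (p - 1)) \<longlongrightarrow> 1 + \<eta> * U / p + C * U powr p / p * 0) (at_right 0)"
      using p by (intro tendsto_intros tendsto_powr_at_right_0) simp
    moreover have "\<forall>\<^sub>F t in at_right 0. cmod (J w) powr p \<le> 1 + \<eta> * U / p + C * U powr p / p * t powr (p - 1)"
      using eventually_at_right_less[of "0::real"] by eventually_elim (rule main[OF _ \<eta> C])
    ultimately have "cmod (J w) powr p \<le> 1 + \<eta> * U / p + C * U powr p / p * 0"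
      by (intro tendsto_lowerbound) auto
    then show ?thesis by simp
  qed
  note bound = this
  have "cmod (J w) powr p \<le> 1"
  proof (rule field_le_epsilon)
    fix e :: real assume e: "0 < e"
    have "e / (U / p + 1) * (U / p) \<le> e"
      using e U0 p by (simp add: field_simps add_nonneg_pos)
    moreover have "0 < e / (U / p + 1)" using e U0 p by (simp add: add_nonneg_pos)
    ultimately show "cmod (J w) powr p \<le> 1 + e" using bound[of "e / (U / p + 1)"] by simp
  qed
  then show ?thesis using powr_less_mono2[of p 1 "cmod (J w)"] p by fastforce
qed

lemma c_le_1: "c \<le> 1"
  using J_le_1[of 0] J_0 c_pos by simp

text \<open>The first variation of the norm at \<open>J\<close> in the direction \<open>w\<close>. Because of \<open>\<bar>J\<bar> \<le> 1\<close> the expansion on the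
  closed disc applies, whose linear term is the pairing with \<open>J\<close>.\<close>

lemma pairing_lower_bound:
  assumes w: "w \<in> E" "w 0 = 0" and e: "0 < e"
  shows "\<forall>\<^sub>F r in at_left 1. - e \<le> Re (circle_mean (\<lambda>z. cnj (J z) * w z) r)"
proof -
  define W where "W = 1 + hardy_sup p w"
  have W: "1 \<le> W" using hardy_sup_nonneg[OF p sub[OF w(1)]] by (simp add: W_def)
  \<comment> \<open>With this choice the error terms add up to \<open>- e p\<close>.\<close>
  define \<eta> where "\<eta> = e * p / (1 + 2 * W)"
  have \<eta>: "0 < \<eta>" "\<eta> * (1 + 2 * W) = e * p" using e p W by (auto simp: \<eta>_def)
  obtain C where C: "C \<ge> 0" "\<And>a b. cmod a \<le> 1 \<Longrightarrow>
      cmod (a + b) powr p \<le> 1 + p * Re (cnj a * b) + \<eta> * cmod b + C * cmod b powr p"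
    using cmod_powr_expansion_closed_disc[OF p \<eta>(1)] by auto
  have "((\<lambda>t. C * t powr (p - 1)) \<longlongrightarrow> C * 0) (at_right 0)"
    using p by (intro tendsto_intros tendsto_powr_at_right_0) simp
  then have "\<forall>\<^sub>F t in at_right 0. C * t powr (p - 1) < \<eta>"
    using \<eta>(1) by (intro order_tendstoD(2)) auto
  then have "\<forall>\<^sub>F t in at_right (0::real). C * t powr (p - 1) < \<eta> \<and> 0 < t"
    using eventually_at_right_less[of "0::real"] by eventually_elim auto
  then obtain t where t: "C * t powr (p - 1) < \<eta>" "0 < t"
    using eventually_happens'[OF trivial_limit_at_right_real] by blast
  define F where "F = (\<lambda>z. J z + of_real t * w z)"
  have F1: "1 \<le> hardy_sup p F"
    unfolding F_def by (rule one_le_perturbed[OF scale[OF w(1)]]) (simp add: w)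
  have FH: "F \<in> hardy_space p" unfolding F_def by (intro sub add J_mem scale w)
  have "\<forall>\<^sub>F r in at_left 1. 1 - \<eta> * t < hardy_mean p F r"
    using F1 \<eta> t by (intro order_tendstoD(1)[OF hardy_mean_tendsto_sup[OF p FH]]) (smt (verit) mult_pos_pos)
  then show ?thesis using eventually_at_left_1
  proof eventually_elim
    case (elim r)
    then have r: "0 < r" "r < 1" "0 \<le> r" by auto
    have cont: "continuous_on (sphere 0 r) J" "continuous_on (sphere 0 r) w" "continuous_on (sphere 0 r) F"
      using holo[OF J_mem] holo[OF w(1)] hardy_space_holomorphic[OF FH] r
      by (auto intro!: holomorphic_continuous_circle)
    have cp: "continuous_on (sphere 0 r) (\<lambda>z. cnj (J z) * w z)" by (intro continuous_intros cont)
    have cw: "continuous_on (sphere 0 r) (\<lambda>z. cmod (w z) powr p)" "continuous_on (sphere 0 r) (\<lambda>z. Re (cnj (J z) * w z))"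
      using cont by (auto intro!: continuous_on_cmod_powr p continuous_intros)
    define k where "k = (\<eta> * t + C * t powr p)"
    have "hardy_mean p F r \<le> circle_mean (\<lambda>z. (1 + \<eta> * t) + (p * t * Re (cnj (J z) * w z) + k * cmod (w z) powr p)) r"
      unfolding hardy_mean_eq
    proof (rule circle_mean_mono)
      show "continuous_on (sphere 0 r) (\<lambda>z. cmod (F z) powr p)" by (intro continuous_on_cmod_powr p cont)
      show "continuous_on (sphere 0 r) (\<lambda>z. (1 + \<eta> * t) + (p * t * Re (cnj (J z) * w z) + k * cmod (w z) powr p))"
        by (intro continuous_on_add continuous_on_const continuous_on_mult_left cw)
      fix z :: complex assume z: "cmod z = r"
      have w1: "cmod (w z) \<le> 1 + cmod (w z) powr p"
      proof (cases "cmod (w z) \<le> 1")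
        case False
        then have "cmod (w z) powr 1 \<le> cmod (w z) powr p" using p by (intro powr_mono) auto
        then show ?thesis using False by simp
      qed (use powr_ge_zero[of "cmod (w z)" p] in linarith)
      have "cmod (F z) powr p \<le> 1 + p * Re (cnj (J z) * (of_real t * w z)) + \<eta> * cmod (of_real t * w z)
          + C * cmod (of_real t * w z) powr p"
        unfolding F_def by (rule C(2)) (use J_le_1 z r in auto)
      also have "\<dots> = 1 + p * t * Re (cnj (J z) * w z) + \<eta> * t * cmod (w z) + C * t powr p * cmod (w z) powr p"
        using t by (simp add: norm_mult powr_mult algebra_simps)
      also have "\<eta> * t * cmod (w z) \<le> \<eta> * t * (1 + cmod (w z) powr p)"
        using w1 \<eta> t by (intro mult_left_mono) auto
      finally show "cmod (F z) powr p \<le> (1 + \<eta> * t) + (p * t * Re (cnj (J z) * w z) + k * cmod (w z) powr p)"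
        unfolding k_def by (simp only: distrib_left distrib_right mult_1_right) linarith
    qed (use r in auto)
    also have "\<dots> = (1 + \<eta> * t) + (p * t * Re (circle_mean (\<lambda>z. cnj (J z) * w z) r) + k * hardy_mean p w r)"
      unfolding hardy_mean_eq circle_mean_Re[OF cp r(3), symmetric]
        circle_mean_mult_left[OF cw(1) r(3), symmetric] circle_mean_mult_left[OF cw(2) r(3), symmetric]
      by (subst circle_mean_add; (intro continuous_on_add continuous_on_const continuous_on_mult_left cw r)?;
          subst circle_mean_add; (intro continuous_on_mult_left cw r)?; simp)
    finally have 1: "1 - \<eta> * t < (1 + \<eta> * t) + (p * t * Re (circle_mean (\<lambda>z. cnj (J z) * w z) r) + k * hardy_mean p w r)"
      using elim by linarith
    have tp: "t powr p = t * t powr (p - 1)" using t by (simp add: powr_diff)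
    have "C * t powr p \<le> \<eta> * t"
      using mult_right_mono[OF less_imp_le[OF t(1)], of t] t(2) by (simp add: tp mult_ac)
    then have "k \<le> 2 * (\<eta> * t)" "0 \<le> k" using C \<eta> t by (auto simp: k_def)
    moreover have "hardy_mean p w r \<le> W - 1" "0 \<le> hardy_mean p w r"
      using hardy_mean_le_sup[OF sub[OF w(1)] r(1,2)] hardy_mean_nonneg[OF p holo[OF w(1)] r(1,2)]
      by (auto simp: W_def)
    ultimately have "k * hardy_mean p w r \<le> 2 * (\<eta> * t) * (W - 1)"
      by (intro mult_mono) auto
    with 1 have "0 < t * (2 * \<eta> + p * Re (circle_mean (\<lambda>z. cnj (J z) * w z) r) + 2 * \<eta> * (W - 1))"
      by (simp add: algebra_simps)
    then have "0 < 2 * \<eta> + p * Re (circle_mean (\<lambda>z. cnj (J z) * w z) r) + 2 * \<eta> * (W - 1)"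
      using t(2) by (simp add: zero_less_mult_iff)
    then have "- (\<eta> * (1 + 2 * W)) < p * Re (circle_mean (\<lambda>z. cnj (J z) * w z) r)"
      using \<eta>(1) by (simp add: algebra_simps)
    then have "p * (- e) < p * Re (circle_mean (\<lambda>z. cnj (J z) * w z) r)"
      unfolding \<eta>(2) by (simp add: mult.commute)
    then have "- e < Re (circle_mean (\<lambda>z. cnj (J z) * w z) r)"
      using p by (simp only: mult_less_cancel_left_pos)
    then show ?case by simp
  qed
qed

text \<open>The lower bound for the four directions \<open>w\<close>, \<open>- w\<close>, \<open>\<i> w\<close> and \<open>- \<i> w\<close>.\<close>

lemma pairing_vanishing:
  assumes w: "w \<in> E" "w 0 = 0"
  shows "((\<lambda>r. circle_mean (\<lambda>z. cnj (J z) * w z) r) \<longlongrightarrow> 0) (at_left 1)"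
proof (rule tendstoI)
  fix e :: real assume e: "0 < e"
  define d where "d = e / 3"
  have d: "0 < d" using e by (simp add: d_def)
  have "\<forall>\<^sub>F r in at_left 1. - d \<le> Re (circle_mean (\<lambda>z. cnj (J z) * (a * w z)) r)" for a
    by (rule pairing_lower_bound[OF scale[OF w(1)] _ d]) (simp add: w)
  from this[of 1] this[of "- 1"] this[of \<i>] this[of "- \<i>"] eventually_at_left_1
  show "\<forall>\<^sub>F r in at_left 1. dist (circle_mean (\<lambda>z. cnj (J z) * w z) r) 0 < e"
  proof eventually_elim
    case (elim r)
    have "continuous_on (sphere 0 r) (\<lambda>z. cnj (J z) * w z)"
      using elim by (intro continuous_on_mult continuous_on_cnj holomorphic_continuous_circle holo J_mem w) auto
    then have lin: "circle_mean (\<lambda>z. cnj (J z) * (a * w z)) r = a * circle_mean (\<lambda>z. cnj (J z) * w z) r" for a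
      using elim circle_mean_mult_left[of r "\<lambda>z. cnj (J z) * w z" a] by (simp add: mult.left_commute)
    have "cmod (circle_mean (\<lambda>z. cnj (J z) * w z) r)
        \<le> \<bar>Re (circle_mean (\<lambda>z. cnj (J z) * w z) r)\<bar> + \<bar>Im (circle_mean (\<lambda>z. cnj (J z) * w z) r)\<bar>"
      by (rule cmod_le)
    also have "\<dots> \<le> d + d" using elim(1-4) unfolding lin by (intro add_mono) auto
    also have "\<dots> < e" using e by (simp add: d_def)
    finally show ?case by simp
  qed
qed

text \<open>The means of \<open>\<bar>J\<bar>\<^sup>p\<close> tend to \<open>1\<close>, and \<open>1 - x\<^sup>2 \<le> K (1 - x\<^sup>p)\<close> holds for \<open>0 \<le> x \<le> 1\<close> with a constant \<open>K\<close>
  depending only on \<open>p\<close>. So \<open>J\<close> has modulus \<open>1\<close> on the unit circle in the sense of square means.\<close>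

lemma mean_square_tendsto: "((\<lambda>r. circle_mean (\<lambda>z. (cmod (J z))\<^sup>2) r) \<longlongrightarrow> 1) (at_left 1)"
proof -
  define K where "K = max 1 (2 / p)"
  have K: "1 \<le> K" by (simp add: K_def)
  have pt: "1 - K * (1 - x powr p) \<le> x\<^sup>2" if x: "0 \<le> x" "x \<le> 1" for x
  proof -
    have xp: "x powr p \<le> 1" using x p by (simp add: powr_le1)
    show ?thesis
    proof (cases "p < 2")
      case True
      have "1 - K * (1 - x powr p) \<le> 1 + (2 / p) * (x powr p - 1)"
      proof -
        have "(2 / p) * (1 - x powr p) \<le> K * (1 - x powr p)"
          using xp by (intro mult_right_mono) (auto simp: K_def)
        moreover have "(2 / p) * (x powr p - 1) = - ((2 / p) * (1 - x powr p))"
          by (simp add: right_diff_distrib)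
        ultimately show ?thesis by linarith
      qed
      also have "\<dots> \<le> (x powr p) powr (2 / p)" using True p by (intro bernoulli_powr) auto
      also have "\<dots> = x\<^sup>2" using p x by (simp add: powr_powr)
      finally show ?thesis .
    next
      case False
      have "1 * (1 - x powr p) \<le> K * (1 - x powr p)" using K xp by (intro mult_right_mono) auto
      moreover have "x powr p \<le> x powr 2" using False x by (intro powr_mono') auto
      ultimately show ?thesis using x by simp
    qed
  qed
  have "((\<lambda>r. 1 - K * (1 - hardy_mean p J r)) \<longlongrightarrow> 1 - K * (1 - hardy_sup p J)) (at_left 1)"
    by (intro tendsto_intros hardy_mean_tendsto_sup p sub J_mem)
  then have lim: "((\<lambda>r. 1 - K * (1 - hardy_mean p J r)) \<longlongrightarrow> 1) (at_left 1)" by (simp add: J_sup)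
  show ?thesis
  proof (rule tendsto_sandwich[OF _ _ lim tendsto_const])
    show "\<forall>\<^sub>F r in at_left 1. 1 - K * (1 - hardy_mean p J r) \<le> circle_mean (\<lambda>z. (cmod (J z))\<^sup>2) r"
      using eventually_at_left_1
    proof eventually_elim
      case (elim r)
      then have r: "0 \<le> r" "r < 1" by auto
      have cJ: "continuous_on (sphere 0 r) J" by (intro holomorphic_continuous_circle holo J_mem r)
      have cp: "continuous_on (sphere 0 r) (\<lambda>z. cmod (J z) powr p)" by (intro continuous_on_cmod_powr p cJ)
      have "1 - K * (1 - hardy_mean p J r) = circle_mean (\<lambda>z. 1 - K * (1 - cmod (J z) powr p)) r"
      proof -
        have "circle_mean (\<lambda>z. 1 - K * (1 - cmod (J z) powr p)) r
            = 1 - circle_mean (\<lambda>z. K * (1 - cmod (J z) powr p)) r"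
          by (subst circle_mean_diff) (intro continuous_on_diff continuous_on_const continuous_on_mult_left cp r | simp)+
        also have "circle_mean (\<lambda>z. K * (1 - cmod (J z) powr p)) r = K * (1 - hardy_mean p J r)"
          unfolding hardy_mean_eq
          by (subst circle_mean_mult_left, (intro continuous_on_diff continuous_on_const cp r)+,
              subst circle_mean_diff, (intro continuous_on_const cp r)+, simp)
        finally show ?thesis by simp
      qed
      also have "\<dots> \<le> circle_mean (\<lambda>z. (cmod (J z))\<^sup>2) r"
      proof (rule circle_mean_mono)
        show "continuous_on (sphere 0 r) (\<lambda>z. 1 - K * (1 - cmod (J z) powr p))"
          by (intro continuous_on_diff continuous_on_const continuous_on_mult_left cp)
        show "continuous_on (sphere 0 r) (\<lambda>z. (cmod (J z))\<^sup>2)" by (intro continuous_intros cJ)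
      qed (use pt J_le_1 r in auto)
      finally show ?case .
    qed
    show "\<forall>\<^sub>F r in at_left 1. circle_mean (\<lambda>z. (cmod (J z))\<^sup>2) r \<le> 1"
      using eventually_at_left_1
    proof eventually_elim
      case (elim r)
      have cJ: "continuous_on (sphere 0 r) J" using elim by (intro holomorphic_continuous_circle holo J_mem) auto
      show ?case
        by (rule circle_mean_le_bound) (use elim J_le_1 in \<open>auto intro!: continuous_intros cJ power_le_one\<close>)
    qed
  qed
qed

text \<open>Subtracting the multiple of \<open>J\<close> with the same value at \<open>0\<close> leaves an element on which the pairing vanishes.\<close>

lemma pairing:
  assumes v: "v \<in> E"
  shows "((\<lambda>r. circle_mean (\<lambda>z. cnj (J z) * v z) r) \<longlongrightarrow> v 0 / of_real c) (at_left 1)"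
proof -
  define k where "k = v 0 / of_real c"
  define w where "w = (\<lambda>z. v z - k * J z)"
  have w: "w \<in> E" unfolding w_def by (intro diff v scale J_mem)
  have w0: "w 0 = 0" using c_pos by (simp add: w_def k_def J_0)
  have "((\<lambda>r. circle_mean (\<lambda>z. cnj (J z) * w z) r + k * of_real (circle_mean (\<lambda>z. (cmod (J z))\<^sup>2) r))
      \<longlongrightarrow> 0 + k * of_real 1) (at_left 1)"
    by (intro tendsto_intros pairing_vanishing w w0 mean_square_tendsto)
  then have lim: "((\<lambda>r. circle_mean (\<lambda>z. cnj (J z) * w z) r + k * of_real (circle_mean (\<lambda>z. (cmod (J z))\<^sup>2) r))
      \<longlongrightarrow> v 0 / of_real c) (at_left 1)" by (simp add: k_def)
  show ?thesis
  proof (rule Lim_transform_eventually[OF lim])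
    show "\<forall>\<^sub>F r in at_left 1. circle_mean (\<lambda>z. cnj (J z) * w z) r + k * of_real (circle_mean (\<lambda>z. (cmod (J z))\<^sup>2) r)
        = circle_mean (\<lambda>z. cnj (J z) * v z) r"
      using eventually_at_left_1
    proof eventually_elim
      case (elim r)
      then have r: "0 \<le> r" "r < 1" by auto
      have cJ: "continuous_on (sphere 0 r) J" by (intro holomorphic_continuous_circle holo J_mem r)
      have cw: "continuous_on (sphere 0 r) w" by (intro holomorphic_continuous_circle holo w r)
      have c2: "continuous_on (sphere 0 r) (\<lambda>z. (cmod (J z))\<^sup>2)" by (intro continuous_intros cJ)
      have c1: "continuous_on (sphere 0 r) (\<lambda>z. cnj (J z) * w z)" by (intro continuous_intros cJ cw)
      have c3: "continuous_on (sphere 0 r) (\<lambda>z. complex_of_real ((cmod (J z))\<^sup>2))"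
        by (intro continuous_intros cJ)
      have "circle_mean (\<lambda>z. cnj (J z) * v z) r
          = circle_mean (\<lambda>z. cnj (J z) * w z + k * of_real ((cmod (J z))\<^sup>2)) r"
        unfolding complex_norm_square by (simp add: w_def algebra_simps)
      also have "\<dots> = circle_mean (\<lambda>z. cnj (J z) * w z) r + circle_mean (\<lambda>z. k * of_real ((cmod (J z))\<^sup>2)) r"
        by (intro circle_mean_add c1 continuous_on_mult_left c3 r)
      also have "circle_mean (\<lambda>z. k * of_real ((cmod (J z))\<^sup>2)) r = k * of_real (circle_mean (\<lambda>z. (cmod (J z))\<^sup>2) r)"
        unfolding circle_mean_mult_left[OF c3 r(1)] circle_mean_linear[OF bounded_linear_of_real c2 r(1)] ..
      finally show ?case by simp
    qed
  qed
qed

end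

section \<open>The point of an invariant subspace nearest to 1\<close>

text \<open>The zeros of \<open>1 - (1 - c \<zeta>)\<^sup>s\<close>: the number \<open>1 - c \<zeta>\<close> has positive real part, so its argument is less
  than \<open>\<pi>/2\<close> in modulus, and that of the power is less than \<open>\<pi>\<close>. Hence the power equals \<open>1\<close> only if
  \<open>1 - c \<zeta> = 1\<close>.\<close>

lemma power_branch:
  fixes c s :: real
  assumes c: "0 < c" "c < 1" and s: "0 < s" "s < 2"
  obtains H where "H holomorphic_on cball 0 1" "\<And>\<zeta>. cmod \<zeta> \<le> 1 \<Longrightarrow> H \<zeta> \<noteq> 0"
    "\<And>\<zeta>. cmod \<zeta> \<le> 1 \<Longrightarrow> 1 - exp (of_real s * Ln (1 - of_real c * \<zeta>)) = \<zeta> * H \<zeta>"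
proof -
  define B where "B = ball (0::complex) (1 / c)"
  have Re_pos: "0 < Re (1 - of_real c * \<zeta>)" if "\<zeta> \<in> B" for \<zeta>
  proof -
    have "Re (of_real c * \<zeta>) \<le> c * cmod \<zeta>"
      using complex_Re_le_cmod[of "of_real c * \<zeta>"] c by (simp add: norm_mult)
    also have "\<dots> < 1" using that c by (simp add: B_def field_simps)
    finally show ?thesis by simp
  qed
  have "1 < 1 / c" using c by simp
  then have sub: "cball 0 1 \<subseteq> B" unfolding B_def by (simp add: cball_subset_ball_iff)
  define \<psi> where "\<psi> = (\<lambda>\<zeta>. 1 - exp (of_real s * Ln (1 - of_real c * \<zeta>)))"
  have nonpos: "1 - of_real c * \<zeta> \<notin> \<real>\<^sub>\<le>\<^sub>0" if "\<zeta> \<in> B" for \<zeta>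
    using Re_pos[OF that] by (auto simp: complex_nonpos_Reals_iff)
  have hol: "\<psi> holomorphic_on B"
    unfolding \<psi>_def by (intro holomorphic_intros nonpos)
  have \<psi>0: "\<psi> 0 = 0" by (simp add: \<psi>_def)
  have "(\<psi> has_field_derivative of_real s * of_real c) (at 0)"
    unfolding \<psi>_def by (auto intro!: derivative_eq_intros)
  then have d: "deriv \<psi> 0 = of_real (s * c)" by (simp add: DERIV_imp_deriv)
  define H where "H = (\<lambda>\<zeta>. if \<zeta> = 0 then deriv \<psi> 0 else (\<psi> \<zeta> - \<psi> 0) / (\<zeta> - 0))"
  have "H holomorphic_on B"
    unfolding H_def by (rule pole_lemma[OF hol]) (use c in \<open>simp add: B_def interior_open\<close>)
  then have hH: "H holomorphic_on cball 0 1" by (rule holomorphic_on_subset[OF _ sub])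
  have eq: "\<psi> \<zeta> = \<zeta> * H \<zeta>" for \<zeta> by (simp add: H_def \<psi>0)
  have nz: "H \<zeta> \<noteq> 0" if \<zeta>: "cmod \<zeta> \<le> 1" for \<zeta>
  proof (cases "\<zeta> = 0")
    case True
    then show ?thesis using c s by (simp add: H_def d)
  next
    case False
    have "\<psi> \<zeta> \<noteq> 0"
    proof
      assume 0: "\<psi> \<zeta> = 0"
      let ?W = "1 - of_real c * \<zeta>"
      have W: "0 < Re ?W" using Re_pos sub \<zeta> by auto
      then have W0: "?W \<noteq> 0" by (metis less_irrefl zero_complex.simps(1))
      have "exp (of_real s * Ln ?W) = 1" using 0 by (simp add: \<psi>_def)
      then obtain n :: int where n: "s * Re (Ln ?W) = 0" "s * Im (Ln ?W) = of_int (2 * n) * pi"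
        by (auto simp: exp_eq_1)
      have "\<bar>Im (Ln ?W)\<bar> < pi / 2" by (rule Re_Ln_pos_lt_imp[OF W])
      then have "s * \<bar>Im (Ln ?W)\<bar> < s * (pi / 2)" using s by (intro mult_strict_left_mono) auto
      also have "\<dots> < 2 * (pi / 2)" using s by (intro mult_strict_right_mono) auto
      finally have "\<bar>s * Im (Ln ?W)\<bar> < pi" using s by (simp add: abs_mult)
      then have "\<bar>real_of_int (2 * n)\<bar> * pi < 1 * pi" unfolding n(2) by (simp add: abs_mult)
      then have "\<bar>real_of_int (2 * n)\<bar> < 1" by (rule mult_right_less_imp_less) simp
      then have "n = 0" by linarith
      then have "Ln ?W = 0" using n s by (simp add: complex_eq_iff)
      then have "?W = 1" using W0 by (metis exp_Ln exp_zero)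
      then show False using False c by simp
    qed
    then show ?thesis using eq[of \<zeta>] by auto
  qed
  show thesis by (rule that[OF hH nz]) (use eq in \<open>auto simp: \<psi>_def\<close>)
qed

context extremal_function
begin

text \<open>If \<open>J = (z - w) \<psi>\<close>, then \<open>v = (1 - cnj w z) \<psi>\<close> has asymptotically the same means as \<open>J\<close>, by
  \<open>\<bar>1 - cnj w z\<bar>\<^sup>2 = \<bar>z - w\<bar>\<^sup>2 + (1 - \<bar>w\<bar>\<^sup>2) (1 - \<bar>z\<bar>\<^sup>2)\<close>. But \<open>\<bar>v 0\<bar> = c / \<bar>w\<bar>\<close> exceeds the largest value
  \<open>c\<close> allowed for elements of \<open>E\<close> of norm at most \<open>1\<close>.\<close>

lemma no_zero_factor:
  assumes w: "cmod w < 1" and \<psi>: "\<psi> \<in> E" and eq: "\<And>z. cmod z < 1 \<Longrightarrow> J z = (z - w) * \<psi> z"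
  shows False
proof -
  have J0: "J 0 = - w * \<psi> 0" using eq[of 0] by simp
  then have w0: "w \<noteq> 0" using J_0 c_pos by auto
  define v where "v = (\<lambda>z. poly [:1, - cnj w:] z * \<psi> z)"
  have v: "v \<in> E" unfolding v_def by (rule poly_mult[OF \<psi>])
  have v_eq: "v z = (1 - cnj w * z) * \<psi> z" for z by (simp add: v_def algebra_simps)
  note vH = sub[OF v]
  \<comment> \<open>A bound for \<open>\<bar>1 - cnj w z\<bar> / \<bar>z - w\<bar>\<close> on the circle of radius \<open>r\<close>, tending to \<open>1\<close>.\<close>
  define k where "k = (\<lambda>r. sqrt (1 + (1 - r\<^sup>2) / (r - cmod w)\<^sup>2))"
  have pw: "\<forall>\<^sub>F r in at_left 1. hardy_mean p v r \<le> k r powr p * hardy_mean p J r"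
  proof -
    have "\<forall>\<^sub>F r in at_left 1. r \<in> {cmod w<..<1}"
      using w by (intro eventually_at_leftI[of "cmod w"]) auto
    then show ?thesis
    proof eventually_elim
      case (elim r)
      then have r: "0 < r" "r < 1" "cmod w < r" by (auto intro: le_less_trans[OF norm_ge_zero])
      have cJ: "continuous_on (sphere 0 r) (\<lambda>z. cmod (J z) powr p)"
        by (intro continuous_on_cmod_powr p holomorphic_continuous_circle holo J_mem r)
      have "hardy_mean p v r \<le> circle_mean (\<lambda>z. k r powr p * cmod (J z) powr p) r"
        unfolding hardy_mean_eq
      proof (rule circle_mean_mono)
        show "continuous_on (sphere 0 r) (\<lambda>z. cmod (v z) powr p)"
          by (intro continuous_on_cmod_powr p holomorphic_continuous_circle holo v r)
        fix z :: complex assume z: "cmod z = r"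
        have d: "r - cmod w \<le> cmod (z - w)" using norm_triangle_ineq2[of z w] z by simp
        have 1: "(cmod (1 - cnj w * z))\<^sup>2 = (cmod (z - w))\<^sup>2 + (1 - (cmod w)\<^sup>2) * (1 - (cmod z)\<^sup>2)"
          unfolding cmod_power2 by (simp add: power2_eq_square algebra_simps)
        have 2: "(1 - (cmod w)\<^sup>2) * (1 - (cmod z)\<^sup>2) \<le> 1 * (1 - r\<^sup>2)"
          unfolding z using r by (intro mult_right_mono) (auto simp: power_le_one)
        have 3: "1 * (1 - r\<^sup>2) \<le> (cmod (z - w))\<^sup>2 * ((1 - r\<^sup>2) / (r - cmod w)\<^sup>2)"
        proof -
          have "(r - cmod w)\<^sup>2 * ((1 - r\<^sup>2) / (r - cmod w)\<^sup>2) \<le> (cmod (z - w))\<^sup>2 * ((1 - r\<^sup>2) / (r - cmod w)\<^sup>2)"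
            using d r by (intro mult_right_mono power_mono) (auto simp: power_le_one)
          then show ?thesis using r by simp
        qed
        have "(cmod (z - w))\<^sup>2 + (cmod (z - w))\<^sup>2 * ((1 - r\<^sup>2) / (r - cmod w)\<^sup>2) = (k r * cmod (z - w))\<^sup>2"
          using r by (simp add: k_def power_mult_distrib power_le_one algebra_simps)
        with 1 2 3 have "(cmod (1 - cnj w * z))\<^sup>2 \<le> (k r * cmod (z - w))\<^sup>2" by linarith
        then have "cmod (1 - cnj w * z) \<le> k r * cmod (z - w)"
          by (rule power2_le_imp_le) (use r in \<open>simp add: k_def power_le_one\<close>)
        then have "cmod (1 - cnj w * z) * cmod (\<psi> z) \<le> k r * cmod (z - w) * cmod (\<psi> z)"
          by (intro mult_right_mono) auto
        then have "cmod (v z) \<le> k r * cmod (J z)"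
          using eq[of z] z r by (simp add: v_eq norm_mult mult.assoc)
        then have "cmod (v z) powr p \<le> (k r * cmod (J z)) powr p" using p by (intro powr_mono2) auto
        also have "\<dots> = k r powr p * cmod (J z) powr p"
          by (rule powr_mult)
        finally show "cmod (v z) powr p \<le> k r powr p * cmod (J z) powr p" .
      qed (use cJ r in \<open>auto intro!: continuous_on_mult_left\<close>)
      also have "\<dots> = k r powr p * hardy_mean p J r"
        unfolding hardy_mean_eq using cJ r by (intro circle_mean_mult_left) auto
      finally show ?case .
    qed
  qed
  have "(k \<longlongrightarrow> sqrt (1 + (1 - 1\<^sup>2) / (1 - cmod w)\<^sup>2)) (at_left 1)"
    unfolding k_def using w by (intro tendsto_intros) auto
  then have "((\<lambda>r. k r powr p * hardy_mean p J r) \<longlongrightarrow> 1 powr p * hardy_sup p J) (at_left 1)"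
    by (intro tendsto_intros hardy_mean_tendsto_sup p sub J_mem) auto
  from tendsto_le[OF trivial_limit_at_left_real this hardy_mean_tendsto_sup[OF p vH] pw]
  have "hardy_sup p v \<le> 1" by (simp add: J_sup)
  then have "cmod (v 0) powr p \<le> c powr p * 1"
    using extremal[OF v] by (meson mult_left_mono order_trans powr_ge_zero)
  then have "cmod (v 0) powr p \<le> c powr p" by simp
  then have v0: "cmod (v 0) \<le> c" using powr_less_mono2[of p c "cmod (v 0)"] p c_pos by force
  have "c = cmod w * cmod (v 0)"
    using arg_cong[OF J0, of cmod] J_0 c_pos by (simp add: norm_mult v_eq)
  also have "\<dots> < 1 * c"
  proof (cases "v 0 = 0")
    case False
    then have "cmod w * cmod (v 0) < 1 * cmod (v 0)" using w by (intro mult_strict_right_mono) auto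
    then show ?thesis using v0 by simp
  qed (use c_pos in simp)
  finally show False by simp
qed

lemma J_constant:
  assumes "c = 1" "cmod z < 1"
  shows "J z = 1"
proof -
  have "J constant_on ball 0 1"
  proof (rule maximum_modulus_principle[OF holo[OF J_mem]])
    show "cmod (J z) \<le> cmod (J 0)" if "z \<in> ball 0 1" for z
      using J_le_1[of z] that assms(1) by (simp add: J_0)
  qed auto
  then obtain a where "\<And>z. z \<in> ball 0 1 \<Longrightarrow> J z = a" by (auto simp: constant_on_def)
  then show ?thesis using assms J_0 by (metis centre_in_ball mem_ball_0 of_real_1 zero_less_one)
qed

text \<open>Let \<open>K = 1 - \<phi>\<close>. The tangent inequality at \<open>K\<close> bounds the mean of \<open>\<bar>1 - v\<bar>\<^sup>p\<close> below by that of
  \<open>\<bar>K\<bar>\<^sup>p\<close> plus \<open>p\<close> times the real part of the mean of \<open>\<bar>K\<bar>\<^bsup>p-2\<^esup> cnj K (\<phi> - v)\<close>. The weight equals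
  \<open>(1 - c cnj J) R\<close> with \<open>R = (1 - c J)\<^bsup>1-2/p\<^esup>\<close> bounded and holomorphic. So \<open>y = R (\<phi> - v)\<close> lies in
  \<open>E\<close>, and the mean of \<open>(1 - c cnj J) y\<close> tends to \<open>y(0) - c (y(0) / c) = 0\<close>.\<close>

lemma minimizer_formula:
  assumes c1: "c < 1"
  defines "\<phi> \<equiv> (\<lambda>z. 1 - exp (of_real (2 / p) * Ln (1 - of_real c * J z)))"
  assumes \<phi>: "\<phi> \<in> E" and v: "v \<in> E"
  shows "hardy_sup p (\<lambda>z. 1 - \<phi> z) \<le> hardy_sup p (\<lambda>z. 1 - v z)"
proof -
  define L where "L = (\<lambda>z. Ln (1 - of_real c * J z))"
  define K where "K = (\<lambda>z. exp (of_real (2 / p) * L z))"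
  define R where "R = (\<lambda>z. exp (of_real (1 - 2 / p) * L z))"
  have Re_pos: "1 - c \<le> Re (1 - of_real c * J z)" if "cmod z < 1" for z
  proof -
    have "Re (of_real c * J z) \<le> c * cmod (J z)"
      using complex_Re_le_cmod[of "of_real c * J z"] c_pos by (simp add: norm_mult)
    also have "\<dots> \<le> c * 1" using J_le_1[OF that] c_pos by (intro mult_left_mono) auto
    finally show ?thesis by simp
  qed
  have nz: "1 - of_real c * J z \<noteq> 0" if "cmod z < 1" for z
    using Re_pos[OF that] c1 by (metis diff_gt_0_iff_gt not_le zero_complex.simps(1))
  have holL: "L holomorphic_on ball 0 1"
    unfolding L_def
    by (intro holomorphic_intros holo J_mem) (use Re_pos c1 in \<open>force simp: complex_nonpos_Reals_iff\<close>)
  have holR: "R holomorphic_on ball 0 1" unfolding R_def by (intro holomorphic_intros holL)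
  have "cmod (R z) \<le> exp (\<bar>1 - 2 / p\<bar> * max (ln 2) (- ln (1 - c)))" if z: "cmod z < 1" for z
  proof -
    have "cmod (1 - of_real c * J z) \<le> 1 + cmod (of_real c * J z)"
      using norm_triangle_ineq4[of 1 "of_real c * J z"] by simp
    also have "cmod (of_real c * J z) \<le> 1 * 1"
      unfolding norm_mult using J_le_1[OF z] c_pos c1 by (intro mult_mono) auto
    finally have up: "cmod (1 - of_real c * J z) \<le> 2" by simp
    have lo: "1 - c \<le> cmod (1 - of_real c * J z)"
      using Re_pos[OF z] complex_Re_le_cmod[of "1 - of_real c * J z"] by linarith
    have ReL: "Re (L z) = ln (cmod (1 - of_real c * J z))" using nz[OF z] by (simp add: L_def)
    have "\<bar>Re (L z)\<bar> \<le> max (ln 2) (- ln (1 - c))"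
    proof -
      have "0 < cmod (1 - of_real c * J z)" using nz[OF z] by simp
      then have "ln (cmod (1 - of_real c * J z)) \<le> ln 2" "ln (1 - c) \<le> ln (cmod (1 - of_real c * J z))"
        using up lo c1 by simp_all
      then show ?thesis unfolding ReL by linarith
    qed
    then have "\<bar>1 - 2 / p\<bar> * \<bar>Re (L z)\<bar> \<le> \<bar>1 - 2 / p\<bar> * max (ln 2) (- ln (1 - c))"
      by (intro mult_left_mono) auto
    moreover have "(1 - 2 / p) * Re (L z) \<le> \<bar>1 - 2 / p\<bar> * \<bar>Re (L z)\<bar>"
      by (metis abs_ge_self abs_mult)
    moreover have "cmod (R z) = exp ((1 - 2 / p) * Re (L z))"
      by (simp add: R_def norm_exp_eq_Re)
    ultimately show ?thesis by simp
  qed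
  then have y: "(\<lambda>z. R z * (\<phi> z - v z)) \<in> E"
    by (intro bounded_holomorphic_mult[OF diff[OF \<phi> v] holR])
  define y where "y = (\<lambda>z. R z * (\<phi> z - v z))"
  have yE: "y \<in> E" using y by (simp add: y_def)
  have K_eq: "1 - \<phi> z = K z" for z by (simp add: \<phi>_def K_def L_def)
  have duality: "of_real (cmod (K z) powr (p - 2)) * cnj (K z) = (1 - of_real c * cnj (J z)) * R z"
    if z: "cmod z < 1" for z
  proof -
    let ?s = "2 / p"
    have "cmod (K z) = exp (?s * Re (L z))" by (simp add: K_def norm_exp_eq_Re)
    then have "cmod (K z) powr (p - 2) = exp ((p - 2) * (?s * Re (L z)))"
      by (simp add: powr_def)
    also have "(p - 2) * (?s * Re (L z)) = (1 - ?s) * (2 * Re (L z))"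
      using p by (simp add: field_simps)
    also have "complex_of_real (exp \<dots>) = exp (of_real (1 - ?s) * (L z + cnj (L z)))"
      by (simp only: exp_of_real[symmetric] complex_add_cnj of_real_mult[symmetric])
    finally have a: "of_real (cmod (K z) powr (p - 2)) = exp (of_real (1 - ?s) * (L z + cnj (L z)))" .
    have b: "cnj (K z) = exp (of_real ?s * cnj (L z))" by (simp add: K_def exp_cnj)
    have "exp (L z) = 1 - of_real c * J z" unfolding L_def by (rule exp_Ln[OF nz[OF z]])
    then have d: "1 - of_real c * cnj (J z) = exp (cnj (L z))"
      by (metis complex_cnj_complex_of_real complex_cnj_diff complex_cnj_mult complex_cnj_one exp_cnj)
    show ?thesis
    proof -
      have "of_real (1 - s) * (x + y) + of_real s * y = y + of_real (1 - s) * x" for x y :: complex and s :: real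
        by (simp add: algebra_simps)
      then show ?thesis unfolding a b d R_def exp_add[symmetric] by (simp only:)
    qed
  qed
  have FH: "(\<lambda>z. 1 - v z) \<in> hardy_space p" "(\<lambda>z. 1 - \<phi> z) \<in> hardy_space p"
    by (intro hardy_diff p hardy_const sub v \<phi>)+
  have ev: "\<forall>\<^sub>F r in at_left 1. hardy_mean p (\<lambda>z. 1 - \<phi> z) r
      + p * Re (y 0 - of_real c * circle_mean (\<lambda>z. cnj (J z) * y z) r) \<le> hardy_mean p (\<lambda>z. 1 - v z) r"
    using eventually_at_left_1
  proof eventually_elim
    case (elim r)
    then have r: "0 < r" "r < 1" "0 \<le> r" by auto
    have cy: "continuous_on (sphere 0 r) y" "continuous_on (sphere 0 r) J"
      by (intro holomorphic_continuous_circle holo yE J_mem r)+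
    have cv: "continuous_on (sphere 0 r) (\<lambda>z. cmod (1 - v z) powr p)"
      "continuous_on (sphere 0 r) (\<lambda>z. cmod (1 - \<phi> z) powr p)"
      by (intro continuous_on_cmod_powr p holomorphic_continuous_circle FH[THEN hardy_space_holomorphic] r)+
    have cJy: "continuous_on (sphere 0 r) (\<lambda>z. cnj (J z) * y z)" by (intro continuous_intros cy)
    have cT: "continuous_on (sphere 0 r) (\<lambda>z. y z - of_real c * (cnj (J z) * y z))"
      by (intro continuous_intros cy)
    have "hardy_mean p (\<lambda>z. 1 - \<phi> z) r + p * Re (y 0 - of_real c * circle_mean (\<lambda>z. cnj (J z) * y z) r)
      = hardy_mean p (\<lambda>z. 1 - \<phi> z) r + p * Re (circle_mean (\<lambda>z. y z - of_real c * (cnj (J z) * y z)) r)"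
      unfolding circle_mean_diff[OF cy(1) continuous_on_mult_left[OF cJy] r(3)] circle_mean_mult_left[OF cJy r(3)]
        circle_mean_holomorphic[OF holo[OF yE] r(1,2)] ..
    also have "\<dots> = circle_mean (\<lambda>z. cmod (1 - \<phi> z) powr p + p * Re (y z - of_real c * (cnj (J z) * y z))) r"
      unfolding hardy_mean_eq circle_mean_Re[OF cT r(3), symmetric]
        circle_mean_mult_left[OF continuous_on_Re[OF cT] r(3), symmetric]
      by (rule circle_mean_add[symmetric, OF cv(2) continuous_on_mult_left[OF continuous_on_Re[OF cT]] r(3)])
    also have "\<dots> \<le> hardy_mean p (\<lambda>z. 1 - v z) r"
      unfolding hardy_mean_eq
    proof (rule circle_mean_mono)
      show "continuous_on (sphere 0 r) (\<lambda>z. cmod (1 - \<phi> z) powr p + p * Re (y z - of_real c * (cnj (J z) * y z)))"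
        by (intro continuous_on_add cv continuous_on_mult_left continuous_on_Re cT)
      fix z :: complex assume z: "cmod z = r"
      then have z1: "cmod z < 1" using r by simp
      have "y z - of_real c * (cnj (J z) * y z) = ((1 - of_real c * cnj (J z)) * R z) * (\<phi> z - v z)"
        by (simp add: y_def algebra_simps)
      also have "\<dots> = of_real (cmod (K z) powr (p - 2)) * (cnj (K z) * ((1 - v z) - K z))"
        unfolding duality[OF z1, symmetric] K_eq[symmetric] by simp
      finally have "Re (y z - of_real c * (cnj (J z) * y z))
          = cmod (K z) powr (p - 2) * Re (cnj (K z) * ((1 - v z) - K z))"
        by (metis scaleR_conv_of_real scaleR_complex.sel(1))
      then show "cmod (1 - \<phi> z) powr p + p * Re (y z - of_real c * (cnj (J z) * y z)) \<le> cmod (1 - v z) powr p"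
        using cmod_powr_tangent[OF p, of "K z" "1 - v z"] unfolding K_eq by simp
    qed (use cv r in auto)
    finally show ?case .
  qed
  have "((\<lambda>r. hardy_mean p (\<lambda>z. 1 - \<phi> z) r + p * Re (y 0 - of_real c * circle_mean (\<lambda>z. cnj (J z) * y z) r))
      \<longlongrightarrow> hardy_sup p (\<lambda>z. 1 - \<phi> z) + p * Re (y 0 - of_real c * (y 0 / of_real c))) (at_left 1)"
    by (intro tendsto_intros hardy_mean_tendsto_sup[OF p FH(2)] pairing yE)
  then have lim: "((\<lambda>r. hardy_mean p (\<lambda>z. 1 - \<phi> z) r + p * Re (y 0 - of_real c * circle_mean (\<lambda>z. cnj (J z) * y z) r))
      \<longlongrightarrow> hardy_sup p (\<lambda>z. 1 - \<phi> z)) (at_left 1)"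
    using c_pos by simp
  show ?thesis
    by (rule tendsto_le[OF trivial_limit_at_left_real hardy_mean_tendsto_sup[OF p FH(1)] lim ev])
qed

text \<open>The bounded factor \<open>S\<close> serves to carry divisibility from the nearest point \<open>\<phi>\<close> over to \<open>J\<close>. If
  \<open>c = 1\<close>, then \<open>J\<close> is the constant \<open>1\<close> and is itself the nearest point.\<close>

lemma nearest_point_to_one:
  obtains \<phi> S B where "\<phi> \<in> E" "\<And>v. v \<in> E \<Longrightarrow> hardy_sup p (\<lambda>z. 1 - \<phi> z) \<le> hardy_sup p (\<lambda>z. 1 - v z)"
    "S holomorphic_on ball 0 1" "\<And>z. cmod z < 1 \<Longrightarrow> cmod (S z) \<le> B"
    "\<And>z. cmod z < 1 \<Longrightarrow> J z = S z * \<phi> z"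
proof (cases "c = 1")
  case True
  have "hardy_sup p (\<lambda>z. 1 - J z) = hardy_sup p (\<lambda>z. 0 * J z)"
    by (rule hardy_sup_cong) (simp add: J_constant[OF True])
  also have "\<dots> = 0" using hardy_scale(2)[OF p sub[OF J_mem], of 0] by simp
  finally show thesis
    using that[of J "\<lambda>_. 1" 1] J_mem hardy_sup_nonneg[OF p hardy_diff[OF p hardy_const[OF p] sub]]
    by simp
next
  case False
  then have c1: "c < 1" using c_le_1 by simp
  obtain H where H: "H holomorphic_on cball 0 1" "\<And>\<zeta>. cmod \<zeta> \<le> 1 \<Longrightarrow> H \<zeta> \<noteq> 0"
    "\<And>\<zeta>. cmod \<zeta> \<le> 1 \<Longrightarrow> 1 - exp (of_real (2 / p) * Ln (1 - of_real c * \<zeta>)) = \<zeta> * H \<zeta>"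
    by (rule power_branch[OF c_pos c1, of "2 / p"]) (use p in \<open>auto simp: field_simps\<close>)
  define \<phi> where "\<phi> = (\<lambda>z. 1 - exp (of_real (2 / p) * Ln (1 - of_real c * J z)))"
  have \<phi>_eq: "\<phi> z = J z * H (J z)" if "cmod z < 1" for z
    unfolding \<phi>_def by (rule H(3)[OF J_le_1[OF that]])
  have cH: "continuous_on (cball 0 1) H" by (rule holomorphic_on_imp_continuous_on[OF H(1)])
  have holHJ: "(\<lambda>z. H (J z)) holomorphic_on ball 0 1"
  proof -
    have "(H \<circ> J) holomorphic_on ball 0 1"
      by (rule holomorphic_on_compose_gen[OF holo[OF J_mem] H(1)]) (use J_le_1 in auto)
    then show ?thesis by (simp add: o_def)
  qed
  have "compact (H ` cball 0 1)" by (intro compact_continuous_image cH compact_cball)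
  then obtain A where A: "\<And>\<zeta>. cmod \<zeta> \<le> 1 \<Longrightarrow> cmod (H \<zeta>) \<le> A"
    by (metis bounded_iff compact_imp_bounded image_eqI mem_cball_0)
  have "compact ((\<lambda>\<zeta>. 1 / H \<zeta>) ` cball 0 1)"
    by (intro compact_continuous_image continuous_intros cH compact_cball) (use H(2) in auto)
  then obtain B where B: "\<And>\<zeta>. cmod \<zeta> \<le> 1 \<Longrightarrow> cmod (1 / H \<zeta>) \<le> B"
    by (metis (no_types, lifting) bounded_iff compact_imp_bounded image_eqI mem_cball_0)
  have "(\<lambda>z. H (J z) * J z) \<in> E"
    by (rule bounded_holomorphic_mult[OF J_mem holHJ]) (use A J_le_1 in blast)
  then have \<phi>E: "\<phi> \<in> E" by (rule cong) (simp add: \<phi>_eq mult.commute)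
  show thesis
  proof (rule that[of \<phi> "\<lambda>z. 1 / H (J z)" B])
    show "\<phi> \<in> E" by fact
    show "hardy_sup p (\<lambda>z. 1 - \<phi> z) \<le> hardy_sup p (\<lambda>z. 1 - v z)" if "v \<in> E" for v
      using minimizer_formula[OF c1 \<phi>E[unfolded \<phi>_def] that] by (simp only: \<phi>_def)
    show "(\<lambda>z. 1 / H (J z)) holomorphic_on ball 0 1"
      by (intro holomorphic_intros holHJ) (use H(2) J_le_1 in auto)
    show "cmod (1 / H (J z)) \<le> B" if "cmod z < 1" for z
      using B J_le_1[OF that] by blast
    show "J z = 1 / H (J z) * \<phi> z" if "cmod z < 1" for z
      using H(2)[OF J_le_1[OF that]] by (simp add: \<phi>_eq[OF that])
  qed
qed

end

section \<open>Cyclic subspaces and locally uniform division\<close>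

lemma poly_bounded_on_disc: "\<exists>B. \<forall>z. cmod z < 1 \<longrightarrow> cmod (poly q z) \<le> B"
proof -
  have "compact (poly q ` cball 0 1)"
    by (intro compact_continuous_image continuous_intros compact_cball)
  then obtain B where "\<And>z. z \<in> cball 0 1 \<Longrightarrow> cmod (poly q z) \<le> B"
    by (meson bounded_iff compact_imp_bounded image_eqI)
  then show ?thesis by (intro exI[of _ B]) auto
qed

lemma poly_mult_hardy:
  assumes "1 < p" "f \<in> hardy_space p"
  shows "(\<lambda>z. poly q z * f z) \<in> hardy_space p"
proof -
  obtain B where "\<And>z. cmod z < 1 \<Longrightarrow> cmod (poly q z) \<le> B" using poly_bounded_on_disc[of q] by blast
  then show ?thesis by (intro hardy_bounded_mult(1)[OF assms]) (auto intro!: holomorphic_intros)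
qed

lemma hardy_space_closed_invariant:
  "1 < p \<Longrightarrow> closed_invariant_subspace p (hardy_space p)"
  by unfold_locales (auto intro: hardy_add poly_mult_hardy)

definition cyclic_subspace :: "real \<Rightarrow> (complex \<Rightarrow> complex) \<Rightarrow> (complex \<Rightarrow> complex) set" where
  "cyclic_subspace p f =
    {v \<in> hardy_space p. \<forall>e>0. \<exists>q. hardy_sup p (\<lambda>z. v z - poly q z * f z) < e}"

lemma cyclic_subspace_approx:
  assumes "v \<in> cyclic_subspace p f" "0 < e"
  obtains q where "hardy_sup p (\<lambda>z. v z - poly q z * f z) < e"
  using assms unfolding cyclic_subspace_def by blast

lemma poly_mult_mem_cyclic_subspace:
  assumes "1 < p" "f \<in> hardy_space p"
  shows "(\<lambda>z. poly q z * f z) \<in> cyclic_subspace p f"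
proof -
  have "hardy_sup p (\<lambda>z. poly q z * f z - poly q z * f z) = 0"
    using hardy_scale(2)[OF assms, of 0] by simp
  then have "\<exists>r. hardy_sup p (\<lambda>z. poly q z * f z - poly r z * f z) < e" if "0 < e" for e
    using that by (intro exI[of _ q]) simp
  then show ?thesis using poly_mult_hardy[OF assms] by (simp add: cyclic_subspace_def)
qed

lemma cyclic_subspace_closed_invariant:
  assumes p: "1 < p" and f: "f \<in> hardy_space p"
  shows "closed_invariant_subspace p (cyclic_subspace p f)"
proof -
  obtain C where C: "C \<ge> 0" "\<And>u v. u \<in> hardy_space p \<Longrightarrow> v \<in> hardy_space p \<Longrightarrow>
      hardy_sup p (\<lambda>z. u z + v z) \<le> (1 + 1) * hardy_sup p u + C * hardy_sup p v"
    using hardy_sup_add_le[OF p, of 1] by auto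
  have small: "hardy_sup p (\<lambda>z. u z + v z) < e"
    if "u \<in> hardy_space p" "v \<in> hardy_space p" "hardy_sup p u < e / 4" "hardy_sup p v < e / (4 * (C + 1))" "0 < e"
    for u v e
  proof -
    have "hardy_sup p (\<lambda>z. u z + v z) \<le> (1 + 1) * (e / 4) + C * (e / (4 * (C + 1)))"
      using C(2)[OF that(1,2)] mult_left_mono[OF less_imp_le[OF that(4)] C(1)] that(3) by simp
    also have "C * (e / (4 * (C + 1))) \<le> e / 4" using C(1) that(5) by (simp add: field_simps)
    finally show ?thesis using that(5) by simp
  qed
  note H = poly_mult_hardy[OF p f]
  show ?thesis
  proof
    show "1 < p" by fact
    show "v \<in> hardy_space p" if "v \<in> cyclic_subspace p f" for v
      using that by (simp add: cyclic_subspace_def)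
  next
    fix u v assume u: "u \<in> cyclic_subspace p f" and v: "v \<in> cyclic_subspace p f"
    have uH: "u \<in> hardy_space p" "v \<in> hardy_space p" using u v by (auto simp: cyclic_subspace_def)
    have "\<exists>q. hardy_sup p (\<lambda>z. (u z + v z) - poly q z * f z) < e" if e: "0 < e" for e
    proof -
      obtain q1 where q1: "hardy_sup p (\<lambda>z. u z - poly q1 z * f z) < e / 4"
        using cyclic_subspace_approx[OF u, of "e / 4"] e by auto
      obtain q2 where q2: "hardy_sup p (\<lambda>z. v z - poly q2 z * f z) < e / (4 * (C + 1))"
        using cyclic_subspace_approx[OF v, of "e / (4 * (C + 1))"] e C(1) by auto
      from small[OF hardy_diff[OF p uH(1) H] hardy_diff[OF p uH(2) H] q1 q2 e]
      show ?thesis by (intro exI[of _ "q1 + q2"]) (simp add: algebra_simps)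
    qed
    then show "(\<lambda>z. u z + v z) \<in> cyclic_subspace p f"
      using hardy_add[OF p uH] by (simp add: cyclic_subspace_def)
  next
    fix v q assume v: "v \<in> cyclic_subspace p f"
    have vH: "v \<in> hardy_space p" using v by (auto simp: cyclic_subspace_def)
    obtain B where B: "\<And>z. cmod z < 1 \<Longrightarrow> cmod (poly q z) \<le> B" using poly_bounded_on_disc[of q] by blast
    have Bp: "0 < B powr p + 1" by (simp add: add_nonneg_pos)
    have "\<exists>r. hardy_sup p (\<lambda>z. poly q z * v z - poly r z * f z) < e" if e: "0 < e" for e
    proof -
      obtain r where r: "hardy_sup p (\<lambda>z. v z - poly r z * f z) < e / (B powr p + 1)"
        using cyclic_subspace_approx[OF v, of "e / (B powr p + 1)"] e Bp by auto
      have d: "(\<lambda>z. v z - poly r z * f z) \<in> hardy_space p" by (rule hardy_diff[OF p vH H])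
      have "hardy_sup p (\<lambda>z. poly q z * (v z - poly r z * f z)) \<le> B powr p * hardy_sup p (\<lambda>z. v z - poly r z * f z)"
        by (rule hardy_bounded_mult(2)[OF p d _ B]) (auto intro!: holomorphic_intros)
      also have "\<dots> \<le> (B powr p + 1) * hardy_sup p (\<lambda>z. v z - poly r z * f z)"
        using hardy_sup_nonneg[OF p d] by (intro mult_right_mono) auto
      also have "\<dots> < e" using r Bp by (simp add: field_simps)
      finally show ?thesis by (intro exI[of _ "q * r"]) (simp add: algebra_simps)
    qed
    then show "(\<lambda>z. poly q z * v z) \<in> cyclic_subspace p f"
      using poly_mult_hardy[OF p vH] by (simp add: cyclic_subspace_def)
  next
    fix v assume vH: "v \<in> hardy_space p"
      and lim: "\<And>e. 0 < e \<Longrightarrow> \<exists>u\<in>cyclic_subspace p f. hardy_sup p (\<lambda>z. v z - u z) < e"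
    have "\<exists>q. hardy_sup p (\<lambda>z. v z - poly q z * f z) < e" if e: "0 < e" for e
    proof -
      obtain u where u: "u \<in> cyclic_subspace p f" "hardy_sup p (\<lambda>z. v z - u z) < e / 4"
        using lim[of "e / 4"] e by auto
      have uH: "u \<in> hardy_space p" using u by (auto simp: cyclic_subspace_def)
      obtain q where q: "hardy_sup p (\<lambda>z. u z - poly q z * f z) < e / (4 * (C + 1))"
        using cyclic_subspace_approx[OF u(1), of "e / (4 * (C + 1))"] e C(1) by auto
      from small[OF hardy_diff[OF p vH uH] hardy_diff[OF p uH H] u(2) q e]
      show ?thesis by (intro exI[of _ q]) simp
    qed
    then show "v \<in> cyclic_subspace p f" using vH by (simp add: cyclic_subspace_def)
  qed
qed

text \<open>Inside every disc of radius less than \<open>1\<close> the function \<open>f\<close> has finitely many zeros, so there are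
  circles close to the boundary on which \<open>\<bar>f\<bar>\<close> is bounded below. There the \<open>h n\<close> form a uniform Cauchy
  sequence, and by the maximum principle they do so inside as well, across the zeros of \<open>f\<close>.\<close>

lemma quotient_locally_uniform:
  assumes h: "\<And>n. h n holomorphic_on ball 0 1" and f: "f holomorphic_on ball 0 1"
    and f0: "a \<in> ball 0 1" "f a \<noteq> 0"
    and lim: "\<And>\<rho>. \<rho> < 1 \<Longrightarrow> uniform_limit (cball 0 \<rho>) (\<lambda>n z. h n z * f z) \<phi> sequentially"
  shows "\<exists>G. G holomorphic_on ball 0 1 \<and> (\<forall>\<rho><1. uniform_limit (cball 0 \<rho>) h G sequentially) \<and>
    (\<forall>z. cmod z < 1 \<longrightarrow> \<phi> z = G z * f z)"
proof -
  define G where "G = (\<lambda>z. lim (\<lambda>n. h n z))"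
  have circle: "\<exists>\<sigma>. \<rho> < \<sigma> \<and> 0 < \<sigma> \<and> \<sigma> < 1 \<and> (\<forall>z. cmod z = \<sigma> \<longrightarrow> f z \<noteq> 0)" if \<rho>: "\<rho> < 1" for \<rho>
  proof -
    define s where "s = (1 + max \<rho> 0) / 2"
    have s: "max \<rho> 0 < s" "s < 1" using \<rho> by (auto simp: s_def)
    have fin: "finite {z \<in> cball 0 s. f z = 0}"
    proof (cases "f constant_on ball 0 1")
      case True
      then obtain k where k: "\<And>z. z \<in> ball 0 1 \<Longrightarrow> f z = k" by (auto simp: constant_on_def)
      have "f z \<noteq> 0" if "z \<in> cball 0 s" for z
      proof -
        have "z \<in> ball 0 1" using that s by simp
        then have "f z = f a" using k f0(1) by metis
        then show ?thesis using f0(2) by simp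
      qed
      then have "{z \<in> cball 0 s. f z = 0} = {}" by blast
      then show ?thesis by (simp only: finite.emptyI)
    next
      case False
      then show ?thesis using s by (intro holomorphic_compact_finite_zeros[OF f]) auto
    qed
    have "infinite ({max \<rho> 0<..<s} - cmod ` {z \<in> cball 0 s. f z = 0})"
      using fin s by (intro Diff_infinite_finite finite_imageI) auto
    then obtain \<sigma> where "\<sigma> \<in> {max \<rho> 0<..<s} - cmod ` {z \<in> cball 0 s. f z = 0}"
      by (metis finite.emptyI ex_in_conv)
    then show ?thesis using s by (intro exI[of _ \<sigma>]) auto
  qed
  have unif: "uniform_limit (cball 0 \<rho>) h G sequentially" if \<rho>: "\<rho> < 1" for \<rho>
  proof -
    obtain \<sigma> where \<sigma>: "\<rho> < \<sigma>" "0 < \<sigma>" "\<sigma> < 1" "\<And>z. cmod z = \<sigma> \<Longrightarrow> f z \<noteq> 0" using circle[OF \<rho>] by blast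
    have "sphere (0::complex) \<sigma> \<noteq> {}" using \<sigma>(2) by simp
    then obtain z0 where z0: "z0 \<in> sphere 0 \<sigma>" "\<And>z. z \<in> sphere 0 \<sigma> \<Longrightarrow> cmod (f z0) \<le> cmod (f z)"
      using continuous_attains_inf[OF compact_sphere _ continuous_on_norm[OF holomorphic_continuous_circle[OF f \<sigma>(3)]]]
      by blast
    have \<delta>: "0 < cmod (f z0)" using \<sigma>(4) z0(1) by simp
    have "uniformly_Cauchy_on (cball 0 \<rho>) h"
    proof (rule uniformly_Cauchy_onI)
      fix e :: real assume e: "0 < e"
      define e' where "e' = e / 2 * cmod (f z0)"
      have e': "0 < e'" using e \<delta> by (simp add: e'_def)
      have "uniformly_Cauchy_on (cball 0 \<sigma>) (\<lambda>n z. h n z * f z)"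
        using lim[OF \<sigma>(3)] uniformly_convergent_Cauchy uniformly_convergent_on_def by blast
      then obtain N where N: "\<And>z m n. z \<in> cball 0 \<sigma> \<Longrightarrow> N \<le> m \<Longrightarrow> N \<le> n \<Longrightarrow>
          dist (h m z * f z) (h n z * f z) < e'"
        unfolding uniformly_Cauchy_on_def using e' by meson
      have bound: "cmod (h m z - h n z) \<le> e / 2" if z: "cmod z = \<sigma>" and mn: "N \<le> m" "N \<le> n" for z m n
      proof -
        have "cmod (h m z - h n z) * cmod (f z0) \<le> cmod (h m z - h n z) * cmod (f z)"
          using z0(2)[of z] z by (intro mult_left_mono) auto
        also have "\<dots> = cmod (h m z * f z - h n z * f z)"
          by (simp add: norm_mult[symmetric] left_diff_distrib)
        also have "\<dots> \<le> e / 2 * cmod (f z0)"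
          using N[of z m n] z mn by (simp add: dist_norm e'_def)
        finally show ?thesis using \<delta> by simp
      qed
      show "\<exists>M. \<forall>x\<in>cball 0 \<rho>. \<forall>m\<ge>M. \<forall>n\<ge>M. dist (h m x) (h n x) < e"
      proof (intro exI[of _ N] ballI allI impI)
        fix z m n assume z: "z \<in> cball (0::complex) \<rho>" and mn: "N \<le> m" "N \<le> n"
        have hol: "(\<lambda>z. h m z - h n z) holomorphic_on ball 0 1" by (intro holomorphic_intros h)
        have "cmod (h m z - h n z) \<le> e / 2"
        proof (rule maximum_modulus_frontier[of "\<lambda>z. h m z - h n z" "cball 0 \<sigma>"])
          show "(\<lambda>z. h m z - h n z) holomorphic_on interior (cball 0 \<sigma>)"
            using \<sigma> by (auto intro!: holomorphic_on_subset[OF hol])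
          show "continuous_on (closure (cball 0 \<sigma>)) (\<lambda>z. h m z - h n z)"
            using \<sigma> by (auto intro!: continuous_on_subset[OF holomorphic_on_imp_continuous_on[OF hol]])
        qed (use \<sigma> z bound mn in \<open>auto simp: frontier_cball\<close>)
        then show "dist (h m z) (h n z) < e" using e by (simp add: dist_norm)
      qed
    qed
    then show ?thesis
      unfolding G_def uniformly_convergent_uniform_limit_iff[symmetric]
      by (rule Cauchy_uniformly_convergent)
  qed
  show ?thesis
  proof (intro exI[of _ G] conjI allI impI unif locally_uniform_limit_holomorphic[OF h unif])
    fix z :: complex assume z: "cmod z < 1"
    have "(\<lambda>n. h n z * f z) \<longlonglongrightarrow> \<phi> z" by (rule tendsto_uniform_limitI[OF lim[OF z]]) simp
    moreover have "(\<lambda>n. h n z) \<longlonglongrightarrow> G z" by (rule tendsto_uniform_limitI[OF unif[OF z]]) simp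
    then have "(\<lambda>n. h n z * f z) \<longlonglongrightarrow> G z * f z" by (intro tendsto_intros)
    ultimately show "\<phi> z = G z * f z" by (rule LIMSEQ_unique)
  qed
qed

section \<open>Optimal polynomial approximants\<close>

lemma poly_synthetic_div:
  fixes w :: "'a::comm_ring_1"
  shows "poly q z = (z - w) * poly (synthetic_div q w) z + poly q w"
proof -
  have "poly q z = poly ([:- w, 1:] * synthetic_div q w + [:poly q w:]) z"
    by (simp only: synthetic_div_correct')
  then show ?thesis by (simp add: algebra_simps)
qed

text \<open>By induction on the degree: synthetic division at a point of \<open>A\<close> lowers the degree and preserves
  convergence at all other points of \<open>A\<close>.\<close>

lemma pointwise_limit_of_polys:
  fixes g :: "complex \<Rightarrow> complex"
  assumes "infinite A" "\<And>k. degree (q k) \<le> n" "\<And>z. z \<in> A \<Longrightarrow> (\<lambda>k. poly (q k) z) \<longlonglongrightarrow> g z"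
  shows "\<exists>r. degree r \<le> n \<and> (\<forall>z\<in>A. g z = poly r z)"
  using assms
proof (induction n arbitrary: A q g)
  case 0
  obtain a where a: "a \<in> A" using "0.prems"(1) by (metis finite.emptyI ex_in_conv)
  have const: "poly (q k) z = poly (q k) a" for k z
  proof -
    obtain b where "q k = [:b:]" using "0.prems"(2)[of k] by (auto elim: degree_eq_zeroE)
    then show ?thesis by simp
  qed
  have "g z = poly [:g a:] z" if "z \<in> A" for z
  proof -
    have "(\<lambda>k. poly (q k) a) \<longlonglongrightarrow> g z" using "0.prems"(3)[OF that] by (simp only: const[of _ z])
    then show ?thesis using LIMSEQ_unique "0.prems"(3)[OF a] by fastforce
  qed
  then show ?case by (intro exI[of _ "[:g a:]"]) auto
next
  case (Suc n)
  obtain a where a: "a \<in> A" using Suc.prems(1) by (metis finite.emptyI ex_in_conv)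
  define g' where "g' = (\<lambda>z. (g z - g a) / (z - a))"
  have "\<exists>r. degree r \<le> n \<and> (\<forall>z\<in>A - {a}. g' z = poly r z)"
  proof (rule Suc.IH[of "A - {a}" "\<lambda>k. synthetic_div (q k) a"])
    show "infinite (A - {a})" using Suc.prems(1) by simp
    show "degree (synthetic_div (q k) a) \<le> n" for k
      using Suc.prems(2)[of k] by (simp add: degree_synthetic_div)
    fix z assume z: "z \<in> A - {a}"
    have "poly (synthetic_div (q k) a) z = (poly (q k) z - poly (q k) a) / (z - a)" for k
      using poly_synthetic_div[of "q k" z a] z by simp
    then show "(\<lambda>k. poly (synthetic_div (q k) a) z) \<longlonglongrightarrow> g' z"
      unfolding g'_def using Suc.prems(3) a z by (auto intro!: tendsto_intros)
  qed
  then obtain r where r: "degree r \<le> n" "\<And>z. z \<in> A - {a} \<Longrightarrow> g' z = poly r z" by blast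
  have "g z = poly ([:- a, 1:] * r + [:g a:]) z" if "z \<in> A" for z
  proof (cases "z = a")
    case False
    then have "g z = (z - a) * g' z + g a" by (simp add: g'_def)
    also have "g' z = poly r z" using r(2) that False by simp
    finally show ?thesis by (simp add: algebra_simps)
  qed simp
  moreover have "degree ([:- a, 1:] * r + [:g a:]) \<le> Suc n"
  proof (rule degree_add_le)
    have "degree ([:- a, 1:] * r) \<le> degree [:- a, 1:] + degree r" by (rule degree_mult_le)
    then show "degree ([:- a, 1:] * r) \<le> Suc n" using r(1) by simp
  qed simp
  ultimately show ?case by blast
qed

lemma infinite_nonzero_set:
  assumes f: "f holomorphic_on ball 0 1" and f0: "f 0 \<noteq> 0"
  shows "infinite {z::complex. cmod z < 1 \<and> f z \<noteq> 0}"
proof -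
  have "isCont f 0"
    using holomorphic_on_imp_continuous_on[OF f] by (simp add: continuous_on_eq_continuous_at)
  from continuous_at_avoid[OF this f0] obtain e where e: "0 < e" "\<And>z. dist 0 z < e \<Longrightarrow> f z \<noteq> 0" by blast
  have "infinite (ball (0::complex) (min e 1))"
    using e(1) finite_imp_not_open[of "ball (0::complex) (min e 1)"] by auto
  moreover have "ball (0::complex) (min e 1) \<subseteq> {z. cmod z < 1 \<and> f z \<noteq> 0}" using e(2) by auto
  ultimately show ?thesis using finite_subset by blast
qed

lemma average_of_residuals:
  fixes x y a :: complex
  shows "((1 - x * a) + (1 - y * a)) / 2 = 1 - 1 / 2 * (x + y) * a"
  by (simp add: field_simps)

text \<open>The \<open>p\<close>-th power of the norm that an optimal polynomial approximant minimizes.\<close>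

definition residual :: "real \<Rightarrow> (complex \<Rightarrow> complex) \<Rightarrow> complex poly \<Rightarrow> real" where
  "residual p f q = hardy_sup p (\<lambda>z. 1 - poly q z * f z)"

text \<open>A minimizing sequence of residuals converges in norm by uniform convexity of the whole Hardy space. Its
  polynomials converge at all points where \<open>f\<close> does not vanish, hence to a polynomial of degree at most \<open>n\<close>.\<close>

lemma residual_minimizer_exists:
  assumes p: "1 < p" and f: "f \<in> hardy_space p" and f0: "f 0 \<noteq> 0"
  shows "\<exists>q\<in>polys_upto n. \<forall>q'\<in>polys_upto n. residual p f q \<le> residual p f q'"
proof -
  interpret H: closed_invariant_subspace p "hardy_space p"
    by (rule hardy_space_closed_invariant[OF p])
  define C where "C = (\<lambda>q z. 1 - poly q z * f z) ` polys_upto n"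
  have mem: "(\<lambda>z. 1 - poly q z * f z) \<in> hardy_space p" for q
    by (intro hardy_diff hardy_const poly_mult_hardy p f)
  obtain u g where u: "\<And>k. u k \<in> C" and g: "g \<in> hardy_space p"
    and lim: "(\<lambda>k. hardy_sup p (\<lambda>z. u k z - g z)) \<longlonglongrightarrow> 0"
    and um: "\<And>k. hardy_sup p (u k) < (INF v\<in>C. hardy_sup p v) + 1 / Suc k"
  proof (rule H.near_minimal_convergent[of "\<lambda>_. C" "residual p f 0"])
    show "C \<subseteq> hardy_space p" unfolding C_def using mem by blast
    show "C \<subseteq> C" ..
    show "\<exists>v\<in>C. hardy_sup p v \<le> residual p f 0"
    proof
      show "hardy_sup p (\<lambda>z. 1 - poly 0 z * f z) \<le> residual p f 0" by (simp only: residual_def)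
      show "(\<lambda>z. 1 - poly 0 z * f z) \<in> C" unfolding C_def by (rule imageI) (simp add: polys_upto_def)
    qed
    fix v w assume "v \<in> C" "w \<in> C"
    then obtain q1 q2 where q: "q1 \<in> polys_upto n" "q2 \<in> polys_upto n"
      "v = (\<lambda>z. 1 - poly q1 z * f z)" "w = (\<lambda>z. 1 - poly q2 z * f z)"
      unfolding C_def by blast
    have "smult (1 / 2) (q1 + q2) \<in> polys_upto n"
      using q(1,2) by (auto simp: polys_upto_def intro!: degree_add_le)
    moreover have "(\<lambda>z. (v z + w z) / 2) = (\<lambda>z. 1 - poly (smult (1 / 2) (q1 + q2)) z * f z)"
      unfolding q(3,4) by (simp only: average_of_residuals poly_smult poly_add)
    ultimately show "(\<lambda>z. (v z + w z) / 2) \<in> C"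
      unfolding C_def by (intro image_eqI[where x = "smult (1 / 2) (q1 + q2)"])
  qed (rule that)
  obtain q where q: "\<And>k. q k \<in> polys_upto n" "\<And>k. u k = (\<lambda>z. 1 - poly (q k) z * f z)"
  proof -
    have "\<exists>q. q \<in> polys_upto n \<and> u k = (\<lambda>z. 1 - poly q z * f z)" for k
      using u[of k] unfolding C_def by auto
    then show thesis using that by metis
  qed
  have uH: "u k \<in> hardy_space p" for k using mem q(2) by simp
  have pw: "(\<lambda>k. 1 - poly (q k) z * f z) \<longlonglongrightarrow> g z" if "cmod z < 1" for z
    using hardy_convergence_pointwise[OF p uH g lim that] unfolding q(2) .
  define A where "A = {z. cmod z < 1 \<and> f z \<noteq> 0}"
  have "\<exists>r. degree r \<le> n \<and> (\<forall>z\<in>A. (1 - g z) / f z = poly r z)"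
  proof (rule pointwise_limit_of_polys)
    show "infinite A" unfolding A_def by (rule infinite_nonzero_set[OF hardy_space_holomorphic[OF f] f0])
    show "degree (q k) \<le> n" for k using q(1)[of k] by (simp add: polys_upto_def)
    fix z assume z: "z \<in> A"
    have "(\<lambda>k. (1 - (1 - poly (q k) z * f z)) / f z) \<longlonglongrightarrow> (1 - g z) / f z"
      using z by (intro tendsto_intros pw) (auto simp: A_def)
    then show "(\<lambda>k. poly (q k) z) \<longlonglongrightarrow> (1 - g z) / f z" using z by (simp add: A_def)
  qed
  then obtain r where r: "degree r \<le> n" "\<And>z. z \<in> A \<Longrightarrow> (1 - g z) / f z = poly r z" by blast
  have gr: "g z = 1 - poly r z * f z" if z: "cmod z < 1" for z
  proof (cases "f z = 0")
    case True
    then show ?thesis using pw[OF z] by (simp add: LIMSEQ_const_iff)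
  next
    case False
    then show ?thesis using r(2)[of z] z by (simp add: A_def field_simps)
  qed
  define m where "m = (INF v\<in>C. hardy_sup p v)"
  have bdd: "bdd_below (hardy_sup p ` C)"
    using hardy_sup_nonneg[OF p mem] by (intro bdd_belowI[of _ 0]) (auto simp: C_def)
  have "hardy_sup p g \<le> m" by (rule hardy_sup_limit_le[OF p uH g lim um[folded m_def]])
  moreover have "residual p f r = hardy_sup p g"
    unfolding residual_def by (rule hardy_sup_cong) (simp add: gr)
  moreover have "m \<le> residual p f q'" if "q' \<in> polys_upto n" for q'
    unfolding m_def residual_def using that by (intro cINF_lower bdd) (auto simp: C_def)
  ultimately have "\<forall>q'\<in>polys_upto n. residual p f r \<le> residual p f q'" by fastforce
  then show ?thesis using r(1) by (auto simp: polys_upto_def)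
qed

text \<open>The mean of two minimizers competes as well, so uniform convexity makes their difference vanish.\<close>

lemma residual_minimizer_unique:
  assumes p: "1 < p" and f: "f \<in> hardy_space p" and f0: "f 0 \<noteq> 0"
    and q: "q1 \<in> polys_upto n" "q2 \<in> polys_upto n"
    and min: "\<And>q. q \<in> polys_upto n \<Longrightarrow> residual p f q1 \<le> residual p f q"
      "\<And>q. q \<in> polys_upto n \<Longrightarrow> residual p f q2 \<le> residual p f q"
  shows "q1 = q2"
proof -
  define m where "m = residual p f q1"
  have m: "residual p f q2 = m" using min q unfolding m_def by (meson order_antisym)
  define u where "u = (\<lambda>q z. 1 - poly q z * f z)"
  have mem: "u q \<in> hardy_space p" for q
    unfolding u_def by (intro hardy_diff hardy_const poly_mult_hardy p f)
  have sup: "hardy_sup p (u q1) = m" "hardy_sup p (u q2) = m"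
    using m by (simp_all add: u_def residual_def m_def)
  have m0: "0 \<le> m" using hardy_sup_nonneg[OF p mem] sup(1) by metis
  have "smult (1 / 2) (q1 + q2) \<in> polys_upto n"
    using q by (auto simp: polys_upto_def intro!: degree_add_le)
  moreover have "(\<lambda>z. (u q1 z + u q2 z) / 2) = (\<lambda>z. 1 - poly (smult (1 / 2) (q1 + q2)) z * f z)"
    unfolding u_def by (simp only: average_of_residuals poly_smult poly_add)
  ultimately have mid: "m \<le> hardy_sup p (\<lambda>z. (u q1 z + u q2 z) / 2)"
    using min(1)[of "smult (1 / 2) (q1 + q2)"] by (simp only: residual_def m_def)
  define d where "d = (\<lambda>z. u q1 z - u q2 z)"
  have dH: "d \<in> hardy_space p" unfolding d_def by (rule hardy_diff[OF p mem mem])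
  have "hardy_sup p d \<le> 0 + e" if e: "0 < e" for e
  proof -
    have e': "0 < e / (2 * m + 1)" using e m0 by simp
    obtain D where D0: "D \<ge> 0" "\<And>f g. f \<in> hardy_space p \<Longrightarrow> g \<in> hardy_space p \<Longrightarrow>
      hardy_sup p (\<lambda>z. f z - g z) \<le> e / (2 * m + 1) * (hardy_sup p f + hardy_sup p g)
      + D * ((hardy_sup p f + hardy_sup p g) / 2 - hardy_sup p (\<lambda>z. (f z + g z) / 2))"
      using hardy_sup_uniform_convexity[OF p e'] by auto
    have D: "D \<ge> 0" "hardy_sup p d \<le> e / (2 * m + 1) * (m + m)
        + D * ((m + m) / 2 - hardy_sup p (\<lambda>z. (u q1 z + u q2 z) / 2))"
      using D0(1) D0(2)[OF mem mem, of q1 q2] unfolding sup d_def .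
    have "D * ((m + m) / 2 - hardy_sup p (\<lambda>z. (u q1 z + u q2 z) / 2)) \<le> 0"
      using D(1) mid by (intro mult_nonneg_nonpos) auto
    moreover have "e / (2 * m + 1) * (m + m) \<le> e" using e m0 by (simp add: field_simps)
    ultimately show ?thesis using D(2) by linarith
  qed
  then have "hardy_sup p d \<le> 0" by (rule field_le_epsilon)
  then have d0: "d z = 0" if z: "cmod z < 1" for z
  proof -
    obtain D where D: "D > 0" "cmod (d z) powr p \<le> D * hardy_sup p d"
      using hardy_point_evaluation[OF p, of "cmod z"] z dH by auto
    have "D * hardy_sup p d \<le> 0" using D(1) \<open>hardy_sup p d \<le> 0\<close> by (simp add: mult_le_0_iff)
    then have "cmod (d z) powr p \<le> 0" using D(2) by linarith
    then show ?thesis by (metis norm_eq_zero powr_gt_zero not_le)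
  qed
  have "poly (q1 - q2) z = 0" if z: "cmod z < 1" "f z \<noteq> 0" for z
  proof -
    have "d z = (poly q2 z - poly q1 z) * f z" by (simp add: d_def u_def algebra_simps)
    then show ?thesis using d0[OF z(1)] z(2) by simp
  qed
  then have "{z. cmod z < 1 \<and> f z \<noteq> 0} \<subseteq> {z. poly (q1 - q2) z = 0}" by blast
  then have "infinite {z. poly (q1 - q2) z = 0}"
    using infinite_nonzero_set[OF hardy_space_holomorphic[OF f] f0] finite_subset by blast
  then have "q1 - q2 = 0" using poly_roots_finite by blast
  then show ?thesis by simp
qed

text \<open>Justifies the definite description in the definition of the optimal polynomial approximant.\<close>

lemma opt_poly_approx_minimizer:
  assumes p: "1 < p" and f: "f \<in> hardy_space p" and f0: "f 0 \<noteq> 0"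
  shows "opt_poly_approx p n f \<in> polys_upto n"
    and "q \<in> polys_upto n \<Longrightarrow> residual p f (opt_poly_approx p n f) \<le> residual p f q"
proof -
  let ?N = "\<lambda>q. hardy_norm p (\<lambda>z. 1 - poly q z * f z)"
  have nonneg: "0 \<le> residual p f q" for q
    unfolding residual_def
    by (intro hardy_sup_nonneg[OF p] hardy_diff hardy_const poly_mult_hardy p f)
  have N_eq: "?N q = residual p f q powr (1 / p)" for q
    by (simp add: hardy_norm_eq residual_def)
  have le_iff: "?N q \<le> ?N q' \<longleftrightarrow> residual p f q \<le> residual p f q'" for q q'
  proof -
    have "0 < 1 / p" using p by simp
    then show ?thesis
      unfolding N_eq using powr_less_mono2[of "1 / p" "residual p f q'" "residual p f q"]
        powr_mono2[of "1 / p" "residual p f q" "residual p f q'"] nonneg[of q] nonneg[of q']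
      by (meson less_imp_le not_le)
  qed
  have bdd: "bdd_below (?N ` polys_upto n)" by (intro bdd_belowI[of _ 0]) (auto simp: N_eq)
  have iff: "q \<in> polys_upto n \<and> ?N q = (INF q'\<in>polys_upto n. ?N q')
      \<longleftrightarrow> q \<in> polys_upto n \<and> (\<forall>q'\<in>polys_upto n. residual p f q \<le> residual p f q')" for q
  proof (intro conj_cong refl iffI ballI)
    fix q' assume "?N q = (INF q'\<in>polys_upto n. ?N q')" "q' \<in> polys_upto n"
    then have "?N q \<le> ?N q'" using cINF_lower[OF bdd] by simp
    then show "residual p f q \<le> residual p f q'" by (simp only: le_iff)
  next
    assume q: "q \<in> polys_upto n" and min: "\<forall>q'\<in>polys_upto n. residual p f q \<le> residual p f q'"
    show "?N q = (INF q'\<in>polys_upto n. ?N q')"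
    proof (rule antisym)
      show "?N q \<le> (INF q'\<in>polys_upto n. ?N q')" using q min by (intro cINF_greatest) (auto simp only: le_iff)
      show "(INF q'\<in>polys_upto n. ?N q') \<le> ?N q" by (rule cINF_lower[OF bdd q])
    qed
  qed
  have "\<exists>!q. q \<in> polys_upto n \<and> (\<forall>q'\<in>polys_upto n. residual p f q \<le> residual p f q')"
  proof -
    obtain q where q: "q \<in> polys_upto n" "\<forall>q'\<in>polys_upto n. residual p f q \<le> residual p f q'"
      using residual_minimizer_exists[OF p f f0, of n] by blast
    show ?thesis
    proof (rule ex1I[of _ q])
      fix r assume "r \<in> polys_upto n \<and> (\<forall>q'\<in>polys_upto n. residual p f r \<le> residual p f q')"
      then show "r = q" using q by (intro residual_minimizer_unique[OF p f f0]) auto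
    qed (use q in blast)
  qed
  then have "\<exists>!q. q \<in> polys_upto n \<and> ?N q = (INF q'\<in>polys_upto n. ?N q')" by (simp only: iff)
  from theI'[OF this, folded opt_poly_approx_def] iff
  have "opt_poly_approx p n f \<in> polys_upto n \<and>
      (\<forall>q'\<in>polys_upto n. residual p f (opt_poly_approx p n f) \<le> residual p f q')"
    by blast
  then show "opt_poly_approx p n f \<in> polys_upto n"
    "q \<in> polys_upto n \<Longrightarrow> residual p f (opt_poly_approx p n f) \<le> residual p f q" by auto
qed

text \<open>On circles of radius at least \<open>(1 + \<bar>w\<bar>) / 2\<close> one has \<open>\<bar>z - w\<bar> \<ge> (1 - \<bar>w\<bar>) / 2\<close>, and only the limit
  of the means matters.\<close>

lemma hardy_sup_divide_le:
  assumes p: "1 < p" and x: "x \<in> hardy_space p" and w: "cmod w < 1"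
  shows "hardy_sup p x \<le> (2 / (1 - cmod w)) powr p * hardy_sup p (\<lambda>z. (z - w) * x z)"
proof -
  define b where "b = 2 / (1 - cmod w)"
  have b: "0 < b" using w by (simp add: b_def)
  have zxH: "(\<lambda>z. (z - w) * x z) \<in> hardy_space p"
    using poly_mult_hardy[OF p x, of "[:- w, 1:]"] by simp
  have ev: "\<forall>\<^sub>F r in at_left 1. hardy_mean p x r \<le> b powr p * hardy_mean p (\<lambda>z. (z - w) * x z) r"
  proof -
    have "\<forall>\<^sub>F r in at_left 1. r \<in> {(1 + cmod w) / 2<..<1}"
      using w by (intro eventually_at_leftI[of "(1 + cmod w) / 2"]) auto
    then show ?thesis
    proof eventually_elim
      case (elim r)
      then have r1: "r < 1" "(1 + cmod w) / 2 < r" by auto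
      have "0 < (1 + cmod w) / 2" by (simp add: add_pos_nonneg)
      from less_trans[OF this r1(2)] r1
      have r: "0 < r" "r < 1" "(1 - cmod w) / 2 \<le> r - cmod w"
        by (auto simp: field_simps)
      have c: "continuous_on (sphere 0 r) (\<lambda>z. cmod ((z - w) * x z) powr p)"
        by (intro continuous_on_cmod_powr p holomorphic_continuous_circle hardy_space_holomorphic[OF zxH] r)
      have "hardy_mean p x r \<le> circle_mean (\<lambda>z. b powr p * cmod ((z - w) * x z) powr p) r"
        unfolding hardy_mean_eq
      proof (rule circle_mean_mono)
        show "continuous_on (sphere 0 r) (\<lambda>z. cmod (x z) powr p)"
          by (intro continuous_on_cmod_powr p holomorphic_continuous_circle hardy_space_holomorphic[OF x] r)
        fix z :: complex assume z: "cmod z = r"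
        have "(1 - cmod w) / 2 \<le> cmod (z - w)" using norm_triangle_ineq2[of z w] z r by linarith
        then have "b * ((1 - cmod w) / 2) \<le> b * cmod (z - w)" using b by (intro mult_left_mono) auto
        moreover have "b * ((1 - cmod w) / 2) = 1" using w by (simp add: b_def)
        ultimately have "1 \<le> b * cmod (z - w)" by simp
        then have "1 * cmod (x z) \<le> b * cmod (z - w) * cmod (x z)" by (intro mult_right_mono) auto
        then have "cmod (x z) powr p \<le> (b * cmod ((z - w) * x z)) powr p"
          using p by (intro powr_mono2) (auto simp: norm_mult mult.assoc)
        then show "cmod (x z) powr p \<le> b powr p * cmod ((z - w) * x z) powr p"
          by (simp only: powr_mult)
      qed (use c r in \<open>auto intro!: continuous_on_mult_left\<close>)
      also have "\<dots> = b powr p * hardy_mean p (\<lambda>z. (z - w) * x z) r"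
        unfolding hardy_mean_eq using c r by (intro circle_mean_mult_left) auto
      finally show ?case .
    qed
  qed
  have "((\<lambda>r. b powr p * hardy_mean p (\<lambda>z. (z - w) * x z) r) \<longlongrightarrow> b powr p * hardy_sup p (\<lambda>z. (z - w) * x z)) (at_left 1)"
    by (intro tendsto_intros hardy_mean_tendsto_sup p zxH)
  from tendsto_le[OF trivial_limit_at_left_real this hardy_mean_tendsto_sup[OF p x] ev]
  show ?thesis by (simp only: b_def)
qed

text \<open>Polynomials of large degree come as close to \<open>\<phi>\<close> as desired, so the residuals of the optimal ones
  tend to the distance \<open>d\<close>, in \<open>p\<close>-th power. The average of \<open>1 - \<phi>\<close> and such a residual
  is again \<open>1\<close> minus an element of the subspace, hence not below \<open>d\<close>, and uniform convexity applies.\<close>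

lemma opt_poly_approx_converges:
  assumes p: "1 < p" and f: "f \<in> hardy_space p" and f0: "f 0 \<noteq> 0"
    and \<phi>: "\<phi> \<in> cyclic_subspace p f"
    and min: "\<And>v. v \<in> cyclic_subspace p f \<Longrightarrow> hardy_sup p (\<lambda>z. 1 - \<phi> z) \<le> hardy_sup p (\<lambda>z. 1 - v z)"
  shows "(\<lambda>n. hardy_sup p (\<lambda>z. poly (opt_poly_approx p n f) z * f z - \<phi> z)) \<longlonglongrightarrow> 0"
proof -
  interpret closed_invariant_subspace p "cyclic_subspace p f"
    by (rule cyclic_subspace_closed_invariant[OF p f])
  define d where "d = hardy_sup p (\<lambda>z. 1 - \<phi> z)"
  define q where "q = (\<lambda>n. opt_poly_approx p n f)"
  have qE: "(\<lambda>z. poly r z * f z) \<in> cyclic_subspace p f" for r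
    by (rule poly_mult_mem_cyclic_subspace[OF p f])
  have H: "(\<lambda>z. 1 - v z) \<in> hardy_space p" if "v \<in> cyclic_subspace p f" for v
    by (intro hardy_diff hardy_const p sub that)
  have d0: "0 \<le> d" unfolding d_def by (rule hardy_sup_nonneg[OF p H[OF \<phi>]])
  have near: "\<forall>\<^sub>F n in sequentially. residual p f (q n) < d + e" if e: "0 < e" for e
  proof -
    \<comment> \<open>Both \<open>e1 d\<close> and the contribution of the approximation error to the sum below are at most \<open>e / 2\<close>.\<close>
    define e1 where "e1 = e / (2 * (d + 1))"
    have e1: "0 < e1" "e1 * d \<le> e / 2" using e d0 by (auto simp: e1_def field_simps)
    obtain C where C: "C \<ge> 0" "\<And>u v. u \<in> hardy_space p \<Longrightarrow> v \<in> hardy_space p \<Longrightarrow>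
      hardy_sup p (\<lambda>z. u z + v z) \<le> (1 + e1) * hardy_sup p u + C * hardy_sup p v"
      using hardy_sup_add_le[OF p e1(1)] by auto
    have "0 < e / (2 * (C + 1))" using e C(1) by simp
    then obtain r where r: "hardy_sup p (\<lambda>z. \<phi> z - poly r z * f z) < e / (2 * (C + 1))"
      by (rule cyclic_subspace_approx[OF \<phi>])
    have "hardy_sup p (\<lambda>z. (1 - \<phi> z) + (\<phi> z - poly r z * f z)) \<le> (1 + e1) * d + C * hardy_sup p (\<lambda>z. \<phi> z - poly r z * f z)"
      unfolding d_def by (rule C(2)[OF H[OF \<phi>] sub[OF diff[OF \<phi> qE]]])
    also have "C * hardy_sup p (\<lambda>z. \<phi> z - poly r z * f z) \<le> C * (e / (2 * (C + 1)))"
      using r C(1) by (intro mult_left_mono) auto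
    also have "C * (e / (2 * (C + 1))) < e / 2" using C(1) e by (simp add: field_simps)
    finally have res: "residual p f r < d + e" using e1(2) by (simp add: residual_def algebra_simps)
    show ?thesis
      using eventually_ge_at_top[of "degree r"]
    proof eventually_elim
      case (elim n)
      then have "r \<in> polys_upto n" by (simp add: polys_upto_def)
      from opt_poly_approx_minimizer(2)[OF p f f0 this] res show ?case unfolding q_def by linarith
    qed
  qed
  show ?thesis
  proof (rule LIMSEQ_I)
    fix e :: real assume e: "0 < e"
    \<comment> \<open>Eventually the two norms add up to at most \<open>2 d + 1\<close>, so the first term of the convexity inequality is at most \<open>e / 2\<close>.\<close>
    define e1 where "e1 = e / (2 * (2 * d + 1))"
    have e1: "0 < e1" "e1 * (2 * d + 1) = e / 2" using e d0 by (auto simp: e1_def field_simps)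
    obtain D where D: "D \<ge> 0" "\<And>u v. u \<in> hardy_space p \<Longrightarrow> v \<in> hardy_space p \<Longrightarrow>
      hardy_sup p (\<lambda>z. u z - v z) \<le> e1 * (hardy_sup p u + hardy_sup p v)
      + D * ((hardy_sup p u + hardy_sup p v) / 2 - hardy_sup p (\<lambda>z. (u z + v z) / 2))"
      using hardy_sup_uniform_convexity[OF p e1(1)] by auto
    define e2 where "e2 = min 1 (e / (2 * (D + 1)))"
    have e2: "0 < e2" "e2 \<le> 1" using e D(1) by (auto simp: e2_def)
    have De2: "D * e2 < e / 2"
    proof -
      have "D * e2 \<le> D * (e / (2 * (D + 1)))" using D(1) by (intro mult_left_mono) (auto simp: e2_def)
      also have "\<dots> < e / 2" using D(1) e by (simp add: field_simps)
      finally show ?thesis .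
    qed
    obtain N where N: "\<And>n. N \<le> n \<Longrightarrow> residual p f (q n) < d + e2"
      using near[OF e2(1)] by (auto simp: eventually_sequentially)
    have "norm (hardy_sup p (\<lambda>z. poly (q n) z * f z - \<phi> z) - 0) < e" if n: "N \<le> n" for n
    proof -
      let ?u = "\<lambda>z. 1 - \<phi> z" and ?v = "\<lambda>z. 1 - poly (q n) z * f z"
      have res: "hardy_sup p ?v < d + e2" using N[OF n] by (simp only: residual_def)
      have "(\<lambda>z. (?u z + ?v z) / 2) = (\<lambda>z. 1 - (\<phi> z + poly (q n) z * f z) / 2)"
        by (auto simp: field_simps)
      with min[OF midpoint[OF \<phi> qE]] have mid: "d \<le> hardy_sup p (\<lambda>z. (?u z + ?v z) / 2)"
        by (simp only: d_def)
      have "(\<lambda>z. poly (q n) z * f z - \<phi> z) = (\<lambda>z. ?u z - ?v z)" by auto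
      then have "hardy_sup p (\<lambda>z. poly (q n) z * f z - \<phi> z) \<le> e1 * (d + hardy_sup p ?v)
          + D * ((d + hardy_sup p ?v) / 2 - hardy_sup p (\<lambda>z. (?u z + ?v z) / 2))"
        using D(2)[OF H[OF \<phi>] H[OF qE]] by (simp only: d_def)
      also have "\<dots> \<le> e1 * (2 * d + 1) + D * e2"
      proof (rule add_mono; rule mult_left_mono)
        show "d + hardy_sup p ?v \<le> 2 * d + 1" using res e2(2) by linarith
        have "(d + hardy_sup p ?v) / 2 \<le> d + e2" using res e2(1) by (simp add: field_simps)
        from diff_mono[OF this mid]
        show "(d + hardy_sup p ?v) / 2 - hardy_sup p (\<lambda>z. (?u z + ?v z) / 2) \<le> e2"
          by (simp only: add_diff_cancel_left')
      qed (use e1 D(1) in auto)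
      also have "\<dots> < e" using e1(2) De2 by linarith
      finally have "hardy_sup p (\<lambda>z. poly (q n) z * f z - \<phi> z) < e" .
      moreover have "0 \<le> hardy_sup p (\<lambda>z. poly (q n) z * f z - \<phi> z)"
        by (rule hardy_sup_nonneg[OF p sub[OF diff[OF qE \<phi>]]])
      ultimately show ?thesis by simp
    qed
    then show "\<exists>N. \<forall>n\<ge>N. norm (hardy_sup p (\<lambda>z. poly (opt_poly_approx p n f) z * f z - \<phi> z) - 0) < e"
      unfolding q_def by blast
  qed
qed

text \<open>The quotients \<open>(q\<^sub>n(z) - q\<^sub>n(w)) / (z - w)\<close> are polynomials. Multiplied by \<open>f\<close> they stay bounded in norm, because
  division by \<open>z - w\<close> is bounded on functions divisible by it, and they converge
  pointwise to \<open>\<phi> / (z - w)\<close>.\<close>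

lemma zero_divides_in_cyclic_subspace:
  assumes p: "1 < p" and f: "f \<in> hardy_space p" and f0: "f 0 \<noteq> 0"
    and \<phi>: "\<phi> \<in> hardy_space p"
    and lim: "(\<lambda>n. hardy_sup p (\<lambda>z. poly (q n) z * f z - \<phi> z)) \<longlonglongrightarrow> 0"
    and w: "cmod w < 1" and qw: "(\<lambda>n. poly (q n) w) \<longlonglongrightarrow> 0"
  obtains \<psi> where "\<psi> \<in> cyclic_subspace p f" "\<And>z. cmod z < 1 \<Longrightarrow> \<phi> z = (z - w) * \<psi> z"
proof -
  interpret closed_invariant_subspace p "cyclic_subspace p f"
    by (rule cyclic_subspace_closed_invariant[OF p f])
  define s where "s = (\<lambda>n. synthetic_div (q n) w)"
  define x where "x = (\<lambda>n z. poly (s n) z * f z)"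
  have xE: "x n \<in> cyclic_subspace p f" for n
    unfolding x_def by (rule poly_mult_mem_cyclic_subspace[OF p f])
  note hf = hardy_space_holomorphic[OF f]
  have qH: "(\<lambda>z. poly r z * f z) \<in> hardy_space p" for r by (rule poly_mult_hardy[OF p f])
  have zx: "(z - w) * x n z = (poly (q n) z * f z - \<phi> z) + (\<phi> z - poly (q n) w * f z)" for n z
    unfolding x_def s_def poly_synthetic_div[of "q n" z w] by (simp add: algebra_simps)
  obtain C where C: "C \<ge> 0" "\<And>u v. u \<in> hardy_space p \<Longrightarrow> v \<in> hardy_space p \<Longrightarrow>
      hardy_sup p (\<lambda>z. u z + v z) \<le> (1 + 1) * hardy_sup p u + C * hardy_sup p v"
    using hardy_sup_add_le[OF p, of 1] by auto
  have zx_lim: "(\<lambda>n. hardy_sup p (\<lambda>z. (z - w) * x n z - \<phi> z)) \<longlonglongrightarrow> 0"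
  proof (rule tendsto_sandwich[OF _ _ tendsto_const])
    have mem: "(\<lambda>z. (z - w) * x n z - \<phi> z) \<in> hardy_space p" for n
      using hardy_diff[OF p poly_mult_hardy[OF p sub[OF xE], of "[:- w, 1:]"] \<phi>] by simp
    show "\<forall>\<^sub>F n in sequentially. 0 \<le> hardy_sup p (\<lambda>z. (z - w) * x n z - \<phi> z)"
      using hardy_sup_nonneg[OF p mem] by simp
    have "hardy_sup p (\<lambda>z. (z - w) * x n z - \<phi> z) \<le> (1 + 1) * hardy_sup p (\<lambda>z. poly (q n) z * f z - \<phi> z)
        + C * (cmod (poly (q n) w) powr p * hardy_sup p f)" for n
    proof -
      have "(\<lambda>z. (z - w) * x n z - \<phi> z) = (\<lambda>z. (poly (q n) z * f z - \<phi> z) + (- poly (q n) w) * f z)"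
        unfolding zx by auto
      then show ?thesis
        using C(2)[OF hardy_diff[OF p qH \<phi>] hardy_scale(1)[OF p f], of "q n" "- poly (q n) w"]
        by (simp only: hardy_scale(2)[OF p f] norm_minus_cancel)
    qed
    then show "\<forall>\<^sub>F n in sequentially. hardy_sup p (\<lambda>z. (z - w) * x n z - \<phi> z)
        \<le> (1 + 1) * hardy_sup p (\<lambda>z. poly (q n) z * f z - \<phi> z) + C * (cmod (poly (q n) w) powr p * hardy_sup p f)"
      by simp
    have qp: "(\<lambda>n. cmod (poly (q n) w) powr p) \<longlonglongrightarrow> cmod 0 powr p"
      using p by (intro tendsto_powr' tendsto_intros qw) auto
    have "(\<lambda>n. (1 + 1) * hardy_sup p (\<lambda>z. poly (q n) z * f z - \<phi> z) + C * (cmod (poly (q n) w) powr p * hardy_sup p f))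
      \<longlonglongrightarrow> (1 + 1) * 0 + C * (cmod 0 powr p * hardy_sup p f)"
      by (intro tendsto_add tendsto_mult tendsto_const lim qp)
    then show "(\<lambda>n. (1 + 1) * hardy_sup p (\<lambda>z. poly (q n) z * f z - \<phi> z) + C * (cmod (poly (q n) w) powr p * hardy_sup p f))
      \<longlonglongrightarrow> 0" by simp
  qed
  have zxH: "(\<lambda>z. (z - w) * x n z) \<in> hardy_space p" for n
    using poly_mult_hardy[OF p sub[OF xE], of "[:- w, 1:]"] by simp
  have "\<exists>a\<in>ball 0 1. (a - w) * f a \<noteq> 0"
  proof -
    have "infinite ({z. cmod z < 1 \<and> f z \<noteq> 0} - {w})"
      using infinite_nonzero_set[OF hf f0] by simp
    then obtain a where "a \<in> {z. cmod z < 1 \<and> f z \<noteq> 0} - {w}" by (metis finite.emptyI ex_in_conv)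
    then show ?thesis by (intro bexI[of _ a]) auto
  qed
  then obtain a where a: "a \<in> ball 0 1" "(a - w) * f a \<noteq> 0" by blast
  have unif: "uniform_limit (cball 0 \<rho>) (\<lambda>n z. poly (s n) z * ((z - w) * f z)) \<phi> sequentially" if "\<rho> < 1" for \<rho>
    using hardy_convergence_locally_uniform[OF p zxH \<phi> zx_lim that]
    by (simp add: x_def mult_ac)
  have "poly (s n) holomorphic_on ball 0 1" "(\<lambda>z. (z - w) * f z) holomorphic_on ball 0 1" for n
    by (intro holomorphic_intros hf)+
  from quotient_locally_uniform[OF this a unif]
  obtain G where G: "\<And>\<rho>. \<rho> < 1 \<Longrightarrow> uniform_limit (cball 0 \<rho>) (\<lambda>n. poly (s n)) G sequentially"
    "\<And>z. cmod z < 1 \<Longrightarrow> \<phi> z = G z * ((z - w) * f z)"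
    by auto
  have "Bseq (\<lambda>n. hardy_sup p (\<lambda>z. (z - w) * x n z - \<phi> z))"
    using zx_lim convergent_imp_Bseq convergentI by blast
  then obtain M where M: "\<And>n. hardy_sup p (\<lambda>z. (z - w) * x n z - \<phi> z) \<le> M"
    unfolding Bseq_def by (metis abs_le_D1 real_norm_def)
  have bound: "hardy_sup p (x n) \<le> (2 / (1 - cmod w)) powr p * ((1 + 1) * M + C * hardy_sup p \<phi>)" for n
  proof -
    have "hardy_sup p (\<lambda>z. ((z - w) * x n z - \<phi> z) + \<phi> z)
        \<le> (1 + 1) * hardy_sup p (\<lambda>z. (z - w) * x n z - \<phi> z) + C * hardy_sup p \<phi>"
      by (rule C(2)[OF hardy_diff[OF p zxH \<phi>] \<phi>])
    then have "hardy_sup p (\<lambda>z. (z - w) * x n z) \<le> (1 + 1) * M + C * hardy_sup p \<phi>"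
      using M[of n] by simp
    then have "(2 / (1 - cmod w)) powr p * hardy_sup p (\<lambda>z. (z - w) * x n z)
        \<le> (2 / (1 - cmod w)) powr p * ((1 + 1) * M + C * hardy_sup p \<phi>)"
      by (intro mult_left_mono) auto
    then show ?thesis using hardy_sup_divide_le[OF p sub[OF xE] w, of n] by linarith
  qed
  show thesis
  proof (rule that[of "\<lambda>z. G z * f z"])
    show "(\<lambda>z. G z * f z) \<in> cyclic_subspace p f"
    proof (rule bounded_pointwise_limit_mem[OF xE bound])
      fix z :: complex assume z: "cmod z < 1"
      have "(\<lambda>n. poly (s n) z) \<longlonglongrightarrow> G z" by (rule tendsto_uniform_limitI[OF G(1)[OF z]]) simp
      then show "(\<lambda>n. x n z) \<longlonglongrightarrow> G z * f z" unfolding x_def by (intro tendsto_intros)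
    qed
    show "\<phi> z = (z - w) * (G z * f z)" if "cmod z < 1" for z
      using G(2)[OF that] by (simp add: mult_ac)
  qed
qed

theorem proposition4p6:
  fixes p :: real and f :: "complex \<Rightarrow> complex" and K :: "complex set"
  assumes "1 < p"
    and "f \<in> hardy_space p"
    and "f 0 \<noteq> 0"
    and "compact K"
    and "K \<subseteq> ball 0 1"
  shows "\<exists>N::nat. \<forall>n\<ge>N. \<forall>z. poly (opt_poly_approx p n f) z = 0 \<longrightarrow> z \<notin> K"
proof -
  note p = assms(1) and f = assms(2) and f0 = assms(3)
  define E where "E = cyclic_subspace p f"
  interpret closed_invariant_subspace p E
    unfolding E_def by (rule cyclic_subspace_closed_invariant[OF p f])
  define q where "q = (\<lambda>n. opt_poly_approx p n f)"
  have qE: "(\<lambda>z. poly r z * f z) \<in> E" for r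
    unfolding E_def by (rule poly_mult_mem_cyclic_subspace[OF p f])
  have "\<exists>v\<in>E. v 0 \<noteq> 0" using qE[of 1] f0 by (intro bexI[of _ "\<lambda>z. poly 1 z * f z"]) auto
  then obtain J c where J: "J \<in> E" "0 < c" "J 0 = of_real c" "hardy_sup p J = 1"
    "\<And>v. v \<in> E \<Longrightarrow> cmod (v 0) powr p \<le> c powr p * hardy_sup p v"
    by (rule extremal_function_exists) blast
  interpret extremal_function p E J c by unfold_locales (use J in auto)
  obtain \<phi> S B where \<phi>: "\<phi> \<in> E"
    and min: "\<And>v. v \<in> E \<Longrightarrow> hardy_sup p (\<lambda>z. 1 - \<phi> z) \<le> hardy_sup p (\<lambda>z. 1 - v z)"
    and S: "S holomorphic_on ball 0 1" "\<And>z. cmod z < 1 \<Longrightarrow> cmod (S z) \<le> B"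
    and JS: "\<And>z. cmod z < 1 \<Longrightarrow> J z = S z * \<phi> z"
    by (rule nearest_point_to_one) blast
  have lim: "(\<lambda>n. hardy_sup p (\<lambda>z. poly (q n) z * f z - \<phi> z)) \<longlonglongrightarrow> 0"
    unfolding q_def by (rule opt_poly_approx_converges[OF p f f0 \<phi>[unfolded E_def] min[unfolded E_def]])
  have unif: "uniform_limit (cball 0 \<rho>) (\<lambda>n z. poly (q n) z * f z) \<phi> sequentially" if "\<rho> < 1" for \<rho>
    by (rule hardy_convergence_locally_uniform[OF p sub[OF qE] sub[OF \<phi>] lim that])
  have "poly (q n) holomorphic_on ball 0 1" for n by (intro holomorphic_intros)
  from quotient_locally_uniform[OF this hardy_space_holomorphic[OF f] _ f0 unif]
  obtain G where G: "G holomorphic_on ball 0 1"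
    "\<And>\<rho>. \<rho> < 1 \<Longrightarrow> uniform_limit (cball 0 \<rho>) (\<lambda>n. poly (q n)) G sequentially"
    by auto
  have G_nz: "G w \<noteq> 0" if w: "cmod w < 1" for w
  proof
    assume "G w = 0"
    moreover have "(\<lambda>n. poly (q n) w) \<longlonglongrightarrow> G w" by (rule tendsto_uniform_limitI[OF G(2)[OF w]]) simp
    ultimately have "(\<lambda>n. poly (q n) w) \<longlonglongrightarrow> 0" by simp
    from zero_divides_in_cyclic_subspace[OF p f f0 sub[OF \<phi>] lim w this]
    obtain \<psi> where \<psi>: "\<psi> \<in> E" "\<And>z. cmod z < 1 \<Longrightarrow> \<phi> z = (z - w) * \<psi> z"
      unfolding E_def by blast
    have "(\<lambda>z. S z * \<psi> z) \<in> E" by (rule bounded_holomorphic_mult[OF \<psi>(1) S])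
    then show False by (rule no_zero_factor[OF w]) (simp add: JS \<psi>(2))
  qed
  show ?thesis
  proof (cases "K = {}")
    case False
    obtain z0 where z0: "z0 \<in> K" "\<And>z. z \<in> K \<Longrightarrow> cmod z \<le> cmod z0"
      using continuous_attains_sup[OF assms(4) False continuous_on_norm_id] by blast
    have \<rho>: "cmod z0 < 1" using z0(1) assms(5) by auto
    have K: "K \<subseteq> cball 0 (cmod z0)" using z0(2) by auto
    have "continuous_on K (\<lambda>z. cmod (G z))"
      using continuous_on_subset[OF holomorphic_on_imp_continuous_on[OF G(1)] assms(5)]
      by (rule continuous_on_norm)
    then obtain z1 where z1: "z1 \<in> K" "\<And>z. z \<in> K \<Longrightarrow> cmod (G z1) \<le> cmod (G z)"
      using continuous_attains_inf[OF assms(4) False] by blast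
    have "0 < cmod (G z1)" using G_nz[of z1] z1(1) assms(5) by auto
    then have "\<forall>\<^sub>F n in sequentially. \<forall>z\<in>cball 0 (cmod z0). dist (poly (q n) z) (G z) < cmod (G z1)"
      by (rule uniform_limitD[OF G(2)[OF \<rho>]])
    then obtain N where N: "\<And>n z. N \<le> n \<Longrightarrow> z \<in> cball 0 (cmod z0) \<Longrightarrow> dist (poly (q n) z) (G z) < cmod (G z1)"
      unfolding eventually_sequentially by blast
    show ?thesis
    proof (intro exI[of _ N] allI impI notI)
      fix n z assume "N \<le> n" "poly (opt_poly_approx p n f) z = 0" "z \<in> K"
      then show False using N[of n z] z1(2)[of z] K by (auto simp: q_def)
    qed
  qed auto
qed

end
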